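(* Let $\{P_i\}_i$ be a sequence of Delzant polytopes in $\mathbb{R}^n$ and let $P$ be a Delzant polytope in $\mathbb{R}^n$. Suppose that $d^H(P_i,P)\to 0$ as $i\to\infty$ and that the limit as $i\to\infty$ of the number of facets of $P_i$ exists and equals the number of facets of $P$. Then the sequence of symplectic toric manifolds $\{M_{P_i}\}_i$, each equipped with its Guillemin metric, converges to $M_P$ (with its Guillemin metric) in the $T^n$-equivariant Gromov-Hausdorff topology.
   Context: $d^H$ is the Hausdorff distance on compact subsets of $\mathbb{R}^n$. Delzant polytopes. An $n$-dimensional convex polytope $P\subset\mathbb{R}^n$ is a Delzant polytope if each vertex of $P$ lies on exactly $n$ edges, and at each vertex the directional vectors of the edges can be taken to be integral vectors forming a $\mathbb{Z}$-basis of $\mathbb{Z}^n$. Delzant construction and Guillemin metric. Let $P$ be a Delzant polytope with $N$ facets, written $P=\bigcap_{r=1}^N\{x\in\mathbb{R}^n \mid l^{(r)}(x)\ge 0\}$ with $l^{(r)}(x)=\langle x,\nu^{(r)}\rangle-\lambda^{(r)}$, where $\nu^{(r)}\in\mathbb{Z}^n$ is the primitive inward normal vector of the $r$-th facet. Let $T^k=\mathbb{R}^k/\mathbb{Z}^k$. The torus $T^N$ acts on $\mathbb{C}^N$ by $[\theta]\cdot z=(e^{2\pi\sqrt{-1}\theta_r}z_r)_r$. Equip $\mathbb{C}^N$ with the standard flat Kähler structure scaled by $1/\pi$ (metric $\frac1\pi\sum_r(du_r^2+dv_r^2)$, symplectic form $\frac1\pi\sum_r du_r\wedge dv_r$, $z_r=u_r+\sqrt{-1}v_r$).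 The linear map $\mathbb{R}^N\to\mathbb{R}^n$, $e_r\mapsto\nu^{(r)}$, induces a surjective homomorphism $T^N\to T^n$; let $H$ be its kernel, a subtorus of dimension $N-n$. Let $Z_P:=\{z\in\mathbb{C}^N \mid \exists x\in\mathbb{R}^n,\ |z_r|^2=l^{(r)}(x)\text{ for all } r\}$ (a zero level set of a moment map for the $H$-action). It is a compact submanifold on which $H$ acts freely, and $M_P:=Z_P/H$ is a compact Kähler manifold of real dimension $2n$ (Kähler reduction), with an effective isometric Hamiltonian action of $T=T^n=T^N/H$. The Riemannian metric on $M_P$ induced from $\mathbb{C}^N$ (the quotient metric, making $Z_P\to M_P$ a Riemannian submersion) is called the Guillemin metric. $M_P$ is regarded as a metric space by its Riemannian distance. Equivariant Gromov-Hausdorff convergence. Let $(X,d)$ and $(X_i,d_i)$ be compact metric spaces on each of which a group $G$ acts effectively by isometries. $\{X_i\}_i$ converges to $X$ in the $G$-equivariant Gromov-Hausdorff topology if there exist maps $f_i:X_i\to X$ (approximation maps), group automorphisms $\rho_i:G\to G$ and numbers $\epsilon_i>0$ with $\epsilon_i\to0$ such that for all large $i$: $|d_i(x,y)-d(f_i(x),f_i(y))|<\epsilon_i$ for all $x,y\in X_i$; for any $p\in X$ there is $x\in X_i$ with $d(p,f_i(x))<\epsilon_i$; and $d(f_i(gx),\rho_i(g)f_i(x))<\epsilon_i$ for all $x\in X_i$, $g\in G$. *)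

theory Defs
  imports "HOL-Analysis.Analysis" "HOL-Algebra.Group_Action"
begin

section \<open>Delzant polytopes\<close>

definition int_lattice :: "(real ^ 'n) set" where
  "int_lattice = {x. \<forall>i. x $ i \<in> \<int>}"

definition int_lattice_basis :: "(real ^ 'n) set \<Rightarrow> bool" where
  "int_lattice_basis B \<longleftrightarrow> finite B \<and> B \<subseteq> int_lattice \<and>
     (\<forall>x\<in>int_lattice. \<exists>!a. a \<in> B \<rightarrow>\<^sub>E (UNIV :: int set) \<and> x = (\<Sum>b\<in>B. real_of_int (a b) *\<^sub>R b))"

definition edges_at :: "(real ^ 'n) set \<Rightarrow> real ^ 'n \<Rightarrow> (real ^ 'n) set set" where
  "edges_at P v = {e. e edge_of P \<and> v \<in> e}"

definition delzant :: "(real ^ 'n) set \<Rightarrow> bool" where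
  "delzant P \<longleftrightarrow> polytope P \<and> aff_dim P = int CARD('n) \<and>
     (\<forall>v. v extreme_point_of P \<longrightarrow>
        finite (edges_at P v) \<and> card (edges_at P v) = CARD('n) \<and>
        (\<exists>u. (\<forall>e\<in>edges_at P v. \<exists>c>0. e = closed_segment v (v + c *\<^sub>R u e)) \<and>
             int_lattice_basis (u ` edges_at P v)))"

definition facets :: "(real ^ 'n) set \<Rightarrow> (real ^ 'n) set set" where
  "facets P = {F. F facet_of P}"

definition primitive_vec :: "real ^ 'n \<Rightarrow> bool" where
  "primitive_vec \<nu> \<longleftrightarrow> \<nu> \<in> int_lattice \<and>
     (\<forall>w\<in>int_lattice. \<forall>k::nat. \<nu> = real k *\<^sub>R w \<longrightarrow> k = 1)"

definition facet_normal :: "(real ^ 'n) set \<Rightarrow> (real ^ 'n) set \<Rightarrow> real ^ 'n" where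
  "facet_normal P F =
     (THE \<nu>. primitive_vec \<nu> \<and> (\<exists>c. P \<subseteq> {x. c \<le> x \<bullet> \<nu>} \<and> F = P \<inter> {x. x \<bullet> \<nu> = c}))"

definition facet_offset :: "(real ^ 'n) set \<Rightarrow> (real ^ 'n) set \<Rightarrow> real" where
  "facet_offset P F = (THE c. \<forall>x\<in>F. x \<bullet> facet_normal P F = c)"

definition facet_form :: "(real ^ 'n) set \<Rightarrow> (real ^ 'n) set \<Rightarrow> real ^ 'n \<Rightarrow> real" where
  "facet_form P F x = x \<bullet> facet_normal P F - facet_offset P F"

text \<open>For nonempty compact sets.\<close>

definition hausdorff_dist :: "'a::metric_space set \<Rightarrow> 'a set \<Rightarrow> real" where
  "hausdorff_dist A B = max (SUP x\<in>A. infdist x B) (SUP y\<in>B. infdist y A)"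


section \<open>The Delzant construction\<close>

text \<open>
  The \<open>N\<close> coordinates of \<open>\<complex>\<^sup>N\<close>, \<open>\<real>\<^sup>N\<close> and \<open>T\<^sup>N\<close> are indexed by the facets of \<open>P\<close> themselves.
  A vector of \<open>\<complex>\<^sup>N\<close> is a function that vanishes off \<open>facets P\<close>. An element of \<open>T\<^sup>N\<close> is
  represented by an angle function, whose values off \<open>facets P\<close> are irrelevant.
\<close>

type_synonym 'n cvec = "(real ^ 'n) set \<Rightarrow> complex"

definition rotate_by :: "((real ^ 'n) set \<Rightarrow> real) \<Rightarrow> 'n cvec \<Rightarrow> 'n cvec" where
  "rotate_by \<theta> z = (\<lambda>F. exp (2 * of_real pi * \<i> * of_real (\<theta> F)) * z F)"

text \<open>The linear map \<open>\<real>\<^sup>N \<rightarrow> \<real>\<^sup>n\<close> sending each basis vector to the corresponding normal.\<close>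

definition normal_map :: "(real ^ 'n) set \<Rightarrow> ((real ^ 'n) set \<Rightarrow> real) \<Rightarrow> real ^ 'n" where
  "normal_map P \<theta> = (\<Sum>F\<in>facets P. \<theta> F *\<^sub>R facet_normal P F)"

definition level_set :: "(real ^ 'n) set \<Rightarrow> 'n cvec set" where
  "level_set P = {z. (\<forall>F. F \<notin> facets P \<longrightarrow> z F = 0) \<and>
                     (\<exists>x. \<forall>F\<in>facets P. (cmod (z F))\<^sup>2 = facet_form P F x)}"

text \<open>
  The angle functions \<open>\<theta>\<close> with \<open>normal_map P \<theta> \<in> int_lattice\<close> represent exactly the elements of
  the kernel \<open>H\<close> of \<open>T\<^sup>N \<rightarrow> T\<^sup>n\<close>.
\<close>

definition H_orbit :: "(real ^ 'n) set \<Rightarrow> 'n cvec \<Rightarrow> 'n cvec set" where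
  "H_orbit P z = {rotate_by \<theta> z | \<theta>. normal_map P \<theta> \<in> int_lattice}"

definition toric_manifold :: "(real ^ 'n) set \<Rightarrow> 'n cvec set set" where
  "toric_manifold P = H_orbit P ` level_set P"

definition torus :: "(real ^ 'n) set monoid" where
  "torus = \<lparr>carrier = UNIV, mult = (+), one = 0\<rparr> Mod int_lattice"

text \<open>
  An element \<open>g\<close> of the torus is a coset in \<open>\<real>\<^sup>n\<close>, so \<open>normal_map P \<theta> \<in> g\<close> says that
  \<open>T\<^sup>N \<rightarrow> T\<^sup>n\<close> maps the class of \<open>\<theta>\<close> to \<open>g\<close>; this is the action of \<open>T\<^sup>n = T\<^sup>N / H\<close>.
\<close>

definition torus_action ::
    "(real ^ 'n) set \<Rightarrow> (real ^ 'n) set \<Rightarrow> 'n cvec set \<Rightarrow> 'n cvec set" where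
  "torus_action P g =
     (\<lambda>X\<in>toric_manifold P. {rotate_by \<theta> z | \<theta> z. z \<in> X \<and> normal_map P \<theta> \<in> g})"


section \<open>The Guillemin metric and its distance\<close>

definition flat_inner :: "(real ^ 'n) set \<Rightarrow> 'n cvec \<Rightarrow> 'n cvec \<Rightarrow> real" where
  "flat_inner P v w = (1 / pi) * (\<Sum>F\<in>facets P. v F \<bullet> w F)"

text \<open>The tangent space at \<open>z\<close> of the \<open>H\<close>-orbit of \<open>z\<close>; the Lie algebra of \<open>H\<close> is the kernel of
  \<open>normal_map P\<close>.\<close>

definition vertical_space :: "(real ^ 'n) set \<Rightarrow> 'n cvec \<Rightarrow> 'n cvec set" where
  "vertical_space P z = {(\<lambda>F. 2 * of_real pi * \<i> * of_real (\<xi> F) * z F) | \<xi>. normal_map P \<xi> = 0}"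

definition horizontal_part :: "(real ^ 'n) set \<Rightarrow> 'n cvec \<Rightarrow> 'n cvec \<Rightarrow> 'n cvec" where
  "horizontal_part P z v =
     (THE h. (\<lambda>F. v F - h F) \<in> vertical_space P z \<and> (\<forall>w\<in>vertical_space P z. flat_inner P h w = 0))"

text \<open>
  The quotient metric at \<open>H_orbit P z\<close>, evaluated on the images under the differential of the
  projection of vectors \<open>v\<close>, \<open>w\<close> tangent to the level set at \<open>z\<close>.
\<close>

definition guillemin_metric :: "(real ^ 'n) set \<Rightarrow> 'n cvec \<Rightarrow> 'n cvec \<Rightarrow> 'n cvec \<Rightarrow> real" where
  "guillemin_metric P z v w = flat_inner P (horizontal_part P z v) (horizontal_part P z w)"

definition velocity :: "(real \<Rightarrow> 'n cvec) \<Rightarrow> real \<Rightarrow> 'n cvec" where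
  "velocity \<gamma> t = (\<lambda>F. vector_derivative (\<lambda>s. \<gamma> s F) (at t))"

text \<open>
  \<open>C1_lift P c a b \<gamma>\<close>: on \<open>[a, b]\<close> the curve \<open>c\<close> in the quotient is the projection of the
  \<open>C\<^sup>1\<close> curve \<open>\<gamma>\<close> in the level set. Since the projection is a submersion, the \<open>C\<^sup>1\<close> curves of the
  quotient manifold are those which locally have such lifts.
\<close>

definition C1_lift ::
    "(real ^ 'n) set \<Rightarrow> (real \<Rightarrow> 'n cvec set) \<Rightarrow> real \<Rightarrow> real \<Rightarrow> (real \<Rightarrow> 'n cvec) \<Rightarrow> bool" where
  "C1_lift P c a b \<gamma> \<longleftrightarrow>
     (\<forall>F\<in>facets P. (\<lambda>t. \<gamma> t F) C1_differentiable_on {a..b}) \<and>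
     (\<forall>t\<in>{a..b}. \<gamma> t \<in> level_set P \<and> c t = H_orbit P (\<gamma> t))"

text \<open>
  \<open>c\<close> restricted to \<open>[0, 1]\<close> is a piecewise \<open>C\<^sup>1\<close> curve in the quotient, of length \<open>L\<close>. The
  subdivision \<open>p\<close> is also used to lift \<open>c\<close> piece by piece; the lifts of adjacent pieces need not
  match up. The length does not depend on the choices.
\<close>

definition curve_has_length :: "(real ^ 'n) set \<Rightarrow> (real \<Rightarrow> 'n cvec set) \<Rightarrow> real \<Rightarrow> bool" where
  "curve_has_length P c L \<longleftrightarrow>
     (\<exists>(m::nat) (p::nat \<Rightarrow> real) \<gamma>. p 0 = 0 \<and> p m = 1 \<and>
        (\<forall>k<m. p k < p (Suc k) \<and> C1_lift P c (p k) (p (Suc k)) (\<gamma> k)) \<and>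
        L = (\<Sum>k<m. integral {p k..p (Suc k)}
               (\<lambda>t. sqrt (guillemin_metric P (\<gamma> k t) (velocity (\<gamma> k) t) (velocity (\<gamma> k) t)))))"

text \<open>Set to 0 off \<open>toric_manifold P\<close>, since the locale \<open>Metric_space\<close> constrains the distance
  function also outside the carrier.\<close>

definition guillemin_dist :: "(real ^ 'n) set \<Rightarrow> 'n cvec set \<Rightarrow> 'n cvec set \<Rightarrow> real" where
  "guillemin_dist P X Y =
     (if X \<in> toric_manifold P \<and> Y \<in> toric_manifold P
      then Inf {L. \<exists>c. c 0 = X \<and> c 1 = Y \<and> curve_has_length P c L} else 0)"


section \<open>Equivariant Gromov-Hausdorff convergence\<close>

definition compact_isometric_G_space ::
    "('g, 'm) monoid_scheme \<Rightarrow> 'a set \<Rightarrow> ('a \<Rightarrow> 'a \<Rightarrow> real) \<Rightarrow> ('g \<Rightarrow> 'a \<Rightarrow> 'a) \<Rightarrow> bool" where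
  "compact_isometric_G_space G X d \<phi> \<longleftrightarrow>
     Metric_space X d \<and> compact_space (Metric_space.mtopology X d) \<and>
     faithful_action G X \<phi> \<and>
     (\<forall>g\<in>carrier G. \<forall>x\<in>X. \<forall>y\<in>X. d (\<phi> g x) (\<phi> g y) = d x y)"

definition equivariant_GH_converges ::
    "('g, 'm) monoid_scheme \<Rightarrow>
     (nat \<Rightarrow> 'a set) \<Rightarrow> (nat \<Rightarrow> 'a \<Rightarrow> 'a \<Rightarrow> real) \<Rightarrow> (nat \<Rightarrow> 'g \<Rightarrow> 'a \<Rightarrow> 'a) \<Rightarrow>
     'b set \<Rightarrow> ('b \<Rightarrow> 'b \<Rightarrow> real) \<Rightarrow> ('g \<Rightarrow> 'b \<Rightarrow> 'b) \<Rightarrow> bool" where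
  "equivariant_GH_converges G Xs ds \<phi>s X d \<phi> \<longleftrightarrow>
     (\<forall>i. compact_isometric_G_space G (Xs i) (ds i) (\<phi>s i)) \<and>
     compact_isometric_G_space G X d \<phi> \<and>
     (\<exists>f \<rho> \<epsilon>.
        (\<forall>i. f i \<in> Xs i \<rightarrow> X) \<and> (\<forall>i. \<rho> i \<in> iso G G) \<and>
        (\<forall>i. \<epsilon> i > 0) \<and> \<epsilon> \<longlonglongrightarrow> 0 \<and>
        (\<forall>\<^sub>F i in sequentially.
           (\<forall>x\<in>Xs i. \<forall>y\<in>Xs i. \<bar>ds i x y - d (f i x) (f i y)\<bar> < \<epsilon> i) \<and>
           (\<forall>p\<in>X. \<exists>x\<in>Xs i. d p (f i x) < \<epsilon> i) \<and>
           (\<forall>x\<in>Xs i. \<forall>g\<in>carrier G. d (f i (\<phi>s i g x)) (\<phi> (\<rho> i g) (f i x)) < \<epsilon> i)))"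

end

theory Submission
  imports Defs
begin

text \<open>
  At a vertex of a Delzant polytope the primitive facet normals are dual to the integral edge
  vectors. If \<open>P\<^sub>i\<close> is close to \<open>P\<close> and has as many facets, its unit facet normals are close to those
  of \<open>P\<close>; integrality of the dual edge vectors bounds the lengths of the primitive normals, so that
  these eventually coincide with those of \<open>P\<close>. From then on all level sets lie in the same space
  \<open>\<complex>\<^sup>N\<close>, the group \<open>H\<close> is the same, and the level sets converge in the Hausdorff sense.

  Horizontal lifts show that the Guillemin distance dominates the distance of orbits in \<open>\<complex>\<^sup>N\<close>.
  Conversely, projecting a segment of \<open>\<complex>\<^sup>N\<close> radially to the level set gives, for two points at distance
  \<open>\<delta>\<close>, an arc of length at most \<open>\<delta> + C\<delta>\<^sup>2\<close>, where \<open>C\<close> is uniform for polytopes near \<open>P\<close>. Cutting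
  curves into short pieces of equal length and moving their ends to the other level set therefore
  compares the two Guillemin distances, and any map that moves orbits little in \<open>\<complex>\<^sup>N\<close> is an
  approximation map; equivariance up to a small error is automatic.
\<close>

section \<open>Delzant polytopes: vertices, facets and charts\<close>

text \<open>Equality of the numbers of facets is what gives a bijection: every facet of
  \<open>P\<close> has a partner in a nearby polytope, but that polytope may have more facets, for
  instance at small cut-off corners. Nearby unit normals would not suffice either, because
  \<open>H\<close> is determined by the primitive ones. Curves are replaced by chains of arcs that
  have to meet only as orbits, since lifts of adjacent pieces need not match. The obstacle in
  comparing lengths is that moving the ends of a piece costs a fixed amount, however short the piece
  is. Hence the constants are chosen in a strict order: a relative error, the scale at which the
  local comparison holds with this error, the number of pieces, and only then the closeness of
  orbits. The scale must not depend on the nearby polytope; so the geometry is condensed into vertex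
  charts with two constants, found by compactness on \<open>P\<close> and carried over along the
  bijection of facets. The diameter of the nearby manifold has no a priori bound. Distances there
  are first estimated by those on \<open>toric_manifold P\<close>, and this provides the bound that
  the reverse estimate needs.\<close>

lemma polytope_minimal_face:
  fixes P :: "'a::euclidean_space set"
  assumes "polytope P" "p \<in> P"
  obtains G where "G face_of P" "p \<in> rel_interior G"
proof -
  define \<G> where "\<G> = {G. G face_of P \<and> p \<in> G}"
  have fin: "finite \<G>" using finite_polytope_faces[OF assms(1)] by (simp add: \<G>_def)
  have ne: "P \<in> \<G>" using assms polytope_imp_convex face_of_refl by (auto simp: \<G>_def)
  have G: "\<Inter>\<G> face_of P" using ne by (intro face_of_Inter) (auto simp: \<G>_def)
  \<comment> \<open>On the relative boundary, \<open>p\<close> would lie in a facet of the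
    intersection; that facet is a face of \<open>P\<close> through \<open>p\<close>, so it contains
    the whole intersection.\<close>
  have "p \<in> rel_interior (\<Inter>\<G>)"
  proof (rule ccontr)
    assume "p \<notin> rel_interior (\<Inter>\<G>)"
    moreover have "p \<in> \<Inter>\<G>" by (auto simp: \<G>_def)
    moreover have "polyhedron (\<Inter>\<G>)"
      using G assms(1) face_of_polytope_polytope polytope_imp_polyhedron by blast
    ultimately obtain F where F: "F facet_of (\<Inter>\<G>)" "p \<in> F"
      using rel_boundary_of_polyhedron by blast
    then have "F \<in> \<G>" using G face_of_trans facet_of_imp_face_of unfolding \<G>_def by blast
    then have "F = \<Inter>\<G>" using facet_of_imp_subset[OF F(1)] by blast
    then show False using F by simp
  qed
  then show ?thesis using that G by blast
qed

text \<open>A vertex figure: the hyperplane cuts \<open>v\<close> off from all other vertices. The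
  face \<open>G\<close> with \<open>p\<close> in its relative interior must reach across to
  \<open>v\<close>, because otherwise all its vertices are strictly on the far side; and extremality
  of \<open>p\<close> in the slice leaves \<open>G\<close> no direction inside the hyperplane, so
  \<open>G\<close> is one-dimensional.\<close>

lemma extreme_point_slice_in_edge:
  fixes P :: "'a::euclidean_space set"
  assumes P: "polytope P" and v: "v extreme_point_of P"
    and av: "a \<bullet> v < b" and others: "\<And>w. w extreme_point_of P \<Longrightarrow> w \<noteq> v \<Longrightarrow> b < a \<bullet> w"
    and p: "p extreme_point_of (P \<inter> {x. a \<bullet> x = b})"
  obtains e where "e edge_of P" "v \<in> e" "p \<in> e"
proof -
  have pP: "p \<in> P" and pb: "a \<bullet> p = b" using p by (auto simp: extreme_point_of_def)
  obtain G where G: "G face_of P" "p \<in> rel_interior G" using polytope_minimal_face[OF P pP] .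
  have pG: "p \<in> G" using G(2) rel_interior_subset by blast
  have polG: "polytope G" using G(1) P face_of_polytope_polytope by blast
  have GP: "G \<subseteq> P" using G(1) face_of_imp_subset by blast
  have vG: "v \<in> G"
  proof (rule ccontr)
    assume "v \<notin> G"
    then have "{x. x extreme_point_of G} \<subseteq> {x. b < a \<bullet> x}"
      using others extreme_point_of_face[OF G(1)] by auto
    then have "convex hull {x. x extreme_point_of G} \<subseteq> {x. b < a \<bullet> x}"
      by (simp add: convex_halfspace_gt hull_minimal)
    then have "p \<in> {x. b < a \<bullet> x}"
      using Krein_Milman_Minkowski[of G] polG pG polytope_imp_compact polytope_imp_convex by blast
    with pb show False by simp
  qed
  obtain r where r: "r > 0" "\<And>y. y \<in> affine hull G \<Longrightarrow> dist p y \<le> r \<Longrightarrow> y \<in> G"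
  proof -
    obtain r where "r > 0" "cball p r \<inter> affine hull G \<subseteq> G"
      using G(2) by (auto simp: mem_rel_interior_cball)
    then show thesis by (intro that[of r]) auto
  qed
  \<comment> \<open>Since \<open>p\<close> is relatively interior to \<open>G\<close>, it would be
    the midpoint of a segment of the slice in direction \<open>d\<close>.\<close>
  have nod: "d = 0" if dG: "\<And>t. p + t *\<^sub>R d \<in> affine hull G" and d0: "a \<bullet> d = 0" for d
  proof (rule ccontr)
    assume "d \<noteq> 0"
    define t where "t = r / norm d"
    have t: "t > 0" "t * norm d = r" using \<open>d \<noteq> 0\<close> r by (auto simp: t_def)
    have 1: "p + t *\<^sub>R d \<in> G" by (rule r(2)[OF dG]) (use t in \<open>simp add: dist_norm\<close>)
    have 2: "p + (-t) *\<^sub>R d \<in> G" by (rule r(2)[OF dG]) (use t in \<open>simp add: dist_norm\<close>)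
    have ne: "p + t *\<^sub>R d \<noteq> p + (-t) *\<^sub>R d"
    proof
      assume "p + t *\<^sub>R d = p + (-t) *\<^sub>R d"
      then have "t *\<^sub>R d + t *\<^sub>R d = 0" by (simp add: eq_neg_iff_add_eq_0)
      then have "2 *\<^sub>R (t *\<^sub>R d) = 0" by (simp only: scaleR_2)
      then show False using t \<open>d \<noteq> 0\<close> by simp
    qed
    have mid: "p = (1 - 1/2) *\<^sub>R (p + t *\<^sub>R d) + (1/2) *\<^sub>R (p + (-t) *\<^sub>R d)"
    proof -
      have "(1/2) *\<^sub>R (p + t *\<^sub>R d) + (1/2) *\<^sub>R (p + (-t) *\<^sub>R d) = (1/2) *\<^sub>R (p + p)"
        by (simp flip: scaleR_add_right)
      then show ?thesis by simp
    qed
    have "p \<in> open_segment (p + t *\<^sub>R d) (p + (-t) *\<^sub>R d)"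
      unfolding in_segment(2)
    proof (intro conjI exI)
      show "p = (1 - 1/2) *\<^sub>R (p + t *\<^sub>R d) + (1/2) *\<^sub>R (p + (-t) *\<^sub>R d)" by (fact mid)
    qed (use ne in auto)
    moreover have "p + t *\<^sub>R d \<in> P \<inter> {x. a \<bullet> x = b}" "p + (-t) *\<^sub>R d \<in> P \<inter> {x. a \<bullet> x = b}"
      using 1 2 GP pb d0 by (auto simp: inner_simps)
    ultimately show False using p unfolding extreme_point_of_def by blast
  qed
  have "G \<subseteq> affine hull {v, p}"
  proof
    fix q assume q: "q \<in> G"
    \<comment> \<open>The combination of \<open>q - p\<close> and \<open>v - p\<close> on which
      \<open>a\<close> vanishes; once it is zero, \<open>q\<close> is on the line through
      \<open>v\<close> and \<open>p\<close>.\<close>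
    define d where "d = (a \<bullet> (v - p)) *\<^sub>R (q - p) - (a \<bullet> (q - p)) *\<^sub>R (v - p)"
    have "d = 0"
    proof (rule nod)
      show "a \<bullet> d = 0" by (simp add: d_def inner_simps)
      fix t
      define s1 where "s1 = t * (a \<bullet> (v - p))"
      define s2 where "s2 = t * (a \<bullet> (q - p))"
      have eq: "p + t *\<^sub>R d = (1 - s1 + s2) *\<^sub>R p + s1 *\<^sub>R q + (- s2) *\<^sub>R v"
        unfolding d_def s1_def s2_def by (simp add: algebra_simps)
      show "p + t *\<^sub>R d \<in> affine hull G" unfolding eq
        by (rule mem_affine_3[OF affine_affine_hull]) (use pG q vG hull_inc in auto)
    qed
    moreover have ne: "a \<bullet> (v - p) \<noteq> 0" using av pb by (simp add: inner_simps)
    moreover have "(1 / (a \<bullet> (v - p))) *\<^sub>R ((a \<bullet> (v - p)) *\<^sub>R (q - p)) = (1 / (a \<bullet> (v - p))) *\<^sub>R ((a \<bullet> (q - p)) *\<^sub>R (v - p))"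
      using \<open>d = 0\<close> by (simp add: d_def)
    ultimately have "q - p = ((a \<bullet> (q - p)) / (a \<bullet> (v - p))) *\<^sub>R (v - p)"
      by simp
    then have "q = (1 - (a \<bullet> (q - p)) / (a \<bullet> (v - p))) *\<^sub>R p + ((a \<bullet> (q - p)) / (a \<bullet> (v - p))) *\<^sub>R v"
      by (simp add: algebra_simps)
    then show "q \<in> affine hull {v, p}"
      unfolding affine_hull_2 by (smt (verit) add.commute mem_Collect_eq)
  qed
  moreover have "affine hull {v, p} \<subseteq> affine hull G"
    using vG pG by (intro hull_mono) auto
  ultimately have "affine hull G = affine hull {v, p}"
    by (metis hull_hull hull_mono subset_antisym)
  then have "aff_dim G = aff_dim {v, p}" by (metis aff_dim_affine_hull)
  moreover have "v \<noteq> p" using av pb by auto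
  ultimately have "aff_dim G = 1" by (simp add: aff_dim_2)
  then show ?thesis using that G(1) vG pG by (auto simp: edge_of_def)
qed

text \<open>The slice of \<open>P\<close> by a hyperplane separating \<open>v\<close> from the other
  vertices is the convex hull of points on edges at \<open>v\<close>, and every other point of
  \<open>P\<close> lies on a ray from \<open>v\<close> through this slice.\<close>

lemma polytope_in_edge_cone:
  fixes P :: "'a::euclidean_space set"
  assumes P: "polytope P" and v: "v extreme_point_of P"
    and fin: "finite E" and E: "E = {e. e edge_of P \<and> v \<in> e}"
    and u: "\<And>e. e \<in> E \<Longrightarrow> \<exists>c>0. e = closed_segment v (v + c *\<^sub>R u e)"
    and x: "x \<in> P"
  shows "\<exists>s. (\<forall>e\<in>E. 0 \<le> s e) \<and> x = v + (\<Sum>e\<in>E. s e *\<^sub>R u e)"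
proof (cases "x = v")
  case True
  then show ?thesis by (intro exI[of _ "\<lambda>_. 0"]) auto
next
  case False
  define V where "V = {w. w extreme_point_of P}"
  define Co where "Co = {y. \<exists>s. (\<forall>e\<in>E. 0 \<le> s e) \<and> y = v + (\<Sum>e\<in>E. s e *\<^sub>R u e)}"
  have finV: "finite V"
    using P polytope_imp_polyhedron finite_polyhedron_extreme_points by (auto simp: V_def)
  have PV: "P = convex hull V"
    using Krein_Milman_Minkowski[of P] P polytope_imp_compact polytope_imp_convex by (auto simp: V_def)
  have vnot: "v \<notin> convex hull (V - {v})"
  proof -
    have "convex (P - {v})"
      using extreme_point_of_stillconvex[of P v] v P polytope_imp_convex by blast
    moreover have "V - {v} \<subseteq> P - {v}" using hull_subset[of V convex] PV by blast
    ultimately have "convex hull (V - {v}) \<subseteq> P - {v}" by (rule hull_minimal[rotated])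
    then show ?thesis by blast
  qed
  obtain a b where ab: "a \<bullet> v < b" "\<And>y. y \<in> convex hull (V - {v}) \<Longrightarrow> b < a \<bullet> y"
    using separating_hyperplane_closed_point[of "convex hull (V - {v})" v] vnot finV
    by (meson compact_convex_hull compact_imp_closed convex_convex_hull finite_Diff finite_imp_compact)
  define Q where "Q = P \<inter> {x. a \<bullet> x = b}"
  have CoI: "convex Co"
  proof (rule convexI)
    fix y z and \<alpha> \<beta> :: real assume yz: "y \<in> Co" "z \<in> Co" and ab: "0 \<le> \<alpha>" "0 \<le> \<beta>" "\<alpha> + \<beta> = 1"
    then obtain s t where s: "\<forall>e\<in>E. 0 \<le> s e" "y = v + (\<Sum>e\<in>E. s e *\<^sub>R u e)"
      and t: "\<forall>e\<in>E. 0 \<le> t e" "z = v + (\<Sum>e\<in>E. t e *\<^sub>R u e)" unfolding Co_def by blast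
    have "\<alpha> *\<^sub>R y + \<beta> *\<^sub>R z = (\<alpha> + \<beta>) *\<^sub>R v + (\<Sum>e\<in>E. (\<alpha> * s e + \<beta> * t e) *\<^sub>R u e)"
      unfolding s t by (simp add: algebra_simps scaleR_sum_right sum.distrib)
    then show "\<alpha> *\<^sub>R y + \<beta> *\<^sub>R z \<in> Co" using s t ab unfolding Co_def
      by (intro CollectI exI[of _ "\<lambda>e. \<alpha> * s e + \<beta> * t e"]) auto
  qed
  have QCo: "Q \<subseteq> Co"
  proof -
    have "compact Q" "convex Q"
      using P polytope_imp_compact polytope_imp_convex unfolding Q_def
      by (auto intro: compact_Int_closed closed_hyperplane convex_Int convex_hyperplane)
    then have "Q = convex hull {x. x extreme_point_of Q}" by (rule Krein_Milman_Minkowski)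
    moreover have "{x. x extreme_point_of Q} \<subseteq> Co"
    proof
      fix p assume "p \<in> {x. x extreme_point_of Q}"
      then have p: "p extreme_point_of (P \<inter> {x. a \<bullet> x = b})" by (simp add: Q_def)
      have oth: "b < a \<bullet> w" if "w extreme_point_of P" "w \<noteq> v" for w
        by (rule ab(2)) (use that in \<open>auto simp: V_def intro: hull_inc\<close>)
      obtain e where e: "e edge_of P" "v \<in> e" "p \<in> e"
        using extreme_point_slice_in_edge[OF P v ab(1) oth p] by blast
      then have eE: "e \<in> E" using E by simp
      obtain c where c: "c > 0" "e = closed_segment v (v + c *\<^sub>R u e)" using u[OF eE] by blast
      then obtain t where t: "0 \<le> t" "p = (1 - t) *\<^sub>R v + t *\<^sub>R (v + c *\<^sub>R u e)"
        using e(3) by (metis in_segment(1))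
      have "p = v + (\<Sum>e'\<in>E. (if e' = e then t * c else 0) *\<^sub>R u e')"
        using t fin eE by (simp add: if_distrib[of "\<lambda>r. r *\<^sub>R _"] sum.delta algebra_simps cong: if_cong)
      then show "p \<in> Co" using t c unfolding Co_def
        by (intro CollectI exI[of _ "\<lambda>e'. if e' = e then t * c else 0"]) auto
    qed
    ultimately show ?thesis by (metis CoI hull_minimal)
  qed
  have Vne: "V - {v} \<noteq> {}"
  proof
    assume "V - {v} = {}"
    then have "V = {v}" using v V_def by blast
    then have "P = {v}" using PV by simp
    then show False using x False by simp
  qed
  have "V = insert v (V - {v})" using v V_def by blast
  then obtain \<alpha> \<beta> y where y: "0 \<le> \<alpha>" "0 \<le> \<beta>" "\<alpha> + \<beta> = 1" "y \<in> convex hull (V - {v})" "x = \<alpha> *\<^sub>R v + \<beta> *\<^sub>R y"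
    using x PV convex_hull_insert[OF Vne, of v] by auto
  have "\<beta> > 0" using y False by (cases "\<beta> = 0") auto
  have ay: "b < a \<bullet> y" using ab y by blast
  \<comment> \<open>The parameter at which the segment from \<open>v\<close> to \<open>y\<close>
    crosses the hyperplane.\<close>
  define s where "s = (b - a \<bullet> v) / (a \<bullet> y - a \<bullet> v)"
  have s: "0 < s" "s < 1" using ab(1) ay by (auto simp: s_def)
  define p where "p = (1 - s) *\<^sub>R v + s *\<^sub>R y"
  have "y \<in> P" using y(4) PV by (metis Diff_subset hull_mono subsetD)
  moreover have "v \<in> P" using v by (simp add: extreme_point_of_def)
  ultimately have "p \<in> P" unfolding p_def using s P polytope_imp_convex
    by (intro convexD) auto
  moreover have "a \<bullet> p = b"
  proof -
    have "a \<bullet> p = a \<bullet> v + s * (a \<bullet> y - a \<bullet> v)" by (simp add: p_def inner_simps algebra_simps)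
    also have "\<dots> = b" using ab(1) ay by (simp add: s_def)
    finally show ?thesis .
  qed
  ultimately have "p \<in> Co" using QCo by (auto simp: Q_def)
  then obtain t where t: "\<forall>e\<in>E. 0 \<le> t e" "p = v + (\<Sum>e\<in>E. t e *\<^sub>R u e)" unfolding Co_def by blast
  have \<alpha>: "\<alpha> = 1 - \<beta>" using y by simp
  have "p - v = s *\<^sub>R (y - v)" by (simp add: p_def algebra_simps)
  moreover have "x = v + \<beta> *\<^sub>R (y - v)" by (simp add: y(5) \<alpha> algebra_simps)
  ultimately have "x = v + (\<beta> / s) *\<^sub>R (p - v)" using s by simp
  also have "\<dots> = v + (\<Sum>e\<in>E. (\<beta> / s * t e) *\<^sub>R u e)" by (simp add: t scaleR_sum_right)
  finally show ?thesis using t s \<open>\<beta> > 0\<close> by (intro exI[of _ "\<lambda>e. \<beta> / s * t e"]) auto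
qed

section \<open>Lattice bases, their duals, and the facets at a vertex\<close>

lemma int_lattice_inner: "x \<in> int_lattice \<Longrightarrow> y \<in> int_lattice \<Longrightarrow> x \<bullet> y \<in> \<int>"
  unfolding inner_vec_def int_lattice_def by (intro Ints_sum) (auto simp: inner_real_def)

lemma axis_int_lattice: "axis i 1 \<in> int_lattice"
  by (auto simp: int_lattice_def axis_def)

lemma int_lattice_norm_ge_1:
  fixes x :: "real ^ 'n"
  assumes "x \<in> int_lattice" "x \<noteq> 0"
  shows "1 \<le> norm x"
proof -
  obtain i where i: "x $ i \<noteq> 0" using assms(2) by (auto simp: vec_eq_iff)
  have "1 \<le> \<bar>x $ i\<bar>" using assms(1) i by (auto simp: int_lattice_def intro: Ints_nonzero_abs_ge1)
  also have "\<dots> \<le> norm x" by (rule component_le_norm_cart)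
  finally show ?thesis .
qed

text \<open>The dual basis is integral because its entries are the integer coefficients of the
  standard basis vectors in terms of \<open>u\<close>. Duality turns the integral edge directions
  into candidates for the facet normals.\<close>

lemma lattice_dual_basis:
  fixes u :: "'e \<Rightarrow> real ^ 'n"
  assumes basis: "int_lattice_basis (u ` E)" and fin: "finite E" and card: "card E = CARD('n)"
  obtains w where "\<And>e. e \<in> E \<Longrightarrow> w e \<in> int_lattice"
    "\<And>e e'. e \<in> E \<Longrightarrow> e' \<in> E \<Longrightarrow> w e \<bullet> u e' = (if e = e' then 1 else 0)"
    "\<And>x. x = (\<Sum>e\<in>E. (x \<bullet> u e) *\<^sub>R w e)" "\<And>x. x = (\<Sum>e\<in>E. (x \<bullet> w e) *\<^sub>R u e)"
proof -
  have "\<forall>i::'n. \<exists>a. axis i 1 = (\<Sum>b\<in>u ` E. real_of_int (a b) *\<^sub>R b)"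
    using basis axis_int_lattice unfolding int_lattice_basis_def by blast
  then obtain a where a: "\<And>i::'n. axis i 1 = (\<Sum>b\<in>u ` E. real_of_int (a i b) *\<^sub>R b)" by metis
  have spanU: "UNIV \<subseteq> span (u ` E)"
  proof -
    have "Basis \<subseteq> span (u ` E)"
    proof
      fix y :: "real ^ 'n" assume "y \<in> Basis"
      then obtain i where "y = axis i 1" by (auto simp: Basis_vec_def)
      then show "y \<in> span (u ` E)" by (simp add: a span_sum span_base span_scale)
    qed
    then have "span Basis \<subseteq> span (u ` E)" by (metis span_mono span_span)
    then show ?thesis by simp
  qed
  \<comment> \<open>A spanning set with at most \<open>CARD('n)\<close> elements is independent;
    comparing dimensions then shows that \<open>u\<close> is injective on \<open>E\<close>.\<close>
  have indep: "independent (u ` E)"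
    by (rule card_le_dim_spanning[of _ UNIV]) (use spanU fin card card_image_le[OF fin, of u] in auto)
  have inj: "inj_on u E"
  proof (rule eq_card_imp_inj_on[OF fin])
    have "dim (u ` E) = card (u ` E)" using indep dim_eq_card_independent by blast
    moreover have "dim (u ` E) = dim (UNIV :: (real ^ 'n) set)"
      by (metis dim_span spanU top.extremum_unique)
    ultimately show "card (u ` E) = card E" using card by simp
  qed
  define w where "w e = (\<chi> i. real_of_int (a i (u e)))" for e
  have exp2: "x = (\<Sum>e\<in>E. (x \<bullet> w e) *\<^sub>R u e)" for x
  proof -
    have "(\<Sum>e\<in>E. (x \<bullet> w e) *\<^sub>R u e) = (\<Sum>e\<in>E. \<Sum>i\<in>UNIV. (x $ i * a i (u e)) *\<^sub>R u e)"
      by (simp add: inner_vec_def w_def scaleR_sum_left)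
    also have "\<dots> = (\<Sum>i\<in>UNIV. \<Sum>e\<in>E. (x $ i * a i (u e)) *\<^sub>R u e)" by (rule sum.swap)
    also have "\<dots> = (\<Sum>i\<in>UNIV. x $ i *\<^sub>R axis i 1)"
      by (simp add: a sum.reindex[OF inj] scaleR_sum_right)
    also have "\<dots> = x" using basis_expansion[of x] by (simp add: scalar_mult_eq_scaleR)
    finally show ?thesis by simp
  qed
  have dual: "w e \<bullet> u e' = (if e = e' then 1 else 0)" if "e \<in> E" "e' \<in> E" for e e'
  proof -
    have "(\<Sum>f\<in>E. (u e' \<bullet> w f - (if f = e' then 1 else 0)) *\<^sub>R u f) = 0"
      using exp2[of "u e'"] that fin
      by (simp add: scaleR_diff_left sum_subtractf if_distrib[of "\<lambda>r. r *\<^sub>R _"] sum.delta cong: if_cong)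
    then have "(\<Sum>b\<in>u ` E. (\<lambda>b. u e' \<bullet> w (inv_into E u b) - (if inv_into E u b = e' then 1 else 0)) b *\<^sub>R b) = 0"
      by (simp add: sum.reindex[OF inj] inj)
    then have "(\<lambda>b. u e' \<bullet> w (inv_into E u b) - (if inv_into E u b = e' then 1 else 0)) (u e) = 0"
      by (rule independentD[OF indep, rotated 2]) (use fin that in auto)
    then show ?thesis using that inj by (auto simp: inner_commute split: if_splits)
  qed
  have exp1: "x = (\<Sum>e\<in>E. (x \<bullet> u e) *\<^sub>R w e)" for x
  proof -
    define y where "y = x - (\<Sum>e\<in>E. (x \<bullet> u e) *\<^sub>R w e)"
    have yu: "y \<bullet> u e' = 0" if "e' \<in> E" for e'
    proof -
      have "(\<Sum>e\<in>E. (x \<bullet> u e) * (w e \<bullet> u e')) = (\<Sum>e\<in>E. if e = e' then x \<bullet> u e' else 0)"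
        by (rule sum.cong) (auto simp: dual that)
      then show ?thesis using that fin by (simp add: y_def inner_diff_left inner_sum_left)
    qed
    have "y \<bullet> y = y \<bullet> (\<Sum>e\<in>E. (y \<bullet> w e) *\<^sub>R u e)" using exp2[of y] by simp
    also have "\<dots> = 0" by (simp add: inner_sum_right yu)
    finally show ?thesis by (simp add: y_def)
  qed
  show thesis by (rule that[of w, OF _ dual exp1 exp2]) (auto simp: w_def int_lattice_def)
qed

text \<open>For the facets \<open>A\<close> at a vertex, \<open>u F\<close> is the integral direction of the edge that leaves \<open>F\<close>.\<close>

definition chart :: "(real ^ 'n) set \<Rightarrow> (real ^ 'n) set set \<Rightarrow> ((real ^ 'n) set \<Rightarrow> real ^ 'n) \<Rightarrow> bool" where
  "chart P A u \<longleftrightarrow> A \<subseteq> facets P \<and> card A = CARD('n) \<and> (\<forall>F\<in>A. u F \<in> int_lattice) \<and>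
     (\<forall>F\<in>A. \<forall>G\<in>A. facet_normal P F \<bullet> u G = (if F = G then 1 else 0)) \<and>
     (\<forall>x. x = (\<Sum>F\<in>A. (x \<bullet> u F) *\<^sub>R facet_normal P F)) \<and>
     (\<forall>x. x = (\<Sum>F\<in>A. (x \<bullet> facet_normal P F) *\<^sub>R u F))"

text \<open>By the edge cone, each dual vector \<open>w e\<close> attains its minimum over
  \<open>P\<close> at \<open>v\<close>. The face cut out by it contains every edge at
  \<open>v\<close> except \<open>e\<close>, and these faces are exactly the facets through
  \<open>v\<close>. Their normals are the \<open>w e\<close>, as
  \<open>w e \<bullet> u e = 1\<close> makes \<open>w e\<close> primitive.\<close>

lemma delzant_vertex:
  fixes P :: "(real ^ 'n) set"
  assumes D: "delzant P" and v: "v extreme_point_of P"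
  obtains u where "chart P {F \<in> facets P. v \<in> F} u"
    "\<forall>F\<in>facets P. v \<in> F \<longrightarrow>
       primitive_vec (facet_normal P F) \<and> (\<forall>x\<in>P. v \<bullet> facet_normal P F \<le> x \<bullet> facet_normal P F) \<and>
       F = P \<inter> {x. x \<bullet> facet_normal P F = v \<bullet> facet_normal P F}"
proof -
  define E where "E = edges_at P v"
  have P: "polytope P" "aff_dim P = int CARD('n)" using D by (auto simp: delzant_def)
  have cvx: "convex P" using P polytope_imp_convex by blast
  have vP: "v \<in> P" using v by (simp add: extreme_point_of_def)
  obtain u where fin: "finite E" and card: "card E = CARD('n)"
    and u: "\<And>e. e \<in> E \<Longrightarrow> \<exists>c>0. e = closed_segment v (v + c *\<^sub>R u e)" and basis: "int_lattice_basis (u ` E)"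
    using D v unfolding delzant_def E_def by metis
  obtain w where wI: "\<And>e. e \<in> E \<Longrightarrow> w e \<in> int_lattice"
    and dual: "\<And>e e'. e \<in> E \<Longrightarrow> e' \<in> E \<Longrightarrow> w e \<bullet> u e' = (if e = e' then 1 else 0)"
    and exp1: "\<And>x. x = (\<Sum>e\<in>E. (x \<bullet> u e) *\<^sub>R w e)" and exp2: "\<And>x. x = (\<Sum>e\<in>E. (x \<bullet> w e) *\<^sub>R u e)"
    using lattice_dual_basis[OF basis fin card] by blast
  have uI: "u e \<in> int_lattice" if "e \<in> E" for e using basis that by (auto simp: int_lattice_basis_def)
  obtain c where c: "\<And>e. e \<in> E \<Longrightarrow> c e > 0" "\<And>e. e \<in> E \<Longrightarrow> e = closed_segment v (v + c e *\<^sub>R u e)" using u by metis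
  have cP: "v + c e *\<^sub>R u e \<in> P" if "e \<in> E" for e
  proof -
    have "e \<subseteq> P" using that by (auto simp: E_def edges_at_def edge_of_def face_of_imp_subset)
    then show ?thesis using c(2)[OF that] ends_in_segment(2) by blast
  qed
  have cone: "\<exists>s. (\<forall>e\<in>E. 0 \<le> s e) \<and> x = v + (\<Sum>e\<in>E. s e *\<^sub>R u e)" if xP: "x \<in> P" for x
  proof -
    have E': "E = {e. e edge_of P \<and> v \<in> e}" by (simp add: E_def edges_at_def)
    show ?thesis by (rule polytope_in_edge_cone[where u = u, OF P(1) v fin E' _ xP]) (erule u)
  qed
  have ge: "v \<bullet> w e \<le> x \<bullet> w e" if "x \<in> P" "e \<in> E" for x e
  proof -
    obtain s where s: "\<forall>e\<in>E. 0 \<le> s e" "x = v + (\<Sum>e\<in>E. s e *\<^sub>R u e)" using cone \<open>x \<in> P\<close> by blast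
    have "(\<Sum>f\<in>E. s f * (w e \<bullet> u f)) = (\<Sum>f\<in>E. if e = f then s f else 0)"
      by (rule sum.cong) (auto simp: dual that)
    also have "\<dots> = s e" using that fin by simp
    finally have "w e \<bullet> x = w e \<bullet> v + s e" by (simp add: s(2) inner_add_right inner_sum_right)
    then have "x \<bullet> w e = v \<bullet> w e + s e" by (simp add: inner_commute)
    then show ?thesis using s that by simp
  qed
  define \<Phi> where "\<Phi> e = P \<inter> {x. x \<bullet> w e = v \<bullet> w e}" for e
  have \<Phi>face: "\<Phi> e face_of P" if "e \<in> E" for e
    using face_of_Int_supporting_hyperplane_ge[OF cvx, where a = "w e" and b = "v \<bullet> w e"] ge that
    by (simp add: \<Phi>_def inner_commute)
  have v\<Phi>: "v \<in> \<Phi> e" for e using vP by (simp add: \<Phi>_def)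
  have c\<Phi>: "v + c e' *\<^sub>R u e' \<in> \<Phi> e \<longleftrightarrow> e \<noteq> e'" if "e \<in> E" "e' \<in> E" for e e'
  proof -
    have "(v + c e' *\<^sub>R u e') \<bullet> w e = v \<bullet> w e + c e' * (w e \<bullet> u e')"
      by (simp add: inner_add_left inner_commute[of "u e'"])
    then show ?thesis using cP[OF that(2)] c(1)[OF that(2)] dual[OF that] by (simp add: \<Phi>_def)
  qed
  have \<Phi>ne: "\<Phi> e \<noteq> P" if "e \<in> E" for e using c\<Phi>[OF that that] cP[OF that] by blast
  \<comment> \<open>A functional \<open>a\<close> supporting \<open>P\<close> in \<open>F\<close> is
    nonnegative on all edge directions, so \<open>F\<close> lies in \<open>\<Phi> e\<close> whenever
    \<open>a \<bullet> u e\<close> is nonzero. A facet is not a proper face of a proper face, so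
    equality holds; the \<open>\<Phi> e\<close> being distinct, a single coordinate of
    \<open>a\<close> survives.\<close>
  have key: "\<exists>e\<in>E. F = \<Phi> e \<and> (\<exists>k>0. a = k *\<^sub>R w e)"
    if F: "F facet_of P" and vF: "v \<in> F" and Pa: "P \<subseteq> {x. b \<le> x \<bullet> a}" and Fa: "F = P \<inter> {x. x \<bullet> a = b}" for F a b
  proof -
    have va: "v \<bullet> a = b" using vF Fa by simp
    have au: "0 \<le> a \<bullet> u e" if "e \<in> E" for e
    proof -
      have "b \<le> (v + c e *\<^sub>R u e) \<bullet> a" using Pa cP[OF that] by blast
      then have "0 \<le> c e * (u e \<bullet> a)" using va by (simp add: inner_add_left)
      then show ?thesis using c(1)[OF that] by (simp add: zero_le_mult_iff inner_commute)
    qed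
    have sub: "F \<subseteq> \<Phi> e" if "e \<in> E" "a \<bullet> u e \<noteq> 0" for e
    proof
      fix x assume "x \<in> F"
      then have xP: "x \<in> P" and xa: "x \<bullet> a = b" using Fa by auto
      have "x \<bullet> a - v \<bullet> a = (x - v) \<bullet> (\<Sum>e\<in>E. (a \<bullet> u e) *\<^sub>R w e)" using exp1[of a] by (simp add: inner_diff_left)
      also have "\<dots> = (\<Sum>e\<in>E. (a \<bullet> u e) * (x \<bullet> w e - v \<bullet> w e))" by (simp add: inner_sum_right inner_diff_left)
      finally have "(\<Sum>e\<in>E. (a \<bullet> u e) * (x \<bullet> w e - v \<bullet> w e)) = 0" using xa va by simp
      then have "(a \<bullet> u e) * (x \<bullet> w e - v \<bullet> w e) = 0"
        using sum_nonneg_eq_0_iff[OF fin, of "\<lambda>e. (a \<bullet> u e) * (x \<bullet> w e - v \<bullet> w e)"] au ge[OF xP] that by auto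
      then show "x \<in> \<Phi> e" using that xP by (simp add: \<Phi>_def)
    qed
    have eqF: "F = \<Phi> e" if "e \<in> E" "a \<bullet> u e \<noteq> 0" for e
    proof (rule ccontr)
      assume "F \<noteq> \<Phi> e"
      have "F face_of \<Phi> e" using facet_of_imp_face_of[OF F] sub[OF that] \<Phi>face[OF that(1)]
        by (meson face_of_face)
      then have "aff_dim F < aff_dim (\<Phi> e)"
        using face_of_aff_dim_lt \<open>F \<noteq> \<Phi> e\<close> \<Phi>face[OF that(1)] face_of_imp_convex by blast
      moreover have "aff_dim (\<Phi> e) < aff_dim P" using face_of_aff_dim_lt[OF cvx \<Phi>face \<Phi>ne] that by blast
      ultimately show False using F by (simp add: facet_of_def)
    qed
    obtain e where e: "e \<in> E" "a \<bullet> u e \<noteq> 0"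
    proof (rule ccontr)
      assume "\<not> thesis"
      then have "a \<bullet> u e = 0" if "e \<in> E" for e using that \<open>\<And>e. e \<in> E \<Longrightarrow> a \<bullet> u e \<noteq> 0 \<Longrightarrow> thesis\<close> by blast
      then have "a = 0" using exp1[of a] by simp
      then have "F = P" using Fa va by auto
      then show False using F by simp
    qed
    have z: "a \<bullet> u e' = 0" if "e' \<in> E" "e' \<noteq> e" for e'
    proof (rule ccontr)
      assume "a \<bullet> u e' \<noteq> 0"
      then have "\<Phi> e = \<Phi> e'" using eqF e that by metis
      moreover have "v + c e' *\<^sub>R u e' \<in> \<Phi> e" using c\<Phi>[OF e(1) that(1)] that by simp
      moreover have "v + c e' *\<^sub>R u e' \<notin> \<Phi> e'" using c\<Phi>[OF that(1) that(1)] by simp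
      ultimately show False by simp
    qed
    have "a = (\<Sum>f\<in>E. (a \<bullet> u f) *\<^sub>R w f)" by (rule exp1)
    also have "\<dots> = (\<Sum>f\<in>E. if f = e then (a \<bullet> u e) *\<^sub>R w e else 0)" by (rule sum.cong) (auto simp: z)
    also have "\<dots> = (a \<bullet> u e) *\<^sub>R w e" using fin e by simp
    finally have "a = (a \<bullet> u e) *\<^sub>R w e" .
    then show ?thesis using e eqF[OF e] au[OF e(1)] by (metis order_le_less)
  qed
  have facet: "\<exists>e\<in>E. F = \<Phi> e" if F: "F facet_of P" and vF: "v \<in> F" for F
  proof -
    obtain a b where "P \<subseteq> {x. a \<bullet> x \<le> b}" "F = P \<inter> {x. a \<bullet> x = b}"
      using facet_of_polyhedron[OF polytope_imp_polyhedron[OF P(1)] F] by metis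
    then have "P \<subseteq> {x. - b \<le> x \<bullet> (- a)}" "F = P \<inter> {x. x \<bullet> (- a) = - b}" by (auto simp: inner_commute)
    then show ?thesis using key[OF F vF] by blast
  qed
  \<comment> \<open>A facet containing \<open>\<Phi> e\<close> is some \<open>\<Phi> e'\<close>; for
    \<open>e' \<noteq> e\<close> the far end of the edge \<open>e'\<close> would be in
    \<open>\<Phi> e\<close> but not in \<open>\<Phi> e'\<close>.\<close>
  have \<Phi>facet: "\<Phi> e facet_of P" if eE: "e \<in> E" for e
  proof -
    obtain C where C: "C facet_of P" "\<Phi> e \<subseteq> C"
      using face_of_polyhedron_subset_facet[OF polytope_imp_polyhedron[OF P(1)] \<Phi>face[OF eE] _ \<Phi>ne[OF eE]] v\<Phi> by blast
    then obtain e' where e': "e' \<in> E" "C = \<Phi> e'" using facet v\<Phi> by blast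
    then have "e = e'" using c\<Phi>[OF that e'(1)] c\<Phi>[OF e'(1) e'(1)] C(2) by blast
    then show ?thesis using C e' by simp
  qed
  have \<Phi>inj: "inj_on \<Phi> E" by (metis (no_types, lifting) c\<Phi> inj_onI)
  have prim: "primitive_vec (w e)" if "e \<in> E" for e
    unfolding primitive_vec_def
  proof (intro conjI ballI allI impI)
    fix y :: "real ^ 'n" and k :: nat assume y: "y \<in> int_lattice" "w e = real k *\<^sub>R y"
    have "y \<bullet> u e \<in> \<int>" using y uI[OF that] int_lattice_inner by blast
    then obtain m :: int where m: "y \<bullet> u e = of_int m" by (auto elim: Ints_cases)
    have "1 = real k * (y \<bullet> u e)" using dual[OF that that] y by simp
    then have "1 = real_of_int (int k * m)" by (simp add: m)
    then have "int k * m = 1" by linarith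
    then show "k = 1" by (metis int_dvd_int_iff dvd_triv_left nat_dvd_1_iff_1 of_nat_1)
  qed (use wI that in auto)
  have normal: "facet_normal P (\<Phi> e) = w e" if e: "e \<in> E" for e
    unfolding facet_normal_def
  proof (rule the_equality)
    show "primitive_vec (w e) \<and> (\<exists>c. P \<subseteq> {x. c \<le> x \<bullet> w e} \<and> \<Phi> e = P \<inter> {x. x \<bullet> w e = c})"
      using prim[OF e] ge e by (intro conjI exI[of _ "v \<bullet> w e"]) (auto simp: \<Phi>_def)
    \<comment> \<open>The definite description needs uniqueness: another candidate is
      \<open>k\<close> times \<open>w e\<close>, where \<open>k = \<nu> \<bullet> u e\<close> is an
      integer, and primitivity forces \<open>k = 1\<close>.\<close>
    fix \<nu> assume \<nu>: "primitive_vec \<nu> \<and> (\<exists>c. P \<subseteq> {x. c \<le> x \<bullet> \<nu>} \<and> \<Phi> e = P \<inter> {x. x \<bullet> \<nu> = c})"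
    then obtain b where "P \<subseteq> {x. b \<le> x \<bullet> \<nu>}" "\<Phi> e = P \<inter> {x. x \<bullet> \<nu> = b}" by blast
    from key[OF \<Phi>facet[OF e] v\<Phi> this] obtain e' k where e': "e' \<in> E" "\<Phi> e = \<Phi> e'" "k > 0" "\<nu> = k *\<^sub>R w e'" by blast
    then have [simp]: "e' = e" using \<Phi>inj e by (auto dest: inj_onD)
    have "\<nu> \<bullet> u e = k" using e' dual[OF e e] by simp
    moreover have "\<nu> \<bullet> u e \<in> \<int>" using \<nu> uI[OF e] int_lattice_inner by (auto simp: primitive_vec_def)
    ultimately obtain m :: int where m: "k = of_int m" by (auto elim: Ints_cases)
    have "\<nu> = real (nat m) *\<^sub>R w e" using e' m by simp
    then have "nat m = 1" using \<nu> wI[OF e] unfolding primitive_vec_def by blast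
    then show "\<nu> = w e" using \<open>\<nu> = real (nat m) *\<^sub>R w e\<close> by simp
  qed
  have A: "{F \<in> facets P. v \<in> F} = \<Phi> ` E" using facet \<Phi>facet v\<Phi> by (auto simp: facets_def)
  show thesis
  proof (rule that[of "\<lambda>F. u (inv_into E \<Phi> F)"])
    show "chart P {F \<in> facets P. v \<in> F} (\<lambda>F. u (inv_into E \<Phi> F))"
      unfolding chart_def A
    proof (intro conjI ballI allI)
      show "\<Phi> ` E \<subseteq> facets P" using \<Phi>facet by (auto simp: facets_def)
      show "card (\<Phi> ` E) = CARD('n)" by (simp add: card_image[OF \<Phi>inj] card)
      fix F assume F: "F \<in> \<Phi> ` E"
      show "u (inv_into E \<Phi> F) \<in> int_lattice" using F uI by (simp add: inv_into_into)
      fix G assume G: "G \<in> \<Phi> ` E"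
      show "facet_normal P F \<bullet> u (inv_into E \<Phi> G) = (if F = G then 1 else 0)"
      proof -
        obtain e f where "e \<in> E" "f \<in> E" "F = \<Phi> e" "G = \<Phi> f" using F G by blast
        then show ?thesis by (simp add: normal dual \<Phi>inj inj_on_eq_iff[OF \<Phi>inj])
      qed
    next
      fix x show "x = (\<Sum>F\<in>\<Phi> ` E. (x \<bullet> u (inv_into E \<Phi> F)) *\<^sub>R facet_normal P F)"
        using exp1[of x] by (simp add: sum.reindex[OF \<Phi>inj] \<Phi>inj normal)
      show "x = (\<Sum>F\<in>\<Phi> ` E. (x \<bullet> facet_normal P F) *\<^sub>R u (inv_into E \<Phi> F))"
        using exp2[of x] by (simp add: sum.reindex[OF \<Phi>inj] \<Phi>inj normal)
    qed
    show "\<forall>F\<in>facets P. v \<in> F \<longrightarrow>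
       primitive_vec (facet_normal P F) \<and> (\<forall>x\<in>P. v \<bullet> facet_normal P F \<le> x \<bullet> facet_normal P F) \<and>
       F = P \<inter> {x. x \<bullet> facet_normal P F = v \<bullet> facet_normal P F}"
    proof (intro ballI impI)
      fix F assume "F \<in> facets P" "v \<in> F"
      then obtain e where "e \<in> E" "F = \<Phi> e" using A by blast
      then show "primitive_vec (facet_normal P F) \<and> (\<forall>x\<in>P. v \<bullet> facet_normal P F \<le> x \<bullet> facet_normal P F) \<and>
         F = P \<inter> {x. x \<bullet> facet_normal P F = v \<bullet> facet_normal P F}"
        using prim ge by (simp add: normal) (simp add: \<Phi>_def)
    qed
  qed
qed

section \<open>Facet forms, half-spaces and uniform charts\<close>

lemma finite_facets [simp]: "delzant P \<Longrightarrow> finite (facets P)"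
  by (simp add: delzant_def facets_def finite_polytope_facets)

lemma delzant_compact: "delzant P \<Longrightarrow> compact P"
  by (simp add: delzant_def polytope_imp_compact)

lemma delzant_convex: "delzant P \<Longrightarrow> convex P"
  by (simp add: delzant_def polytope_imp_convex)

lemma delzant_facet_vertex:
  assumes D: "delzant P" and F: "F \<in> facets P"
  obtains v where "v extreme_point_of P" "v \<in> F"
proof -
  have P: "polytope P" and f: "F face_of P" "F \<noteq> {}"
    using D F by (auto simp: delzant_def facets_def facet_of_def)
  have "compact F" "convex F"
    using face_of_polytope_polytope[OF P f(1)] by (auto simp: polytope_imp_compact polytope_imp_convex)
  then obtain v where "v extreme_point_of F" using extreme_point_exists_convex f(2) by blast
  then show ?thesis using extreme_point_of_face[OF f(1)] that by blast
qed

text \<open>Every facet has a vertex, so the description at a vertex reaches all facets. After this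
  the definite descriptions behind \<open>facet_normal\<close> and \<open>facet_offset\<close> are
  not unfolded any more.\<close>

lemma delzant_facet:
  assumes D: "delzant P" and F: "F \<in> facets P"
  shows "primitive_vec (facet_normal P F)" "\<And>x. x \<in> P \<Longrightarrow> 0 \<le> facet_form P F x"
    "F = {x \<in> P. facet_form P F x = 0}"
proof -
  obtain v where v: "v extreme_point_of P" "v \<in> F" using delzant_facet_vertex[OF D F] .
  obtain u where "chart P {F \<in> facets P. v \<in> F} u" "\<forall>F\<in>facets P. v \<in> F \<longrightarrow>
       primitive_vec (facet_normal P F) \<and> (\<forall>x\<in>P. v \<bullet> facet_normal P F \<le> x \<bullet> facet_normal P F) \<and>
       F = P \<inter> {x. x \<bullet> facet_normal P F = v \<bullet> facet_normal P F}"
    using delzant_vertex[OF D v(1)] .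
  from this(2)[rule_format, OF F v(2)] have *: "primitive_vec (facet_normal P F)"
    "\<forall>x\<in>P. v \<bullet> facet_normal P F \<le> x \<bullet> facet_normal P F"
    "F = P \<inter> {x. x \<bullet> facet_normal P F = v \<bullet> facet_normal P F}" by blast+
  have off: "facet_offset P F = v \<bullet> facet_normal P F" unfolding facet_offset_def
  proof (rule the_equality)
    show "\<forall>x\<in>F. x \<bullet> facet_normal P F = v \<bullet> facet_normal P F" using *(3) by blast
    show "c = v \<bullet> facet_normal P F" if "\<forall>x\<in>F. x \<bullet> facet_normal P F = c" for c using that v(2) by metis
  qed
  show "primitive_vec (facet_normal P F)" by (fact *(1))
  show "\<And>x. x \<in> P \<Longrightarrow> 0 \<le> facet_form P F x" using *(2) by (simp add: facet_form_def off)
  show "F = {x \<in> P. facet_form P F x = 0}" using *(3) by (auto simp: facet_form_def off)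
qed

lemma facet_normal_lattice: "delzant P \<Longrightarrow> F \<in> facets P \<Longrightarrow> facet_normal P F \<in> int_lattice"
  using delzant_facet(1) by (auto simp: primitive_vec_def)

lemma facet_normal_nonzero:
  fixes P :: "(real ^ 'n) set"
  shows "delzant P \<Longrightarrow> F \<in> facets P \<Longrightarrow> facet_normal P F \<noteq> 0"
proof
  assume "delzant P" "F \<in> facets P" "facet_normal P F = 0"
  then have "primitive_vec (0::real^'n)" using delzant_facet(1) by metis
  then have "0 = (1::nat)" unfolding primitive_vec_def by (metis of_nat_0 scaleR_zero_left)
  then show False by simp
qed

lemma delzant_interior_point:
  fixes P :: "(real ^ 'n) set"
  assumes D: "delzant P"
  obtains y where "y \<in> interior P" "\<forall>F\<in>facets P. 0 < facet_form P F y"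
proof -
  have P: "polytope P" and dim: "aff_dim P = int DIM(real^'n)" using D by (auto simp: delzant_def)
  have "P \<noteq> {}" using dim by auto
  then obtain y where y: "y \<in> rel_interior P" using delzant_convex[OF D] by (meson all_not_in_conv rel_interior_eq_empty)
  have "affine hull P = UNIV" using dim aff_dim_eq_full[of P] by blast
  then have "y \<in> interior P" using y by (simp add: rel_interior_interior)
  moreover have "0 < facet_form P F y" if F: "F \<in> facets P" for F
  proof -
    have "y \<in> P" using y rel_interior_subset by blast
    have "y \<notin> F" using rel_boundary_of_polyhedron[OF polytope_imp_polyhedron[OF P]] y F
      by (auto simp: facets_def)
    then have "facet_form P F y \<noteq> 0" using delzant_facet(3)[OF D F] \<open>y \<in> P\<close> by blast
    then show ?thesis using delzant_facet(2)[OF D F \<open>y \<in> P\<close>] by simp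
  qed
  ultimately show ?thesis using that by blast
qed

lemma facet_form_affine: "facet_form P F ((1 - t) *\<^sub>R x + t *\<^sub>R y) = (1 - t) * facet_form P F x + t * facet_form P F y"
  by (simp add: facet_form_def inner_simps algebra_simps)

text \<open>On the way from an interior point to a point outside, a segment leaves \<open>P\<close>
  through a facet. The form of this facet is affine, positive at the start and zero strictly before
  the end, so it cannot be nonnegative at the end.\<close>

lemma delzant_halfspaces:
  fixes P :: "(real ^ 'n) set"
  assumes D: "delzant P"
  shows "P = {x. \<forall>F\<in>facets P. 0 \<le> facet_form P F x}"
proof (intro equalityI subsetI)
  fix x assume "x \<in> P" then show "x \<in> {x. \<forall>F\<in>facets P. 0 \<le> facet_form P F x}" using delzant_facet(2)[OF D] by blast
next
  fix x assume x: "x \<in> {x. \<forall>F\<in>facets P. 0 \<le> facet_form P F x}"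
  show "x \<in> P"
  proof (rule ccontr)
    assume xP: "x \<notin> P"
    obtain y where y: "y \<in> interior P" "\<forall>F\<in>facets P. 0 < facet_form P F y"
      using delzant_interior_point[OF D] .
    have yP: "y \<in> P" using y interior_subset by blast
    have dim: "aff_dim P = int DIM(real^'n)" using D by (auto simp: delzant_def)
    have hull: "affine hull P = UNIV" using dim aff_dim_eq_full[of P] by blast
    have "closed_segment y x \<inter> frontier P \<noteq> {}"
      by (rule connected_Int_frontier) (use yP xP in auto)
    then obtain z where z: "z \<in> closed_segment y x" "z \<in> frontier P" by blast
    have "closed P" using delzant_compact[OF D] compact_imp_closed by blast
    then have "z \<in> P - rel_interior P" using z by (simp add: frontier_def rel_interior_interior[OF hull])
    moreover have "polyhedron P" using D unfolding delzant_def by (blast intro: polytope_imp_polyhedron)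
    ultimately have "z \<in> \<Union>{F. F facet_of P}" using rel_boundary_of_polyhedron by metis
    then obtain F where F: "F \<in> facets P" "z \<in> F" unfolding facets_def by blast
    have z0: "facet_form P F z = 0" using delzant_facet(3)[OF D F(1)] F(2) by blast
    obtain t where t: "0 \<le> t" "t \<le> 1" "z = (1 - t) *\<^sub>R y + t *\<^sub>R x" using z(1) by (auto simp: in_segment)
    have "z \<in> P" using \<open>z \<in> P - rel_interior P\<close> by blast
    then have "t \<noteq> 1" using t(3) xP by auto
    then have "0 < (1 - t) * facet_form P F y" using t y(2) F(1) by simp
    moreover have "0 \<le> t * facet_form P F x" using t x F by simp
    ultimately show False using z0 by (simp add: t(3) facet_form_affine)
  qed
qed

lemma delzant_mem: "delzant P \<Longrightarrow> x \<in> P \<longleftrightarrow> (\<forall>F\<in>facets P. 0 \<le> facet_form P F x)"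
  using delzant_halfspaces by blast

text \<open>Any vertex of the intersection of the facets through \<open>x\<close> will do. The chart
  at this vertex then leaves out only facets whose forms are positive at \<open>x\<close>.\<close>

lemma delzant_active_vertex:
  assumes D: "delzant P" and x: "x \<in> P"
  obtains v where "v extreme_point_of P" "\<forall>F\<in>facets P. x \<in> F \<longrightarrow> v \<in> F"
proof -
  define G where "G = \<Inter>(insert P {F \<in> facets P. x \<in> F})"
  have P: "polytope P" using D by (simp add: delzant_def)
  have "G face_of P" unfolding G_def
    by (rule face_of_Inter) (use delzant_convex[OF D] face_of_refl in \<open>auto simp: facets_def facet_of_imp_face_of\<close>)
  moreover have "G \<noteq> {}" using x by (auto simp: G_def)
  ultimately obtain v where "v extreme_point_of G"
    using extreme_point_exists_convex[of G] face_of_polytope_polytope[OF P] polytope_imp_compact polytope_imp_convex by metis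
  then have "v extreme_point_of P" "v \<in> G" using extreme_point_of_face[OF \<open>G face_of P\<close>] by blast+
  then show ?thesis by (intro that[of v]) (auto simp: G_def)
qed

text \<open>A quantitative form of smoothness. The local comparison of distances depends on the
  polytope only through \<open>c\<close>, \<open>M\<close> and the number of facets, and a nearby
  polytope with the same normals inherits the cover with \<open>c / 2\<close> and the same
  \<open>M\<close>.\<close>

definition chart_cover :: "(real ^ 'n) set \<Rightarrow> real \<Rightarrow> real \<Rightarrow> bool" where
  "chart_cover P c M \<longleftrightarrow> (\<forall>x\<in>P. \<exists>A u. chart P A u \<and> (\<forall>F\<in>facets P - A. c \<le> facet_form P F x) \<and>
     (\<forall>G\<in>A. norm (u G) \<le> M) \<and> (\<forall>F\<in>facets P. \<forall>G\<in>A. \<bar>facet_normal P F \<bullet> u G\<bar> \<le> M))"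

lemma continuous_facet_form [continuous_intros]: "continuous_on S (facet_form P F)"
  unfolding facet_form_def by (intro continuous_intros)

text \<open>One vertex chart works on a neighbourhood of each point, and finitely many of these
  neighbourhoods cover \<open>P\<close> by compactness.\<close>

lemma chart_cover_exists:
  fixes P :: "(real ^ 'n) set"
  assumes D: "delzant P"
  obtains c M where "c > 0" "M \<ge> 1" "chart_cover P c M"
proof -
  \<comment> \<open>The factor 2 leaves room: on the neighbourhood \<open>U x\<close> below, the
    forms outside the chart stay above \<open>c x\<close>.\<close>
  define R where "R x A u c M \<longleftrightarrow> chart P A u \<and> c > 0 \<and> (\<forall>F\<in>facets P - A. 2 * c \<le> facet_form P F x) \<and>
     (\<forall>G\<in>A. norm (u G) \<le> M) \<and> (\<forall>F\<in>facets P. \<forall>G\<in>A. \<bar>facet_normal P F \<bullet> u G\<bar> \<le> M)" for x A u and c M :: real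
  have ex: "\<exists>A u c M. R x A u c M" if x: "x \<in> P" for x
  proof -
    obtain v where v: "v extreme_point_of P" "\<forall>F\<in>facets P. x \<in> F \<longrightarrow> v \<in> F"
      using delzant_active_vertex[OF D x] .
    define A where "A = {F \<in> facets P. v \<in> F}"
    obtain u where u: "chart P A u" unfolding A_def by (rule delzant_vertex[OF D v(1)])
    have finA: "finite A" using D by (simp add: A_def)
    have pos: "0 < facet_form P F x" if "F \<in> facets P - A" for F
      using delzant_facet(2,3)[OF D, of F] that v(2) x by (fastforce simp: A_def order_less_le)
    define c where "c = Min (insert 1 ((\<lambda>F. facet_form P F x) ` (facets P - A))) / 2"
    have "c > 0" using pos D by (simp add: c_def)
    moreover have "2 * c \<le> facet_form P F x" if "F \<in> facets P - A" for F
      using D that by (simp add: c_def)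
    moreover define M where "M = (\<Sum>G\<in>A. norm (u G)) + (\<Sum>F\<in>facets P. \<Sum>G\<in>A. \<bar>facet_normal P F \<bullet> u G\<bar>)"
    have "norm (u G) \<le> M" if "G \<in> A" for G
    proof -
      have "norm (u G) \<le> (\<Sum>G\<in>A. norm (u G))" by (rule member_le_sum) (use that finA in auto)
      then show ?thesis unfolding M_def by (simp add: add_increasing2 sum_nonneg)
    qed
    moreover have "\<bar>facet_normal P F \<bullet> u G\<bar> \<le> M" if "F \<in> facets P" "G \<in> A" for F G
    proof -
      have "\<bar>facet_normal P F \<bullet> u G\<bar> \<le> (\<Sum>G\<in>A. \<bar>facet_normal P F \<bullet> u G\<bar>)"
        by (rule member_le_sum) (use that finA in auto)
      also have "\<dots> \<le> (\<Sum>F\<in>facets P. \<Sum>G\<in>A. \<bar>facet_normal P F \<bullet> u G\<bar>)"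
        by (rule member_le_sum) (use that D in \<open>auto intro: sum_nonneg\<close>)
      finally show ?thesis unfolding M_def by (simp add: add_increasing sum_nonneg)
    qed
    ultimately show ?thesis using u unfolding R_def by blast
  qed
  obtain A u c M where R: "\<And>x. x \<in> P \<Longrightarrow> R x (A x) (u x) (c x) (M x)" using ex by metis
  have ch: "\<And>x. x \<in> P \<Longrightarrow> chart P (A x) (u x)" and c: "\<And>x. x \<in> P \<Longrightarrow> c x > 0"
    and far: "\<And>x F. x \<in> P \<Longrightarrow> F \<in> facets P - A x \<Longrightarrow> 2 * c x \<le> facet_form P F x"
    and uM: "\<And>x G. x \<in> P \<Longrightarrow> G \<in> A x \<Longrightarrow> norm (u x G) \<le> M x"
    and uM2: "\<And>x F G. x \<in> P \<Longrightarrow> F \<in> facets P \<Longrightarrow> G \<in> A x \<Longrightarrow> \<bar>facet_normal P F \<bullet> u x G\<bar> \<le> M x"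
    using R unfolding R_def by blast+
  define U where "U x = (\<Inter>F\<in>facets P - A x. {y. c x < facet_form P F y})" for x
  have opU: "open (U x)" for x unfolding U_def
    using D by (intro open_INT) (auto intro!: open_Collect_less continuous_intros)
  have xU: "x \<in> U x" if "x \<in> P" for x
  proof -
    have "c x < facet_form P F x" if "F \<in> facets P - A x" for F
      using far[OF \<open>x \<in> P\<close> that] c[OF \<open>x \<in> P\<close>] by linarith
    then show ?thesis by (simp add: U_def)
  qed
  have cover: "P \<subseteq> (\<Union>x\<in>P. U x)" using xU by blast
  obtain S where S: "S \<subseteq> P" "finite S" "P \<subseteq> (\<Union>x\<in>S. U x)"
    by (rule compactE_image[where f = U and C = P, OF delzant_compact[OF D] opU cover])
  define c' where "c' = Min (insert 1 (c ` S))"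
  define M' where "M' = Max (insert 1 (M ` S))"
  show thesis
  proof (rule that[of c' M'])
    show "c' > 0" using S c by (auto simp: c'_def)
    show "M' \<ge> 1" using S by (simp add: M'_def)
    show "chart_cover P c' M'" unfolding chart_cover_def
    proof
      fix y assume "y \<in> P"
      then obtain x where x: "x \<in> S" "y \<in> U x" using S by blast
      have cM: "c' \<le> c x" "M x \<le> M'" using x S by (auto simp: c'_def M'_def)
      have "x \<in> P" using x S by blast
      show "\<exists>A u. chart P A u \<and> (\<forall>F\<in>facets P - A. c' \<le> facet_form P F y) \<and>
        (\<forall>G\<in>A. norm (u G) \<le> M') \<and> (\<forall>F\<in>facets P. \<forall>G\<in>A. \<bar>facet_normal P F \<bullet> u G\<bar> \<le> M')"
      proof (intro exI[of _ "A x"] exI[of _ "u x"] conjI ballI)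
        show "chart P (A x) (u x)" using ch \<open>x \<in> P\<close> .
        show "c' \<le> facet_form P F y" if "F \<in> facets P - A x" for F
        proof -
          have "c x < facet_form P F y" using x(2) that by (simp add: U_def)
          then show ?thesis using cM(1) by linarith
        qed
        show "norm (u x G) \<le> M'" if "G \<in> A x" for G using uM[OF \<open>x \<in> P\<close> that] cM(2) by linarith
        show "\<bar>facet_normal P F \<bullet> u x G\<bar> \<le> M'" if "F \<in> facets P" "G \<in> A x" for F G
          using uM2[OF \<open>x \<in> P\<close> that] cM(2) by linarith
      qed
    qed
  qed
qed

section \<open>Hausdorff closeness and unit facet normals\<close>

lemma hausdorff_dist_near:
  fixes A B :: "'a::heine_borel set"
  assumes "compact A" "compact B" "A \<noteq> {}" "B \<noteq> {}" "hausdorff_dist A B < r"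
  shows "x \<in> A \<Longrightarrow> \<exists>y\<in>B. dist x y < r" "y \<in> B \<Longrightarrow> \<exists>x\<in>A. dist y x < r"
proof -
  have bdd: "bdd_above ((\<lambda>x. infdist x T) ` S)" if "compact S" for S T :: "'a set"
    using that by (intro bounded_imp_bdd_above compact_imp_bounded compact_continuous_image continuous_intros)
  have *: "\<exists>y\<in>T. dist x y < r" if sup: "(SUP x\<in>S. infdist x T) < r" and S: "compact S" "x \<in> S"
    and T: "compact T" "T \<noteq> {}" for S T :: "'a set" and x
  proof -
    have "infdist x T \<le> (SUP x\<in>S. infdist x T)" by (rule cSUP_upper[OF S(2) bdd[OF S(1)]])
    moreover obtain y where "y \<in> T" "infdist x T = dist x y"
      using infdist_attains_inf[OF compact_imp_closed[OF T(1)] T(2)] by blast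
    ultimately show ?thesis using sup by (intro bexI[of _ y]) auto
  qed
  show "x \<in> A \<Longrightarrow> \<exists>y\<in>B. dist x y < r" by (rule *[where S = A and T = B and x = x]) (use assms in \<open>auto simp: hausdorff_dist_def\<close>)
  show "y \<in> B \<Longrightarrow> \<exists>x\<in>A. dist y x < r" by (rule *[where S = B and T = A and x = y]) (use assms in \<open>auto simp: hausdorff_dist_def\<close>)
qed

lemma delzant_nonempty:
  assumes "delzant P"
  shows "P \<noteq> {}"
proof -
  obtain y where "y \<in> interior P" using delzant_interior_point[OF assms] .
  then show ?thesis using interior_subset by blast
qed

lemma delzant_near:
  assumes "delzant Q" "delzant P" "hausdorff_dist Q P < r"
  shows "x \<in> Q \<Longrightarrow> \<exists>y\<in>P. dist x y < r" "y \<in> P \<Longrightarrow> \<exists>x\<in>Q. dist y x < r"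
  by (rule hausdorff_dist_near; use assms in \<open>simp add: delzant_compact delzant_nonempty\<close>)+

lemma facet_form_diff: "facet_form P F x - facet_form P F y = facet_normal P F \<bullet> (x - y)"
  by (simp add: facet_form_def inner_diff_right inner_commute)

text \<open>Another facet through a relatively interior point of \<open>F\<close> would contain
  \<open>F\<close>, which is impossible for distinct facets of equal dimension; so near such a point
  only the form of \<open>F\<close> matters. The disc will test the tangential part of the normals
  of nearby polytopes.\<close>

lemma facet_rel_interior_point:
  fixes P :: "(real ^ 'n) set"
  assumes D: "delzant P" and F: "F \<in> facets P"
  obtains p r where "p \<in> F" "r > 0" "\<forall>d. norm d \<le> 1 \<and> facet_normal P F \<bullet> d = 0 \<longrightarrow> p + r *\<^sub>R d \<in> P"
proof -
  have Ff: "F facet_of P" "F face_of P" "F \<noteq> {}" "convex F" using F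
    by (auto simp: facets_def facet_of_def face_of_imp_convex)
  then obtain p where p: "p \<in> rel_interior F" using rel_interior_eq_empty by blast
  have pF: "p \<in> F" using p rel_interior_subset by blast
  then have pP: "p \<in> P" using Ff(2) face_of_imp_subset by blast
  have pos: "0 < facet_form P G p" if G: "G \<in> facets P" "G \<noteq> F" for G
  proof (rule ccontr)
    assume "\<not> 0 < facet_form P G p"
    then have "p \<in> G" using delzant_facet(2,3)[OF D G(1)] pP by force
    moreover have Gf: "G face_of P" "convex G" "aff_dim G = aff_dim F" using G(1) Ff(1)
      by (auto simp: facets_def facet_of_def face_of_imp_convex)
    ultimately have "F \<subseteq> G"
      using subset_of_face_of[OF Gf(1), of F] face_of_imp_subset[OF Ff(2)] p by blast
    then have "F face_of G" using Ff(2) Gf(1) by (meson face_of_face)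
    then show False using face_of_aff_dim_lt[OF Gf(2), of F] G(2) Gf(3) by auto
  qed
  define U where "U = (\<Inter>G\<in>facets P - {F}. {y. 0 < facet_form P G y})"
  have "open U" unfolding U_def
    using D by (intro open_INT) (auto intro!: open_Collect_less continuous_intros)
  moreover have "p \<in> U" using pos by (auto simp: U_def)
  ultimately obtain r where r: "r > 0" "cball p r \<subseteq> U" using open_contains_cball by blast
  have "p + r *\<^sub>R d \<in> P" if d: "norm d \<le> 1 \<and> facet_normal P F \<bullet> d = 0" for d
  proof -
    have "p + r *\<^sub>R d \<in> cball p r" using d r(1) by (simp add: dist_norm mult_left_le)
    then have inU: "p + r *\<^sub>R d \<in> U" using r by blast
    have "facet_form P F (p + r *\<^sub>R d) - facet_form P F p = 0" using d by (simp add: facet_form_diff)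
    moreover have "facet_form P F p = 0" using delzant_facet(3)[OF D F] pF by blast
    ultimately have "0 \<le> facet_form P G (p + r *\<^sub>R d)" if "G \<in> facets P" for G
      using inU that by (cases "G = F") (auto simp: U_def less_imp_le)
    then show ?thesis using delzant_halfspaces[OF D] by blast
  qed
  then show thesis using that[OF pF r(1)] by blast
qed

text \<open>Directions of normals are what Hausdorff closeness controls directly; the lengths of the
  primitive normals of a nearby polytope have no a priori bound.\<close>

definition facet_unit :: "(real ^ 'n) set \<Rightarrow> (real ^ 'n) set \<Rightarrow> real ^ 'n" where
  "facet_unit P F = sgn (facet_normal P F)"

lemma facet_unit:
  assumes "delzant P" "F \<in> facets P"
  shows "norm (facet_unit P F) = 1" "facet_normal P F = norm (facet_normal P F) *\<^sub>R facet_unit P F"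
    "1 \<le> norm (facet_normal P F)"
  using facet_normal_nonzero[OF assms] facet_normal_lattice[OF assms] int_lattice_norm_ge_1
  by (auto simp: facet_unit_def norm_sgn sgn_div_norm)

lemma facet_unit_inj:
  assumes D: "delzant P" and F: "F \<in> facets P" and G: "G \<in> facets P" and eq: "facet_unit P F = facet_unit P G"
  shows "F = G"
proof -
  have sub: "F \<subseteq> G" if F: "F \<in> facets P" and G: "G \<in> facets P" and eq: "facet_unit P F = facet_unit P G" for F G
  proof
    fix x assume x: "x \<in> F"
    obtain g where g: "g \<in> G" using G by (auto simp: facets_def facet_of_def)
    have xg: "x \<in> P" "g \<in> P" "facet_form P F x = 0" "facet_form P G g = 0"
      using delzant_facet(3)[OF D F] delzant_facet(3)[OF D G] x g by blast+
    have "0 \<le> facet_form P F g - facet_form P F x" using delzant_facet(2)[OF D F xg(2)] xg by simp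
    then have "0 \<le> norm (facet_normal P F) * (facet_unit P F \<bullet> (g - x))"
      unfolding facet_form_diff using facet_unit(2)[OF D F] by (metis inner_scaleR_left)
    moreover have "0 < norm (facet_normal P F)" using facet_unit(3)[OF D F] by linarith
    ultimately have "0 \<le> facet_unit P G \<bullet> (g - x)" using eq by (simp add: zero_le_mult_iff)
    then have "0 \<le> norm (facet_normal P G) * (facet_unit P G \<bullet> (g - x))" by simp
    then have "0 \<le> facet_form P G g - facet_form P G x"
      unfolding facet_form_diff using facet_unit(2)[OF D G] by (metis inner_scaleR_left)
    then have "facet_form P G x = 0" using xg delzant_facet(2)[OF D G xg(1)] by simp
    then show "x \<in> G" using delzant_facet(3)[OF D G] xg by blast
  qed
  show ?thesis using sub[OF F G eq] sub[OF G F eq[symmetric]] by blast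
qed

text \<open>A relatively interior point \<open>p\<close> of \<open>F\<close>, pushed outwards by
  \<open>2 * \<kappa>\<close>, leaves every nearby \<open>Q\<close> and so violates a facet
  inequality of \<open>Q\<close>. The unit normal \<open>?m\<close> of that facet is almost
  nonnegative on the vectors from \<open>p\<close> to points of \<open>P\<close>: the disc in
  \<open>F\<close> makes its tangential part small, and an interior point of \<open>P\<close>
  excludes the opposite direction.\<close>

lemma facet_unit_stable:
  fixes P :: "(real ^ 'n) set"
  assumes D: "delzant P" and F: "F \<in> facets P" and \<epsilon>: "\<epsilon> > 0"
  shows "\<exists>\<kappa>>0. \<forall>Q. delzant Q \<longrightarrow> hausdorff_dist Q P < \<kappa> \<longrightarrow>
    (\<exists>F'\<in>facets Q. norm (facet_unit Q F' - facet_unit P F) < \<epsilon>)"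
proof -
  let ?n = "facet_unit P F"
  note un = facet_unit[OF D F]
  obtain p r where p: "p \<in> F" "r > 0" and disc: "\<forall>d. norm d \<le> 1 \<and> facet_normal P F \<bullet> d = 0 \<longrightarrow> p + r *\<^sub>R d \<in> P"
    using facet_rel_interior_point[OF D F] .
  obtain y where y: "y \<in> interior P" "\<forall>F\<in>facets P. 0 < facet_form P F y"
    using delzant_interior_point[OF D] .
  have yP: "y \<in> P" using y interior_subset by blast
  have p0: "facet_form P F p = 0" and pP: "p \<in> P" using delzant_facet(3)[OF D F] p by blast+
  have form: "facet_form P F x = norm (facet_normal P F) * (?n \<bullet> (x - p))" for x
    using facet_form_diff[of P F x p] p0 un(2) by (metis diff_zero inner_scaleR_left)
  have pos: "0 < norm (facet_normal P F)" using un(3) by linarith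
  define a where "a = ?n \<bullet> (y - p)"
  have a: "a > 0" using y(2) F form[of y] pos by (auto simp: a_def zero_less_mult_iff)
  define K where "K = norm (y - p) + 1"
  have K: "K > 0" "norm (y - p) \<le> K" by (auto simp: K_def add_nonneg_pos)
  \<comment> \<open>A bound for the squared tangential part of \<open>?m\<close>. The first entry
    yields the final distance below \<open>\<epsilon>\<close>, the second makes
    \<open>\<bar>\<alpha>\<bar>\<close> at least 1/2, the third limits the tangential contribution
    at \<open>y\<close> to \<open>a / 4\<close>.\<close>
  define \<eta> where "\<eta> = min (min (\<epsilon>\<^sup>2 / 2) (3/4)) ((a / (4 * K))\<^sup>2) / 2"
  have \<eta>: "\<eta> > 0" "\<eta> < \<epsilon>\<^sup>2 / 2" "\<eta> < 3/4" "\<eta> < (a / (4 * K))\<^sup>2"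
  proof -
    have *: "0 < min (min (\<epsilon>\<^sup>2 / 2) (3/4)) ((a / (4 * K))\<^sup>2)" using \<epsilon> a K by simp
    show "\<eta> > 0" using * by (simp add: \<eta>_def)
    have "\<eta> < min (min (\<epsilon>\<^sup>2 / 2) (3/4)) ((a / (4 * K))\<^sup>2)" unfolding \<eta>_def using * by linarith
    then show "\<eta> < \<epsilon>\<^sup>2 / 2" "\<eta> < 3/4" "\<eta> < (a / (4 * K))\<^sup>2" by auto
  qed
  define \<kappa> where "\<kappa> = min (r * \<eta> / 3) (a / 24)"
  have \<kappa>: "\<kappa> > 0" "3 * \<kappa> \<le> r * \<eta>" "3 * \<kappa> \<le> a / 8" using p(2) \<eta>(1) a by (auto simp: \<kappa>_def)
  show ?thesis
  proof (intro exI[of _ \<kappa>] conjI allI impI)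
    fix Q :: "(real ^ 'n) set" assume Q: "delzant Q" and h: "hausdorff_dist Q P < \<kappa>"
    define p' where "p' = p - (2 * \<kappa>) *\<^sub>R ?n"
    have "p' \<notin> Q"
    proof
      assume "p' \<in> Q"
      then obtain q where q: "q \<in> P" "dist p' q < \<kappa>" using delzant_near(1)[OF Q D h] by blast
      have "0 \<le> ?n \<bullet> (q - p)" using delzant_facet(2)[OF D F q(1)] form[of q] pos by (simp add: zero_le_mult_iff)
      moreover have "?n \<bullet> (q - p') = ?n \<bullet> (q - p) + 2 * \<kappa>" using un(1)
        by (simp add: p'_def inner_simps norm_eq_1)
      moreover have "?n \<bullet> (q - p') \<le> norm ?n * norm (q - p')" by (rule norm_cauchy_schwarz)
      ultimately show False using q(2) un(1) \<kappa>(1) by (simp add: dist_norm norm_minus_commute)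
    qed
    then obtain F' where F': "F' \<in> facets Q" "facet_form Q F' p' < 0"
      using delzant_mem[OF Q, of p'] by (auto simp: not_le)
    let ?m = "facet_unit Q F'"
    note um = facet_unit[OF Q F'(1)]
    have mQ: "0 \<le> ?m \<bullet> (x - p')" if "x \<in> Q" for x
    proof -
      have "0 \<le> facet_form Q F' x - facet_form Q F' p'" using delzant_facet(2)[OF Q F'(1) that] F'(2) by simp
      then have "0 \<le> norm (facet_normal Q F') * (?m \<bullet> (x - p'))"
        unfolding facet_form_diff using um(2) by (metis inner_scaleR_left)
      moreover have "0 < norm (facet_normal Q F')" using um(3) by linarith
      ultimately show ?thesis by (simp add: zero_le_mult_iff)
    qed
    define \<alpha> where "\<alpha> = ?m \<bullet> ?n"
    have \<alpha>1: "\<bar>\<alpha>\<bar> \<le> 1" using Cauchy_Schwarz_ineq2[of ?m ?n] un um by (simp add: \<alpha>_def)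
    \<comment> \<open>One \<open>\<kappa>\<close> pays for replacing \<open>q\<close> by a point of
      \<open>Q\<close>, two for the shift from \<open>p'\<close> to \<open>p\<close>.\<close>
    have mP: "- 3 * \<kappa> \<le> ?m \<bullet> (q - p)" if q: "q \<in> P" for q
    proof -
      obtain x where x: "x \<in> Q" "dist q x < \<kappa>" using delzant_near(2)[OF Q D h q] by blast
      have "?m \<bullet> (x - q) \<le> norm ?m * norm (x - q)" by (rule norm_cauchy_schwarz)
      then have "?m \<bullet> (x - q) \<le> \<kappa>" using um x by (simp add: dist_norm norm_minus_commute)
      moreover have "?m \<bullet> (q - p) = ?m \<bullet> (x - p') - ?m \<bullet> (x - q) - 2 * \<kappa> * \<alpha>"
        by (simp add: p'_def \<alpha>_def inner_simps algebra_simps)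
      moreover have "2 * \<kappa> * \<alpha> \<le> 2 * \<kappa> * 1" by (rule mult_left_mono) (use \<alpha>1 \<kappa>(1) in auto)
      ultimately show ?thesis using mQ[OF x(1)] by linarith
    qed
    define d where "d = ?m - \<alpha> *\<^sub>R ?n"
    have nn: "?n \<bullet> ?n = 1" and mm: "?m \<bullet> ?m = 1" using un um by (auto simp: norm_eq_1)
    have dn: "d \<bullet> ?n = 0" using nn by (simp add: d_def inner_simps \<alpha>_def)
    have dd: "d \<bullet> d = 1 - \<alpha>\<^sup>2" using nn mm
      by (simp add: d_def inner_simps power2_eq_square inner_commute[of ?n ?m] flip: \<alpha>_def)
    have dm: "?m \<bullet> d = d \<bullet> d" using dn by (simp add: d_def inner_simps inner_commute)
    have d1: "norm d \<le> 1" using dd by (simp add: norm_le_square)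
    have "p + r *\<^sub>R (- d) \<in> P"
    proof -
      have "facet_normal P F \<bullet> d = norm (facet_normal P F) * (?n \<bullet> d)" by (metis un(2) inner_scaleR_left)
      then show ?thesis using disc[rule_format, of "- d"] d1 dn by (simp add: inner_commute)
    qed
    from mP[OF this] have "r * (d \<bullet> d) \<le> 3 * \<kappa>" by (simp add: dm)
    then have "r * (d \<bullet> d) \<le> r * \<eta>" using \<kappa>(2) by linarith
    then have d\<eta>: "d \<bullet> d \<le> \<eta>" using p(2) by simp
    \<comment> \<open>If \<open>\<alpha> \<le> - 1/2\<close>, then
      \<open>?m \<bullet> (y - p)\<close> is at most \<open>- a / 4\<close>, which is below the
      lower bound \<open>- 3 * \<kappa>\<close>.\<close>
    have "0 \<le> \<alpha>"
    proof (rule ccontr)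
      assume neg: "\<not> 0 \<le> \<alpha>"
      have "1/4 \<le> \<alpha>\<^sup>2" using d\<eta> dd \<eta>(3) by linarith
      then have "(1/2)\<^sup>2 \<le> (-\<alpha>)\<^sup>2" by (simp add: power2_eq_square)
      then have half: "1/2 \<le> - \<alpha>" using neg by (simp add: abs_le_square_iff[symmetric])
      have "d \<bullet> (y - p) \<le> norm d * norm (y - p)" by (rule norm_cauchy_schwarz)
      also have "\<dots> \<le> (a / (4 * K)) * K"
      proof (rule mult_mono)
        have "(norm d)\<^sup>2 \<le> (a / (4 * K))\<^sup>2" using d\<eta> \<eta>(4) by (simp add: power2_norm_eq_inner)
        then show "norm d \<le> a / (4 * K)" by (rule power2_le_imp_le) (use a K in auto)
      qed (use K a in auto)
      also have "\<dots> = a / 4" using K by simp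
      finally have "d \<bullet> (y - p) \<le> a / 4" .
      moreover have "?m \<bullet> (y - p) = \<alpha> * a + d \<bullet> (y - p)" by (simp add: d_def a_def inner_simps algebra_simps)
      moreover have "(1/2) * a \<le> (- \<alpha>) * a" by (rule mult_right_mono) (use half a in auto)
      ultimately show False using mP[OF yP] \<kappa>(3) a by linarith
    qed
    have "(1 - \<alpha>) * 1 \<le> (1 - \<alpha>) * (1 + \<alpha>)" by (rule mult_left_mono) (use \<open>0 \<le> \<alpha>\<close> \<alpha>1 in auto)
    then have "1 - \<alpha> \<le> d \<bullet> d" by (simp add: dd power2_eq_square algebra_simps)
    moreover have "(norm (?m - ?n))\<^sup>2 = 2 - 2 * \<alpha>" using nn mm
      by (simp add: power2_norm_eq_inner inner_simps \<alpha>_def inner_commute[of ?n ?m])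
    ultimately have "(norm (?m - ?n))\<^sup>2 < \<epsilon>\<^sup>2" using d\<eta> \<eta>(2) by linarith
    then have "norm (?m - ?n) < \<epsilon>" by (rule power2_less_imp_less) (use \<epsilon> in auto)
    then show "\<exists>F'\<in>facets Q. norm (facet_unit Q F' - ?n) < \<epsilon>" using F'(1) by blast
  qed (fact \<kappa>(1))
qed

section \<open>Stability of the facet normals\<close>

text \<open>Let \<open>w\<close> be the edge vector dual to the normal of \<open>\<sigma> F\<close>
  at a vertex of \<open>Q\<close>. As a nonzero lattice vector it has norm at least 1; it is
  orthogonal to the other normals at the vertex and has product 1 with that of
  \<open>\<sigma> F\<close>. If the latter normal were very long, \<open>w\<close> would be almost
  orthogonal to a whole basis of normals of \<open>P\<close> and therefore short. With its length
  bounded, the new normal has integral products with the chart vectors of \<open>P\<close>, all but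
  one of them smaller than 1 in modulus, so it is a multiple of the old normal.\<close>

lemma facet_normals_stable:
  fixes P :: "(real ^ 'n) set"
  assumes D: "delzant P"
  shows "\<exists>\<kappa>>0. \<forall>Q. delzant Q \<longrightarrow> hausdorff_dist Q P < \<kappa> \<longrightarrow> card (facets Q) = card (facets P) \<longrightarrow>
    (\<exists>\<sigma>. bij_betw \<sigma> (facets P) (facets Q) \<and> (\<forall>F\<in>facets P. facet_normal Q (\<sigma> F) = facet_normal P F))"
proof -
  have fin: "finite (facets P)" using D by simp
  obtain c M where c: "c > 0" and M: "M \<ge> 1" and cov: "chart_cover P c M" using chart_cover_exists[OF D] .
  define B where "B = M + (\<Sum>F\<in>facets P. norm (facet_normal P F))"
  have B1: "1 \<le> B" and MB: "M \<le> B" using M by (auto simp: B_def sum_nonneg add_increasing2)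
  have \<nu>B: "norm (facet_normal P F) \<le> B" if "F \<in> facets P" for F
  proof -
    have "norm (facet_normal P F) \<le> (\<Sum>F\<in>facets P. norm (facet_normal P F))"
      by (rule member_le_sum) (use that fin in auto)
    then show ?thesis using M by (simp add: B_def)
  qed
  define R where "R = diameter P + 1"
  have R0: "R > 0" using diameter_ge_0[OF compact_imp_bounded[OF delzant_compact[OF D]]] by (simp add: R_def)
  have R: "norm (x - y) \<le> R" if "x \<in> P" "y \<in> P" for x y
    using diameter_bounded_bound[OF compact_imp_bounded[OF delzant_compact[OF D]] that] by (simp add: R_def dist_norm)
  define S where "S = {(F, G) \<in> facets P \<times> facets P. F \<noteq> G}"
  define \<delta> where "\<delta> = Min (insert 1 ((\<lambda>(F, G). norm (facet_unit P F - facet_unit P G)) ` S))"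
  have finS: "finite S" unfolding S_def by (rule finite_subset[of _ "facets P \<times> facets P"]) (use fin in auto)
  have \<delta>: "\<delta> > 0" unfolding \<delta>_def using finS facet_unit_inj[OF D] by (auto simp: S_def)
  have \<delta>le: "\<delta> \<le> norm (facet_unit P F - facet_unit P G)" if "F \<in> facets P" "G \<in> facets P" "F \<noteq> G" for F G
    unfolding \<delta>_def by (rule Min_le) (use finS that in \<open>auto simp: S_def\<close>)
  define n where "n = real CARD('n)"
  have n: "n \<ge> 1" by (simp add: n_def Suc_le_eq)
  \<comment> \<open>The entries serve, in this order, for: injectivity of \<open>\<sigma>\<close>,
    absorbing \<open>norm w\<close>, integers of modulus below 1, matching of the charts at
    neighbouring points, excluding reversed directions.\<close>
  define \<epsilon> where "\<epsilon> = Min {\<delta> / 2, 1 / (2 * n * B\<^sup>2), 1 / (4 * B ^ 3), c / (4 * B * R), 1}"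
  have Bpos: "0 < B" using B1 by linarith
  have "0 < \<epsilon>" using \<delta> n Bpos c R0 by (simp add: \<epsilon>_def)
  have \<epsilon>1: "\<epsilon> \<le> \<delta> / 2" "\<epsilon> \<le> 1 / (2 * n * B\<^sup>2)" "\<epsilon> \<le> 1 / (4 * B ^ 3)" "\<epsilon> \<le> c / (4 * B * R)" "\<epsilon> \<le> 1"
    by (simp_all add: \<epsilon>_def)
  have \<epsilon>2: "n * B\<^sup>2 * \<epsilon> \<le> 1 / 2" "2 * B\<^sup>2 * \<epsilon> * B < 1" "B * (\<epsilon> * R) \<le> c / 4"
  proof -
    have "n * B\<^sup>2 * \<epsilon> \<le> n * B\<^sup>2 * (1 / (2 * n * B\<^sup>2))" using \<epsilon>1(2) n by (intro mult_left_mono) auto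
    then show "n * B\<^sup>2 * \<epsilon> \<le> 1 / 2" using n Bpos by simp
    have "2 * B ^ 3 * \<epsilon> \<le> 2 * B ^ 3 * (1 / (4 * B ^ 3))" using \<epsilon>1(3) Bpos by (intro mult_left_mono) auto
    then have "2 * B ^ 3 * \<epsilon> \<le> 1 / 2" using Bpos by simp
    then show "2 * B\<^sup>2 * \<epsilon> * B < 1" by (simp add: power2_eq_square power3_eq_cube algebra_simps)
    have "B * R * \<epsilon> \<le> B * R * (c / (4 * B * R))" using \<epsilon>1(4) Bpos R0 by (intro mult_left_mono) auto
    then show "B * (\<epsilon> * R) \<le> c / 4" using Bpos R0 by (simp add: algebra_simps)
  qed
  have "\<forall>F\<in>facets P. \<exists>\<kappa>>0. \<forall>Q. delzant Q \<longrightarrow> hausdorff_dist Q P < \<kappa> \<longrightarrow>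
    (\<exists>F'\<in>facets Q. norm (facet_unit Q F' - facet_unit P F) < \<epsilon>)"
    using facet_unit_stable[OF D _ \<open>0 < \<epsilon>\<close>] by blast
  from bchoice[OF this] obtain \<kappa>0 where \<kappa>0: "\<forall>F\<in>facets P. \<kappa>0 F > 0 \<and> (\<forall>Q. delzant Q \<longrightarrow> hausdorff_dist Q P < \<kappa>0 F \<longrightarrow>
    (\<exists>F'\<in>facets Q. norm (facet_unit Q F' - facet_unit P F) < \<epsilon>))" ..
  define \<kappa> where "\<kappa> = Min (insert (c / (8 * B)) (\<kappa>0 ` facets P))"
  have \<kappa>: "\<kappa> > 0" unfolding \<kappa>_def using fin \<kappa>0 c Bpos by auto
  have "\<kappa> \<le> c / (8 * B)" using fin by (simp add: \<kappa>_def)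
  then have "B * \<kappa> \<le> B * (c / (8 * B))" using Bpos by (intro mult_left_mono) auto
  then have \<kappa>B: "B * (2 * \<kappa>) \<le> c / 4" using Bpos by simp
  have \<kappa>le: "\<kappa> \<le> \<kappa>0 F" if "F \<in> facets P" for F using fin that by (simp add: \<kappa>_def)
  show ?thesis
  proof (intro exI[of _ \<kappa>] conjI allI impI)
    show "0 < \<kappa>" by (fact \<kappa>)
    fix Q :: "(real ^ 'n) set" assume Q: "delzant Q" and h: "hausdorff_dist Q P < \<kappa>" and card: "card (facets Q) = card (facets P)"
    have finQ: "finite (facets Q)" using Q by simp
    have "\<forall>F\<in>facets P. \<exists>F'. F' \<in> facets Q \<and> norm (facet_unit Q F' - facet_unit P F) < \<epsilon>"
      using \<kappa>0 \<kappa>le h Q by (meson less_le_trans)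
    from bchoice[OF this] obtain \<sigma> where \<sigma>: "\<forall>F\<in>facets P. \<sigma> F \<in> facets Q \<and> norm (facet_unit Q (\<sigma> F) - facet_unit P F) < \<epsilon>" ..
    have "inj_on \<sigma> (facets P)"
    proof (rule inj_onI, rule ccontr)
      fix F G assume FG: "F \<in> facets P" "G \<in> facets P" "\<sigma> F = \<sigma> G" "F \<noteq> G"
      have "norm (facet_unit P F - facet_unit P G) \<le>
          norm (facet_unit Q (\<sigma> F) - facet_unit P G) + norm (facet_unit Q (\<sigma> F) - facet_unit P F)"
        using norm_triangle_ineq4[of "facet_unit Q (\<sigma> F) - facet_unit P G" "facet_unit Q (\<sigma> F) - facet_unit P F"] by simp
      also have "\<dots> < \<epsilon> + \<epsilon>" using \<sigma> FG by (metis add_strict_mono)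
      finally show False using \<delta>le[OF FG(1,2,4)] \<epsilon>1(1) by linarith
    qed
    then have bij: "bij_betw \<sigma> (facets P) (facets Q)"
    proof -
      have "\<sigma> ` facets P = facets Q"
        by (rule card_subset_eq[OF finQ])
          (use \<sigma> card card_image[OF \<open>inj_on \<sigma> (facets P)\<close>] in auto)
      then show ?thesis using \<open>inj_on \<sigma> (facets P)\<close> by (simp add: bij_betw_def)
    qed
    have "facet_normal Q (\<sigma> F) = facet_normal P F" if F: "F \<in> facets P" for F
    proof -
      have \<sigma>F: "\<sigma> F \<in> facets Q" using \<sigma> F by blast
      obtain v where v: "v extreme_point_of Q" "v \<in> \<sigma> F" using delzant_facet_vertex[OF Q \<sigma>F] .
      define A' where "A' = {F \<in> facets Q. v \<in> F}"
      obtain u' where u': "chart Q A' u'" unfolding A'_def by (rule delzant_vertex[OF Q v(1)])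
      have vQ: "v \<in> Q" using v(1) by (simp add: extreme_point_of_def)
      obtain x where x: "x \<in> P" "dist v x < \<kappa>" using delzant_near(1)[OF Q D h vQ] by blast
      obtain A u where ch: "chart P A u" and far: "\<forall>F\<in>facets P - A. c \<le> facet_form P F x"
        and uM: "\<forall>G\<in>A. norm (u G) \<le> M" using cov x(1) unfolding chart_cover_def by blast
      have near: "G \<in> A" if G: "G \<in> facets P" "\<sigma> G \<in> A'" for G
      proof (rule ccontr)
        assume "G \<notin> A"
        then have "c \<le> facet_form P G x" using far G by blast
        obtain y where yG: "y \<in> G" using G(1) by (auto simp: facets_def facet_of_def)
        then have y: "y \<in> P" "facet_form P G y = 0" using delzant_facet(3)[OF D G(1)] by blast+
        obtain y' where y': "y' \<in> Q" "dist y y' < \<kappa>" using delzant_near(2)[OF Q D h y(1)] by blast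
        let ?n = "facet_unit P G" and ?m = "facet_unit Q (\<sigma> G)"
        have \<sigma>G: "\<sigma> G \<in> facets Q" using \<sigma> G by blast
        note un = facet_unit[OF D G(1)] and um = facet_unit[OF Q \<sigma>G]
        have "facet_form Q (\<sigma> G) v = 0" using delzant_facet(3)[OF Q \<sigma>G] G(2) by (auto simp: A'_def)
        then have "0 \<le> facet_form Q (\<sigma> G) y' - facet_form Q (\<sigma> G) v" using delzant_facet(2)[OF Q \<sigma>G y'(1)] by simp
        then have "0 \<le> norm (facet_normal Q (\<sigma> G)) * (?m \<bullet> (y' - v))"
          unfolding facet_form_diff using um(2) by (metis inner_scaleR_left)
        moreover have "0 < norm (facet_normal Q (\<sigma> G))" using um(3) by linarith
        ultimately have 1: "0 \<le> ?m \<bullet> (y' - v)" by (simp add: zero_le_mult_iff)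
        have "?n \<bullet> (x - y) = (?n - ?m) \<bullet> (x - y) + ?m \<bullet> (x - v) + ?m \<bullet> (y' - y) - ?m \<bullet> (y' - v)"
          by (simp add: inner_simps)
        also have "\<dots> \<le> \<epsilon> * R + \<kappa> + \<kappa>"
        proof -
          have "(?n - ?m) \<bullet> (x - y) \<le> norm (?n - ?m) * norm (x - y)" by (rule norm_cauchy_schwarz)
          also have "\<dots> \<le> \<epsilon> * R" using \<sigma> G(1) R[OF x(1) y(1)] \<open>0 < \<epsilon>\<close>
            by (intro mult_mono) (auto simp: norm_minus_commute less_imp_le)
          finally have "(?n - ?m) \<bullet> (x - y) \<le> \<epsilon> * R" .
          moreover have "?m \<bullet> (x - v) \<le> norm ?m * norm (x - v)" by (rule norm_cauchy_schwarz)
          moreover have "?m \<bullet> (y' - y) \<le> norm ?m * norm (y' - y)" by (rule norm_cauchy_schwarz)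
          ultimately show ?thesis using 1 um(1) x(2) y'(2) by (simp add: dist_norm norm_minus_commute)
        qed
        finally have 2: "?n \<bullet> (x - y) \<le> \<epsilon> * R + 2 * \<kappa>" by simp
        have "facet_form P G x = norm (facet_normal P G) * (?n \<bullet> (x - y))"
          using facet_form_diff[of P G x y] y(2) un(2) by (metis diff_zero inner_scaleR_left)
        also have "\<dots> \<le> norm (facet_normal P G) * (\<epsilon> * R + 2 * \<kappa>)" using 2 by (intro mult_left_mono) auto
        also have "\<dots> \<le> B * (\<epsilon> * R + 2 * \<kappa>)" using \<nu>B[OF G(1)] \<open>0 < \<epsilon>\<close> R0 \<kappa> by (intro mult_right_mono) auto
        also have "\<dots> \<le> c / 2" using \<epsilon>2(3) \<kappa>B by (simp add: distrib_left)
        finally show False using \<open>c \<le> facet_form P G x\<close> c by simp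
      qed
      have chA: "A \<subseteq> facets P" "card A = CARD('n)" "finite A" using ch fin finite_subset by (auto simp: chart_def)
      \<comment> \<open>\<open>A2\<close> and \<open>A\<close> both have \<open>CARD('n)\<close>
        elements, so the inclusion just shown is an equality and the two charts correspond.\<close>
      define A2 where "A2 = {G \<in> facets P. \<sigma> G \<in> A'}"
      have "\<sigma> ` A2 = A'" using bij unfolding bij_betw_def A2_def A'_def by blast
      moreover have "inj_on \<sigma> A2" using \<open>inj_on \<sigma> (facets P)\<close> by (rule inj_on_subset) (auto simp: A2_def)
      ultimately have "card A2 = card A'" using card_image by metis
      then have "card A2 = card A" using u' chA by (simp add: chart_def)
      moreover have "A2 \<subseteq> A" using near by (auto simp: A2_def)
      ultimately have "A2 = A" using chA(3) card_subset_eq by metis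
      then have \<sigma>A: "\<sigma> G \<in> A'" if "G \<in> A" for G using that by (auto simp: A2_def)
      have FA: "F \<in> A" using \<open>A2 = A\<close> F v(2) \<sigma>F by (auto simp: A2_def A'_def)
      let ?\<nu> = "facet_normal P" and ?\<mu> = "\<lambda>G. facet_normal Q (\<sigma> G)"
      define w where "w = u' (\<sigma> F)"
      have wI: "w \<in> int_lattice" using u' \<sigma>A[OF FA] by (simp add: chart_def w_def)
      have \<mu>w: "?\<mu> G \<bullet> w = (if G = F then 1 else 0)" if "G \<in> A" for G
      proof -
        have "?\<mu> G \<bullet> w = (if \<sigma> G = \<sigma> F then 1 else 0)"
          using u' \<sigma>A[OF FA] \<sigma>A[OF that] unfolding chart_def w_def by blast
        moreover have "\<sigma> G = \<sigma> F \<longleftrightarrow> G = F"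
          using \<open>inj_on \<sigma> (facets P)\<close> that F chA(1) by (meson inj_on_eq_iff subsetD)
        ultimately show ?thesis by simp
      qed
      have w1: "1 \<le> norm w" using int_lattice_norm_ge_1[OF wI] \<mu>w[OF FA] by fastforce
      define N where "N = norm (?\<mu> F)"
      have N1: "1 \<le> N" using facet_unit(3)[OF Q \<sigma>F] by (simp add: N_def)
      \<comment> \<open>Only the product with the normal of \<open>F\<close> keeps a term without
        the factor \<open>\<epsilon>\<close>, and this term decays as the length \<open>N\<close> of
        the new normal grows.\<close>
      have bound: "\<bar>w \<bullet> ?\<nu> G\<bar> \<le> B * (\<epsilon> * norm w) + (if G = F then B / N else 0)" if "G \<in> A" for G
      proof -
        let ?n = "facet_unit P G" and ?m = "facet_unit Q (\<sigma> G)"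
        have GP: "G \<in> facets P" and \<sigma>G: "\<sigma> G \<in> facets Q" using that chA \<sigma> by auto
        note un = facet_unit[OF D GP] and um = facet_unit[OF Q \<sigma>G]
        have pos: "0 < norm (?\<mu> G)" using um(3) by linarith
        have "?m \<bullet> w = (if G = F then 1 / N else 0)"
        proof -
          have "norm (?\<mu> G) * (?m \<bullet> w) = (if G = F then 1 else 0)" using \<mu>w[OF that] um(2) by (metis inner_scaleR_left)
          then show ?thesis using pos by (cases "G = F") (simp_all add: N_def field_simps)
        qed
        then have "\<bar>?m \<bullet> w\<bar> = (if G = F then 1 / N else 0)" using N1 by simp
        moreover have "\<bar>?n \<bullet> w\<bar> \<le> \<bar>(?n - ?m) \<bullet> w\<bar> + \<bar>?m \<bullet> w\<bar>" by (simp add: inner_diff_left)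
        moreover have "\<bar>(?n - ?m) \<bullet> w\<bar> \<le> norm (?n - ?m) * norm w" by (rule Cauchy_Schwarz_ineq2)
        moreover have "norm (?n - ?m) * norm w \<le> \<epsilon> * norm w"
          using \<sigma> GP by (intro mult_right_mono) (auto simp: norm_minus_commute less_imp_le)
        ultimately have "\<bar>?n \<bullet> w\<bar> \<le> \<epsilon> * norm w + (if G = F then 1 / N else 0)"
          by linarith
        moreover have "\<bar>w \<bullet> ?\<nu> G\<bar> = norm (?\<nu> G) * \<bar>?n \<bullet> w\<bar>"
          using un(2) by (metis abs_mult abs_norm_cancel inner_commute inner_scaleR_left)
        moreover have "norm (?\<nu> G) * \<bar>?n \<bullet> w\<bar> \<le> B * \<bar>?n \<bullet> w\<bar>" using \<nu>B[OF GP] by (intro mult_right_mono) auto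
        moreover have "B * \<bar>?n \<bullet> w\<bar> \<le> B * (\<epsilon> * norm w + (if G = F then 1 / N else 0))"
          if "\<bar>?n \<bullet> w\<bar> \<le> \<epsilon> * norm w + (if G = F then 1 / N else 0)"
          using that Bpos by (intro mult_left_mono) auto
        ultimately have "\<bar>w \<bullet> ?\<nu> G\<bar> \<le> B * (\<epsilon> * norm w + (if G = F then 1 / N else 0))" by linarith
        then show ?thesis by (cases "G = F") (simp_all add: distrib_left)
      qed
      have "w = (\<Sum>G\<in>A. (w \<bullet> ?\<nu> G) *\<^sub>R u G)" using ch by (simp add: chart_def)
      then have "norm w \<le> (\<Sum>G\<in>A. \<bar>w \<bullet> ?\<nu> G\<bar> * norm (u G))"
        by (metis (mono_tags, lifting) norm_scaleR norm_sum order_trans sum_mono order_refl)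
      also have "\<dots> \<le> (\<Sum>G\<in>A. (B * (\<epsilon> * norm w) + (if G = F then B / N else 0)) * B)"
      proof (intro sum_mono mult_mono)
        fix G assume G: "G \<in> A"
        show "\<bar>w \<bullet> ?\<nu> G\<bar> \<le> B * (\<epsilon> * norm w) + (if G = F then B / N else 0)" by (rule bound[OF G])
        then show "0 \<le> B * (\<epsilon> * norm w) + (if G = F then B / N else 0)" by (meson abs_ge_zero order_trans)
        show "norm (u G) \<le> B" using uM G MB by (meson order_trans)
      qed auto
      also have "\<dots> = (\<Sum>G\<in>A. B * (\<epsilon> * norm w) * B + (if G = F then B / N * B else 0))"
        by (rule sum.cong) (auto simp: algebra_simps)
      also have "\<dots> = n * (B * (\<epsilon> * norm w) * B) + B / N * B"
        using chA FA by (simp add: sum.distrib n_def)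
      also have "\<dots> = n * B\<^sup>2 * \<epsilon> * norm w + B\<^sup>2 / N" by (simp add: power2_eq_square)
      also have "\<dots> \<le> 1 / 2 * norm w + B\<^sup>2 / N" using \<epsilon>2(1) by (intro add_mono mult_right_mono) auto
      finally have "1 / 2 \<le> B\<^sup>2 / N" using w1 by linarith
      then have N2: "N \<le> 2 * B\<^sup>2" using N1 by (simp add: field_simps)
      let ?n = "facet_unit P F" and ?m = "facet_unit Q (\<sigma> F)"
      note un = facet_unit[OF D F] and um = facet_unit[OF Q \<sigma>F]
      \<comment> \<open>\<open>?n\<close> is orthogonal to \<open>u G\<close>, so only the deviation
        of \<open>?m\<close> from \<open>?n\<close> contributes; scaled by
        \<open>N \<le> 2 * B\<^sup>2\<close> it stays below 1, whereas the product is an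
        integer.\<close>
      have zero: "?\<mu> F \<bullet> u G = 0" if G: "G \<in> A" "G \<noteq> F" for G
      proof -
        have "norm (?\<nu> F) * (?n \<bullet> u G) = 0" using ch G FA un(2) unfolding chart_def by (metis inner_scaleR_left)
        then have "?n \<bullet> u G = 0" using un(3) by auto
        then have "?\<mu> F \<bullet> u G = N * ((?m - ?n) \<bullet> u G)" using um(2) by (simp add: N_def inner_diff_left) (metis inner_scaleR_left)
        then have "\<bar>?\<mu> F \<bullet> u G\<bar> = N * \<bar>(?m - ?n) \<bullet> u G\<bar>" using N1 by (simp add: abs_mult)
        also have "\<dots> \<le> 2 * B\<^sup>2 * (\<epsilon> * B)"
        proof (rule mult_mono[OF N2])
          have "\<bar>(?m - ?n) \<bullet> u G\<bar> \<le> norm (?m - ?n) * norm (u G)" by (rule Cauchy_Schwarz_ineq2)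
          also have "\<dots> \<le> \<epsilon> * B" using \<sigma> F uM G MB \<open>0 < \<epsilon>\<close> by (intro mult_mono) (auto intro: less_imp_le order_trans)
          finally show "\<bar>(?m - ?n) \<bullet> u G\<bar> \<le> \<epsilon> * B" .
        qed auto
        also have "\<dots> < 1" using \<epsilon>2(2) by (simp add: algebra_simps)
        finally have "\<bar>?\<mu> F \<bullet> u G\<bar> < 1" .
        moreover have "?\<mu> F \<bullet> u G \<in> \<int>"
          using int_lattice_inner[OF facet_normal_lattice[OF Q \<sigma>F]] ch G by (auto simp: chart_def)
        ultimately show ?thesis using Ints_nonzero_abs_less1 by blast
      qed
      have "?\<mu> F = (\<Sum>G\<in>A. (?\<mu> F \<bullet> u G) *\<^sub>R ?\<nu> G)" using ch by (simp add: chart_def)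
      also have "\<dots> = (\<Sum>G\<in>A. if G = F then (?\<mu> F \<bullet> u F) *\<^sub>R ?\<nu> F else 0)" by (rule sum.cong) (auto simp: zero)
      also have "\<dots> = (?\<mu> F \<bullet> u F) *\<^sub>R ?\<nu> F" using chA FA by simp
      finally have \<mu>: "?\<mu> F = (?\<mu> F \<bullet> u F) *\<^sub>R ?\<nu> F" .
      have "?\<mu> F \<bullet> u F \<in> \<int>"
        using int_lattice_inner[OF facet_normal_lattice[OF Q \<sigma>F]] ch FA by (auto simp: chart_def)
      then obtain m :: int where m: "?\<mu> F \<bullet> u F = of_int m" by (auto elim: Ints_cases)
      \<comment> \<open>A negative multiple would have the opposite unit normal, at distance
        2.\<close>
      have "0 < m"
      proof (rule ccontr)
        assume "\<not> 0 < m"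
        moreover have "m \<noteq> 0" using \<mu> m facet_normal_nonzero[OF Q \<sigma>F] by auto
        ultimately have "m < 0" by simp
        then have "?m = - ?n" using \<mu> m by (simp add: facet_unit_def sgn_scaleR)
        then have "?m - ?n = - (2 *\<^sub>R ?n)" by (simp add: scaleR_2)
        then have "norm (?m - ?n) = norm (2 *\<^sub>R ?n)" by (metis norm_minus_cancel)
        then have "norm (?m - ?n) = 2" using un(1) by simp
        moreover have "norm (?m - ?n) < \<epsilon>" using \<sigma> F by blast
        ultimately show False using \<epsilon>1(5) by simp
      qed
      have "?\<mu> F = real (nat m) *\<^sub>R ?\<nu> F" using \<mu> m \<open>0 < m\<close> by simp
      moreover have "?\<nu> F \<in> int_lattice" using facet_normal_lattice[OF D F] .
      ultimately have "nat m = 1" using delzant_facet(1)[OF Q \<sigma>F] unfolding primitive_vec_def by blast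
      then show ?thesis using \<open>?\<mu> F = real (nat m) *\<^sub>R ?\<nu> F\<close> by simp
    qed
    then show "\<exists>\<sigma>. bij_betw \<sigma> (facets P) (facets Q) \<and> (\<forall>F\<in>facets P. facet_normal Q (\<sigma> F) = facet_normal P F)"
      using bij by blast
  qed
qed

section \<open>Linear algebra\<close>

lemma inner_cis_mult: "(cis a * x) \<bullet> (cis a * y) = x \<bullet> y"
proof -
  have "(cis a * x) \<bullet> (cis a * y) = (cos a * Re x - sin a * Im x) * (cos a * Re y - sin a * Im y)
      + (cos a * Im x + sin a * Re x) * (cos a * Im y + sin a * Re y)"
    by (simp add: inner_complex_def)
  also have "\<dots> = ((cos a)\<^sup>2 + (sin a)\<^sup>2) * (Re x * Re y + Im x * Im y)" by algebra
  finally show ?thesis by (simp add: inner_complex_def)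
qed

lemma rotate_by_cis: "rotate_by \<theta> z = (\<lambda>F. cis (2 * pi * \<theta> F) * z F)"
  by (simp add: rotate_by_def cis_conv_exp mult_ac)

lemma cmod_rotate_by [simp]: "cmod (rotate_by \<theta> z F) = cmod (z F)"
  by (simp add: rotate_by_cis norm_mult)

lemma rotate_by_rotate_by [simp]: "rotate_by \<theta> (rotate_by \<phi> z) = rotate_by (\<lambda>F. \<theta> F + \<phi> F) z"
  by (simp add: rotate_by_cis cis_mult mult.assoc[symmetric] distrib_left)

lemma rotate_by_0 [simp]: "rotate_by (\<lambda>F. 0) z = z"
  by (simp add: rotate_by_cis)

definition cnorm :: "(real ^ 'n) set \<Rightarrow> 'n cvec \<Rightarrow> real" where
  "cnorm P v = sqrt (flat_inner P v v)"

lemma cnorm_L2: "cnorm P v = L2_set (\<lambda>F. cmod (v F)) (facets P) / sqrt pi"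
  by (simp add: cnorm_def flat_inner_def L2_set_def real_sqrt_divide dot_square_norm)

lemma cnorm_nonneg [simp]: "0 \<le> cnorm P v"
  by (simp add: cnorm_L2)

lemma cnorm_sq: "(cnorm P v)\<^sup>2 = flat_inner P v v"
  by (simp add: cnorm_def flat_inner_def sum_nonneg)

lemma cnorm_cong: "(\<And>F. F \<in> facets P \<Longrightarrow> cmod (v F) = cmod (w F)) \<Longrightarrow> cnorm P v = cnorm P w"
  unfolding cnorm_L2 by (simp cong: L2_set_cong_simp)

lemma cnorm_triangle: "cnorm P (\<lambda>F. v F + w F) \<le> cnorm P v + cnorm P w"
proof -
  have "L2_set (\<lambda>F. cmod (v F + w F)) (facets P) \<le> L2_set (\<lambda>F. cmod (v F) + cmod (w F)) (facets P)"
    by (rule L2_set_mono) (auto intro: norm_triangle_ineq)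
  also have "\<dots> \<le> L2_set (\<lambda>F. cmod (v F)) (facets P) + L2_set (\<lambda>F. cmod (w F)) (facets P)"
    by (rule L2_set_triangle_ineq)
  finally show ?thesis by (simp add: cnorm_L2 divide_right_mono flip: add_divide_distrib)
qed

lemma cnorm_minus_commute: "cnorm P (\<lambda>F. v F - w F) = cnorm P (\<lambda>F. w F - v F)"
  by (rule cnorm_cong) (rule norm_minus_commute)

lemma cnorm_diff_triangle: "cnorm P (\<lambda>F. u F - w F) \<le> cnorm P (\<lambda>F. u F - v F) + cnorm P (\<lambda>F. v F - w F)"
  using cnorm_triangle[of P "\<lambda>F. u F - v F" "\<lambda>F. v F - w F"] by simp

lemma cmod_le_cnorm: "finite (facets P) \<Longrightarrow> F \<in> facets P \<Longrightarrow> cmod (v F) \<le> sqrt pi * cnorm P v"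
  using member_le_L2_set[of "facets P" F "\<lambda>F. cmod (v F)"] by (simp add: cnorm_L2)

lemma flat_inner_Cauchy_Schwarz: "flat_inner P v w \<le> cnorm P v * cnorm P w"
proof -
  have "(\<Sum>F\<in>facets P. v F \<bullet> w F) \<le> (\<Sum>F\<in>facets P. \<bar>cmod (v F)\<bar> * \<bar>cmod (w F)\<bar>)"
    by (rule sum_mono) (simp add: norm_cauchy_schwarz)
  also have "\<dots> \<le> L2_set (\<lambda>F. cmod (v F)) (facets P) * L2_set (\<lambda>F. cmod (w F)) (facets P)"
    by (rule L2_set_mult_ineq)
  finally have "(1 / pi) * (\<Sum>F\<in>facets P. v F \<bullet> w F)
      \<le> (1 / pi) * (L2_set (\<lambda>F. cmod (v F)) (facets P) * L2_set (\<lambda>F. cmod (w F)) (facets P))"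
    by (intro mult_left_mono) auto
  then show ?thesis by (simp add: cnorm_L2 flat_inner_def)
qed

lemma cnorm_rotate_diff [simp]: "cnorm P (\<lambda>F. rotate_by \<theta> v F - rotate_by \<theta> w F) = cnorm P (\<lambda>F. v F - w F)"
  by (rule cnorm_cong) (simp add: rotate_by_cis norm_mult flip: right_diff_distrib)

lemma normal_map_add: "normal_map P (\<lambda>F. \<theta> F + \<phi> F) = normal_map P \<theta> + normal_map P \<phi>"
  by (simp add: normal_map_def scaleR_add_left sum.distrib)

lemma normal_map_diff: "normal_map P (\<lambda>F. \<theta> F - \<phi> F) = normal_map P \<theta> - normal_map P \<phi>"
  by (simp add: normal_map_def scaleR_diff_left sum_subtractf)

lemma normal_map_minus: "normal_map P (\<lambda>F. - \<theta> F) = - normal_map P \<theta>"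
  by (simp add: normal_map_def sum_negf)

lemma normal_map_scale: "normal_map P (\<lambda>F. c * \<theta> F) = c *\<^sub>R normal_map P \<theta>"
  by (simp add: normal_map_def scaleR_sum_right)

lemma normal_map_0 [simp]: "normal_map P (\<lambda>F. 0) = 0"
  by (simp add: normal_map_def)

lemma int_lattice_0 [simp]: "0 \<in> int_lattice"
  by (simp add: int_lattice_def)

lemma int_lattice_add: "x \<in> int_lattice \<Longrightarrow> y \<in> int_lattice \<Longrightarrow> x + y \<in> int_lattice"
  by (simp add: int_lattice_def)

lemma int_lattice_minus: "x \<in> int_lattice \<Longrightarrow> - x \<in> int_lattice"
  by (simp add: int_lattice_def)

lemma int_lattice_diff: "x \<in> int_lattice \<Longrightarrow> y \<in> int_lattice \<Longrightarrow> x - y \<in> int_lattice"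
  by (simp add: int_lattice_def)

lemma rotate_by_level_set: "z \<in> level_set P \<Longrightarrow> rotate_by \<theta> z \<in> level_set P"
  by (simp add: level_set_def) (simp add: rotate_by_def)

lemma level_set_point:
  assumes "delzant P" "z \<in> level_set P"
  obtains x where "x \<in> P" "\<forall>F\<in>facets P. (cmod (z F))\<^sup>2 = facet_form P F x"
proof -
  obtain x where x: "\<forall>F\<in>facets P. (cmod (z F))\<^sup>2 = facet_form P F x" using assms(2) by (auto simp: level_set_def)
  then have "\<forall>F\<in>facets P. 0 \<le> facet_form P F x" by (metis zero_le_power2)
  then have "x \<in> P" using delzant_mem[OF assms(1)] by blast
  then show thesis using x that by blast
qed

lemma H_orbit_self: "z \<in> H_orbit P z"
  unfolding H_orbit_def by (intro CollectI exI[of _ "\<lambda>_. 0"]) simp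

lemma H_orbit_rotate: "normal_map P \<theta> \<in> int_lattice \<Longrightarrow> H_orbit P (rotate_by \<theta> z) = H_orbit P z"
proof -
  assume \<theta>: "normal_map P \<theta> \<in> int_lattice"
  have sub: "H_orbit P (rotate_by \<theta> z) \<subseteq> H_orbit P z" if "normal_map P \<theta> \<in> int_lattice" for \<theta> z
  proof
    fix x assume "x \<in> H_orbit P (rotate_by \<theta> z)"
    then obtain \<phi> where "normal_map P \<phi> \<in> int_lattice" "x = rotate_by (\<lambda>F. \<phi> F + \<theta> F) z" by (auto simp: H_orbit_def)
    then show "x \<in> H_orbit P z" using that unfolding H_orbit_def
      by (intro CollectI exI[of _ "\<lambda>F. \<phi> F + \<theta> F"]) (simp add: normal_map_add int_lattice_add)
  qed
  have "H_orbit P (rotate_by (\<lambda>F. - \<theta> F) (rotate_by \<theta> z)) \<subseteq> H_orbit P (rotate_by \<theta> z)"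
    by (rule sub) (simp add: normal_map_minus int_lattice_minus \<theta>)
  then show ?thesis using sub[OF \<theta>] by (simp add: subset_antisym)
qed

lemma H_orbit_eq: "w \<in> H_orbit P z \<Longrightarrow> H_orbit P w = H_orbit P z"
proof -
  assume "w \<in> H_orbit P z"
  then obtain \<theta> where "normal_map P \<theta> \<in> int_lattice" "w = rotate_by \<theta> z" unfolding H_orbit_def by blast
  then show ?thesis using H_orbit_rotate by simp
qed

lemma toric_manifold_eq_orbit: "X \<in> toric_manifold P \<Longrightarrow> z \<in> X \<Longrightarrow> X = H_orbit P z \<and> z \<in> level_set P"
proof -
  assume "X \<in> toric_manifold P" and z: "z \<in> X"
  then obtain w where w: "w \<in> level_set P" "X = H_orbit P w" by (auto simp: toric_manifold_def)
  then obtain \<theta> where "z = rotate_by \<theta> w" using z unfolding H_orbit_def by blast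
  then show ?thesis using w z H_orbit_eq[of z P w] rotate_by_level_set[of w P \<theta>] by simp
qed

text \<open>Freeness of the action of \<open>H\<close> in quantitative, infinitesimal form.
  Coordinates of \<open>z\<close> in the chart may vanish, but an element of the kernel is
  determined by its coordinates outside the chart, where the squared moduli are at least the
  constant of the chart cover.\<close>

lemma level_set_coercive:
  fixes P :: "(real ^ 'n) set"
  assumes D: "delzant P"
  obtains c where "c > 0" "\<forall>z\<in>level_set P. \<forall>\<xi>. normal_map P \<xi> = 0 \<longrightarrow>
     c * (\<Sum>F\<in>facets P. (\<xi> F)\<^sup>2) \<le> (\<Sum>F\<in>facets P. (cmod (z F))\<^sup>2 * (\<xi> F)\<^sup>2)"
proof -
  have fin: "finite (facets P)" using D by simp
  obtain c M where c: "c > 0" and M: "M \<ge> 1" and cov: "chart_cover P c M" using chart_cover_exists[OF D] .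
  define N where "N = real (card (facets P)) + 1"
  have N: "N > 0" by (simp add: N_def add_nonneg_pos)
  have "(c / (N\<^sup>2 * M\<^sup>2)) * (\<Sum>F\<in>facets P. (\<xi> F)\<^sup>2) \<le> (\<Sum>F\<in>facets P. (cmod (z F))\<^sup>2 * (\<xi> F)\<^sup>2)"
    if z: "z \<in> level_set P" and \<xi>: "normal_map P \<xi> = 0" for z \<xi>
  proof -
    obtain x where x: "x \<in> P" "\<forall>F\<in>facets P. (cmod (z F))\<^sup>2 = facet_form P F x" using level_set_point[OF D z] .
    obtain A u where ch: "chart P A u" and far: "\<forall>F\<in>facets P - A. c \<le> facet_form P F x"
      and uM: "\<forall>F\<in>facets P. \<forall>G\<in>A. \<bar>facet_normal P F \<bullet> u G\<bar> \<le> M" using cov x(1) unfolding chart_cover_def by blast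
    have A: "A \<subseteq> facets P" "finite A" using ch fin finite_subset by (auto simp: chart_def)
    define s where "s = (\<Sum>F\<in>facets P - A. \<bar>\<xi> F\<bar>)"
    have s0: "0 \<le> s" by (simp add: s_def sum_nonneg)
    have le: "\<bar>\<xi> G\<bar> \<le> M * s" if G: "G \<in> facets P" for G
    proof (cases "G \<in> A")
      case False
      then have "\<bar>\<xi> G\<bar> \<le> s" unfolding s_def using G fin by (intro member_le_sum) auto
      also have "\<dots> \<le> M * s" using mult_right_mono[OF M s0] by simp
      finally show ?thesis .
    next
      case True
      \<comment> \<open>Pairing the relation with \<open>u G\<close> isolates
        \<open>\<xi> G\<close>, since \<open>u\<close> is dual to the normals of the chart.\<close>
      have "0 = normal_map P \<xi> \<bullet> u G" using \<xi> by simp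
      also have "\<dots> = (\<Sum>F\<in>facets P. \<xi> F * (facet_normal P F \<bullet> u G))" by (simp add: normal_map_def inner_sum_left)
      also have "\<dots> = (\<Sum>F\<in>facets P - A. \<xi> F * (facet_normal P F \<bullet> u G)) + (\<Sum>F\<in>A. \<xi> F * (facet_normal P F \<bullet> u G))"
        by (rule sum.subset_diff) (use A fin in auto)
      also have "(\<Sum>F\<in>A. \<xi> F * (facet_normal P F \<bullet> u G)) = (\<Sum>F\<in>A. if F = G then \<xi> G else 0)"
        using ch True by (intro sum.cong) (auto simp: chart_def)
      also have "\<dots> = \<xi> G" using A True by simp
      finally have "\<bar>\<xi> G\<bar> = \<bar>\<Sum>F\<in>facets P - A. \<xi> F * (facet_normal P F \<bullet> u G)\<bar>" by linarith
      also have "\<dots> \<le> (\<Sum>F\<in>facets P - A. \<bar>\<xi> F * (facet_normal P F \<bullet> u G)\<bar>)" by (rule sum_abs)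
      also have "\<dots> \<le> (\<Sum>F\<in>facets P - A. M * \<bar>\<xi> F\<bar>)"
      proof (rule sum_mono)
        fix F assume "F \<in> facets P - A"
        then have "\<bar>facet_normal P F \<bullet> u G\<bar> \<le> M" using uM True by blast
        then have "\<bar>\<xi> F\<bar> * \<bar>facet_normal P F \<bullet> u G\<bar> \<le> \<bar>\<xi> F\<bar> * M" by (rule mult_left_mono) simp
        then show "\<bar>\<xi> F * (facet_normal P F \<bullet> u G)\<bar> \<le> M * \<bar>\<xi> F\<bar>" by (simp add: abs_mult mult.commute)
      qed
      also have "\<dots> = M * s" by (simp add: s_def sum_distrib_left)
      finally show ?thesis .
    qed
    have "s\<^sup>2 \<le> (\<Sum>F\<in>facets P - A. \<bar>\<xi> F\<bar>\<^sup>2) * card (facets P - A)" unfolding s_def by (rule sum_squared_le_sum_of_squares)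
    also have "\<dots> \<le> (\<Sum>F\<in>facets P - A. \<bar>\<xi> F\<bar>\<^sup>2) * N"
    proof (rule mult_left_mono)
      have "card (facets P - A) \<le> card (facets P)" by (rule card_mono) (use fin in auto)
      then show "real (card (facets P - A)) \<le> N" by (simp add: N_def)
    qed (simp add: sum_nonneg)
    finally have s2: "s\<^sup>2 \<le> (\<Sum>F\<in>facets P - A. (\<xi> F)\<^sup>2) * N" by simp
    have "(\<Sum>F\<in>facets P. (\<xi> F)\<^sup>2) \<le> (\<Sum>F\<in>facets P. (M * s)\<^sup>2)"
      by (rule sum_mono) (use le M s0 in \<open>auto simp: abs_le_square_iff[symmetric]\<close>)
    also have "\<dots> \<le> N * (M\<^sup>2 * s\<^sup>2)" by (simp add: N_def power_mult_distrib mult_right_mono)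
    also have "\<dots> \<le> N * (M\<^sup>2 * ((\<Sum>F\<in>facets P - A. (\<xi> F)\<^sup>2) * N))" using s2 N by (intro mult_left_mono) auto
    finally have 1: "(\<Sum>F\<in>facets P. (\<xi> F)\<^sup>2) \<le> N\<^sup>2 * M\<^sup>2 * (\<Sum>F\<in>facets P - A. (\<xi> F)\<^sup>2)"
      by (simp add: power2_eq_square mult_ac)
    have "c * (\<Sum>F\<in>facets P - A. (\<xi> F)\<^sup>2) \<le> (\<Sum>F\<in>facets P - A. (cmod (z F))\<^sup>2 * (\<xi> F)\<^sup>2)"
      unfolding sum_distrib_left using far x(2) by (intro sum_mono mult_right_mono) auto
    also have "\<dots> \<le> (\<Sum>F\<in>facets P. (cmod (z F))\<^sup>2 * (\<xi> F)\<^sup>2)" by (rule sum_mono2) (use fin in auto)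
    finally have 2: "c * (\<Sum>F\<in>facets P - A. (\<xi> F)\<^sup>2) \<le> (\<Sum>F\<in>facets P. (cmod (z F))\<^sup>2 * (\<xi> F)\<^sup>2)" .
    have "(c / (N\<^sup>2 * M\<^sup>2)) * (\<Sum>F\<in>facets P. (\<xi> F)\<^sup>2) \<le> (c / (N\<^sup>2 * M\<^sup>2)) * (N\<^sup>2 * M\<^sup>2 * (\<Sum>F\<in>facets P - A. (\<xi> F)\<^sup>2))"
      using 1 c by (intro mult_left_mono) auto
    also have "\<dots> = c * (\<Sum>F\<in>facets P - A. (\<xi> F)\<^sup>2)" using N M by simp
    finally show ?thesis using 2 by linarith
  qed
  moreover have "c / (N\<^sup>2 * M\<^sup>2) > 0" using c N M by simp
  ultimately show thesis using that by blast
qed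

section \<open>Least squares on a subspace with degenerate weights\<close>

lemma linear_term_zero:
  fixes p q :: real
  assumes "\<And>t. 0 \<le> t * p + t\<^sup>2 * q" "0 \<le> q"
  shows "p = 0"
proof (rule ccontr)
  assume "p \<noteq> 0"
  \<comment> \<open>The increment in \<open>q + 1\<close> keeps the test point defined for
    \<open>q = 0\<close>.\<close>
  define t where "t = - p / (q + 1)"
  have "t * p + t\<^sup>2 * q = - (p\<^sup>2 / (q + 1)\<^sup>2)"
    using assms(2) by (simp add: t_def power2_eq_square divide_simps) (simp add: algebra_simps)
  moreover have "p\<^sup>2 / (q + 1)\<^sup>2 > 0" using \<open>p \<noteq> 0\<close> assms(2) by simp
  ultimately show False using assms(1)[of t] by linarith
qed

lemma compact_box_functions:
  fixes S :: "'i \<Rightarrow> real set"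
  assumes "\<And>i. compact (S i)"
  shows "compact {\<xi>. \<forall>i. \<xi> i \<in> S i}"
proof -
  have "compactin (product_topology (\<lambda>i. euclidean) UNIV) (PiE UNIV S)"
    using assms by (simp add: compactin_PiE)
  moreover have "PiE UNIV S = {\<xi>. \<forall>i. \<xi> i \<in> S i}" by (auto simp: PiE_def)
  ultimately show ?thesis by (simp add: euclidean_product_topology)
qed

text \<open>The equations are the stationarity conditions of the quadratic functional
  \<open>J\<close> on the kernel. The weights \<open>a\<close> may vanish at some indices, so the
  existence of a minimum rests on coercivity along the kernel.\<close>

lemma weighted_projection:
  fixes \<nu> :: "'i \<Rightarrow> 'a::real_normed_vector" and a b :: "'i \<Rightarrow> real"
  assumes fin: "finite I" and c: "c > 0" and a: "\<And>i. i \<in> I \<Longrightarrow> 0 \<le> a i"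
    and coercive: "\<And>\<xi>. (\<Sum>i\<in>I. \<xi> i *\<^sub>R \<nu> i) = 0 \<Longrightarrow> c * (\<Sum>i\<in>I. (\<xi> i)\<^sup>2) \<le> (\<Sum>i\<in>I. a i * (\<xi> i)\<^sup>2)"
  obtains \<xi> where "(\<Sum>i\<in>I. \<xi> i *\<^sub>R \<nu> i) = 0" "\<forall>i. i \<notin> I \<longrightarrow> \<xi> i = 0"
    "\<forall>\<eta>. (\<Sum>i\<in>I. \<eta> i *\<^sub>R \<nu> i) = 0 \<longrightarrow> (\<Sum>i\<in>I. (a i * \<xi> i - b i) * \<eta> i) = 0"
proof -
  define J where "J \<xi> = (\<Sum>i\<in>I. a i * (\<xi> i)\<^sup>2 - 2 * b i * \<xi> i)" for \<xi>
  define \<beta> where "\<beta> = (\<Sum>i\<in>I. \<bar>b i\<bar>)"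
  \<comment> \<open>Once some coordinate exceeds \<open>R\<close>, the quadratic part outweighs the
    linear one and \<open>J\<close> is nonnegative. As \<open>J\<close> is 0 at the origin, it
    suffices to minimise over the box of radius \<open>R\<close>.\<close>
  define R where "R = 2 * \<beta> / c"
  have \<beta>: "\<beta> \<ge> 0" by (simp add: \<beta>_def sum_nonneg)
  have R: "R \<ge> 0" using \<beta> c by (simp add: R_def)
  define C where "C = {\<xi>. \<forall>i. \<xi> i \<in> (if i \<in> I then {-R..R} else {0})} \<inter> {\<xi>. (\<Sum>i\<in>I. \<xi> i *\<^sub>R \<nu> i) = 0}"
  have "closed {\<xi>. (\<Sum>i\<in>I. \<xi> i *\<^sub>R \<nu> i) = 0}"
    by (intro closed_Collect_eq continuous_intros) auto
  then have "compact C" unfolding C_def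
    by (intro compact_Int_closed compact_box_functions) auto
  moreover have "(\<lambda>_. 0) \<in> C" using R by (simp add: C_def)
  moreover have "continuous_on C J" unfolding J_def
    by (intro continuous_intros continuous_on_subset[OF continuous_on_product_coordinates]) auto
  ultimately obtain \<xi> where \<xi>: "\<xi> \<in> C" "\<forall>\<eta>\<in>C. J \<xi> \<le> J \<eta>"
    using continuous_attains_inf[of C J] by blast
  have K: "(\<Sum>i\<in>I. \<xi> i *\<^sub>R \<nu> i) = 0" and off: "\<forall>i. i \<notin> I \<longrightarrow> \<xi> i = 0"
  proof -
    have "\<xi> i \<in> (if i \<in> I then {-R..R} else {0})" for i using \<xi>(1) unfolding C_def by blast
    then show "\<forall>i. i \<notin> I \<longrightarrow> \<xi> i = 0" by (metis singletonD)
    show "(\<Sum>i\<in>I. \<xi> i *\<^sub>R \<nu> i) = 0" using \<xi>(1) unfolding C_def by blast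
  qed
  have min: "J \<xi> \<le> J \<eta>" if \<eta>: "(\<Sum>i\<in>I. \<eta> i *\<^sub>R \<nu> i) = 0" for \<eta>
  proof (cases "\<forall>i\<in>I. \<bar>\<eta> i\<bar> \<le> R")
    case True
    define \<eta>' where "\<eta>' i = (if i \<in> I then \<eta> i else 0)" for i
    have "\<eta>' \<in> C" using True \<eta> by (auto simp: C_def \<eta>'_def abs_le_iff)
    moreover have "J \<eta>' = J \<eta>" by (simp add: J_def \<eta>'_def)
    ultimately show ?thesis using \<xi>(2) by fastforce
  next
    case False
    then obtain j where j: "j \<in> I" "R < \<bar>\<eta> j\<bar>" by auto
    define m where "m = Max ((\<lambda>i. \<bar>\<eta> i\<bar>) ` I)"
    have mI: "\<bar>\<eta> i\<bar> \<le> m" if "i \<in> I" for i using fin that by (simp add: m_def)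
    have "m \<in> (\<lambda>i. \<bar>\<eta> i\<bar>) ` I" unfolding m_def by (rule Max_in) (use fin j in auto)
    then obtain k where k: "k \<in> I" "m = \<bar>\<eta> k\<bar>" by blast
    have "R < m" using mI[OF j(1)] j(2) by linarith
    then have "2 * \<beta> < c * m" using c by (simp add: R_def field_simps)
    have m0: "0 \<le> m" by (simp add: k)
    have "m\<^sup>2 \<le> (\<Sum>i\<in>I. (\<eta> i)\<^sup>2)" using member_le_sum[of k I "\<lambda>i. (\<eta> i)\<^sup>2"] fin k by simp
    then have "c * m\<^sup>2 \<le> (\<Sum>i\<in>I. a i * (\<eta> i)\<^sup>2)" using coercive[OF \<eta>] c by (meson mult_left_mono less_imp_le order_trans)
    moreover have "(\<Sum>i\<in>I. 2 * b i * \<eta> i) \<le> 2 * \<beta> * m"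
    proof -
      have "(\<Sum>i\<in>I. 2 * b i * \<eta> i) \<le> (\<Sum>i\<in>I. 2 * \<bar>b i\<bar> * m)"
      proof (rule sum_mono)
        fix i assume "i \<in> I"
        have "b i * \<eta> i \<le> \<bar>b i\<bar> * \<bar>\<eta> i\<bar>" by (metis abs_ge_self abs_mult)
        also have "\<dots> \<le> \<bar>b i\<bar> * m" using mI[OF \<open>i \<in> I\<close>] by (intro mult_left_mono) auto
        finally show "2 * b i * \<eta> i \<le> 2 * \<bar>b i\<bar> * m" by simp
      qed
      then show ?thesis by (simp add: \<beta>_def sum_distrib_left sum_distrib_right)
    qed
    moreover have "2 * \<beta> * m \<le> c * m * m" using \<open>2 * \<beta> < c * m\<close> m0 by (intro mult_right_mono) auto
    ultimately have "0 \<le> J \<eta>" unfolding J_def sum_subtractf by (simp add: power2_eq_square mult.assoc)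
    moreover have "J \<xi> \<le> J (\<lambda>_. 0)" using \<xi>(2) \<open>(\<lambda>_. 0) \<in> C\<close> by blast
    ultimately show ?thesis by (simp add: J_def)
  qed
  have "(\<Sum>i\<in>I. (a i * \<xi> i - b i) * \<eta> i) = 0" if \<eta>: "(\<Sum>i\<in>I. \<eta> i *\<^sub>R \<nu> i) = 0" for \<eta>
  proof -
    have "2 * (\<Sum>i\<in>I. (a i * \<xi> i - b i) * \<eta> i) = 0"
    proof (rule linear_term_zero)
      fix t
      have "(\<Sum>i\<in>I. (\<xi> i + t * \<eta> i) *\<^sub>R \<nu> i) = (\<Sum>i\<in>I. \<xi> i *\<^sub>R \<nu> i) + t *\<^sub>R (\<Sum>i\<in>I. \<eta> i *\<^sub>R \<nu> i)"
        by (simp add: scaleR_add_left sum.distrib scaleR_sum_right)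
      then have "J \<xi> \<le> J (\<lambda>i. \<xi> i + t * \<eta> i)" using K \<eta> by (intro min) simp
      moreover have "J (\<lambda>i. \<xi> i + t * \<eta> i) = J \<xi> + (t * (2 * (\<Sum>i\<in>I. (a i * \<xi> i - b i) * \<eta> i)) + t\<^sup>2 * (\<Sum>i\<in>I. a i * (\<eta> i)\<^sup>2))"
        unfolding J_def sum_distrib_left sum.distrib[symmetric]
        by (rule sum.cong) (auto simp: power2_eq_square algebra_simps)
      ultimately show "0 \<le> t * (2 * (\<Sum>i\<in>I. (a i * \<xi> i - b i) * \<eta> i)) + t\<^sup>2 * (\<Sum>i\<in>I. a i * (\<eta> i)\<^sup>2)" by simp
    qed (simp add: sum_nonneg a)
    then show ?thesis by simp
  qed
  then show thesis using that[of \<xi>] K off by blast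
qed

section \<open>Speed\<close>

text \<open>The infinitesimal action of the angular velocities \<open>\<xi>\<close> at
  \<open>z\<close>.\<close>

definition vert :: "'n cvec \<Rightarrow> ((real ^ 'n) set \<Rightarrow> real) \<Rightarrow> 'n cvec" where
  "vert z \<xi> = (\<lambda>F. 2 * of_real pi * \<i> * of_real (\<xi> F) * z F)"

lemma vertical_space_vert: "vertical_space P z = {vert z \<xi> | \<xi>. normal_map P \<xi> = 0}"
  by (simp add: vertical_space_def vert_def)

lemma vert_scaleR: "vert z \<xi> F = (2 * pi * \<xi> F) *\<^sub>R (\<i> * z F)"
  by (simp add: vert_def scaleR_conv_of_real mult_ac)

lemma flat_inner_diff_left: "flat_inner P (\<lambda>F. a F - b F) w = flat_inner P a w - flat_inner P b w"
  by (simp add: flat_inner_def inner_diff_left sum_subtractf diff_divide_distrib)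

lemma flat_inner_diff_right: "flat_inner P w (\<lambda>F. a F - b F) = flat_inner P w a - flat_inner P w b"
  by (simp add: flat_inner_def inner_diff_right sum_subtractf diff_divide_distrib)

text \<open>Turns orthogonality to the vertical space into the equations solved by
  \<open>weighted_projection\<close>, with weights \<open>(cmod (z F))\<^sup>2\<close>.\<close>

lemma flat_inner_vert:
  "flat_inner P (\<lambda>F. v F - vert z \<xi> F) (vert z \<eta>) =
    - 4 * pi * (\<Sum>F\<in>facets P. ((cmod (z F))\<^sup>2 * \<xi> F - ((\<i> * z F) \<bullet> v F) / (2 * pi)) * \<eta> F)"
proof -
  have *: "(\<i> * z F) \<bullet> (\<i> * z F) = (cmod (z F))\<^sup>2" for F
    by (simp add: dot_square_norm norm_mult)
  have "(v F - vert z \<xi> F) \<bullet> vert z \<eta> F =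
      - 4 * pi\<^sup>2 * (((cmod (z F))\<^sup>2 * \<xi> F - ((\<i> * z F) \<bullet> v F) / (2 * pi)) * \<eta> F)" for F
  proof -
    have alg: "2 * pi * h * q - (2 * pi * k) * (2 * pi * h) * a = - 4 * pi\<^sup>2 * ((a * k - q / (2 * pi)) * h)" for h k q a :: real
      by (simp add: field_simps power2_eq_square)
    have "(v F - vert z \<xi> F) \<bullet> vert z \<eta> F = 2 * pi * \<eta> F * ((\<i> * z F) \<bullet> v F) - (2 * pi * \<xi> F) * (2 * pi * \<eta> F) * ((\<i> * z F) \<bullet> (\<i> * z F))"
      unfolding vert_scaleR inner_diff_left inner_scaleR_left inner_scaleR_right inner_commute[of "v F"] by (simp add: algebra_simps)
    then show ?thesis unfolding * alg .
  qed
  then show ?thesis unfolding flat_inner_def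
    by (simp only: sum_distrib_left) (simp add: power2_eq_square mult_ac)
qed

text \<open>The angular velocities of the vertical part of \<open>v\<close>, characterized by the normal equations of the
  orthogonal projection.\<close>

definition vert_angle :: "(real ^ 'n) set \<Rightarrow> 'n cvec \<Rightarrow> 'n cvec \<Rightarrow> (real ^ 'n) set \<Rightarrow> real" where
  "vert_angle P z v = (SOME \<xi>. normal_map P \<xi> = 0 \<and> (\<forall>F. F \<notin> facets P \<longrightarrow> \<xi> F = 0) \<and>
     (\<forall>\<eta>. normal_map P \<eta> = 0 \<longrightarrow>
       (\<Sum>F\<in>facets P. ((cmod (z F))\<^sup>2 * \<xi> F - ((\<i> * z F) \<bullet> v F) / (2 * pi)) * \<eta> F) = 0))"

lemma vert_angle:
  fixes P :: "(real ^ 'n) set"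
  assumes D: "delzant P" and z: "z \<in> level_set P"
  shows "normal_map P (vert_angle P z v) = 0"
    "normal_map P \<eta> = 0 \<Longrightarrow>
       (\<Sum>F\<in>facets P. ((cmod (z F))\<^sup>2 * vert_angle P z v F - ((\<i> * z F) \<bullet> v F) / (2 * pi)) * \<eta> F) = 0"
proof -
  obtain c where c: "c > 0" "\<forall>z\<in>level_set P. \<forall>\<xi>. normal_map P \<xi> = 0 \<longrightarrow>
     c * (\<Sum>F\<in>facets P. (\<xi> F)\<^sup>2) \<le> (\<Sum>F\<in>facets P. (cmod (z F))\<^sup>2 * (\<xi> F)\<^sup>2)"
    using level_set_coercive[OF D] .
  obtain \<xi> where "(\<Sum>F\<in>facets P. \<xi> F *\<^sub>R facet_normal P F) = 0" "\<forall>F. F \<notin> facets P \<longrightarrow> \<xi> F = 0"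
    "\<forall>\<eta>. (\<Sum>F\<in>facets P. \<eta> F *\<^sub>R facet_normal P F) = 0 \<longrightarrow>
      (\<Sum>F\<in>facets P. ((cmod (z F))\<^sup>2 * \<xi> F - ((\<i> * z F) \<bullet> v F) / (2 * pi)) * \<eta> F) = 0"
    by (rule weighted_projection[of "facets P" c "\<lambda>F. (cmod (z F))\<^sup>2" "facet_normal P" "\<lambda>F. ((\<i> * z F) \<bullet> v F) / (2 * pi)"])
      (use D c z in \<open>auto simp: normal_map_def\<close>)
  then have "\<exists>\<xi>. normal_map P \<xi> = 0 \<and> (\<forall>F. F \<notin> facets P \<longrightarrow> \<xi> F = 0) \<and>
     (\<forall>\<eta>. normal_map P \<eta> = 0 \<longrightarrow>
       (\<Sum>F\<in>facets P. ((cmod (z F))\<^sup>2 * \<xi> F - ((\<i> * z F) \<bullet> v F) / (2 * pi)) * \<eta> F) = 0)"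
    unfolding normal_map_def by blast
  from someI_ex[OF this] show "normal_map P (vert_angle P z v) = 0"
    "normal_map P \<eta> = 0 \<Longrightarrow>
       (\<Sum>F\<in>facets P. ((cmod (z F))\<^sup>2 * vert_angle P z v F - ((\<i> * z F) \<bullet> v F) / (2 * pi)) * \<eta> F) = 0"
    unfolding vert_angle_def[symmetric] by blast+
qed

lemma vert_angle_cong:
  assumes "\<And>F. F \<in> facets P \<Longrightarrow> v F = w F"
  shows "vert_angle P z v = vert_angle P z w"
proof -
  have "(\<Sum>F\<in>facets P. ((cmod (z F))\<^sup>2 * \<xi> F - ((\<i> * z F) \<bullet> v F) / (2 * pi)) * \<eta> F) =
    (\<Sum>F\<in>facets P. ((cmod (z F))\<^sup>2 * \<xi> F - ((\<i> * z F) \<bullet> w F) / (2 * pi)) * \<eta> F)" for \<xi> \<eta>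
    using assms by (intro sum.cong) auto
  then show ?thesis unfolding vert_angle_def by simp
qed

text \<open>The defining conditions involve only moduli and inner products, which rotations
  preserve, so the choice operator is applied to the same predicate on both sides.\<close>

lemma vert_angle_rotate: "vert_angle P (rotate_by \<theta> z) (rotate_by \<theta> v) = vert_angle P z v"
proof -
  have "(\<i> * rotate_by \<theta> z F) \<bullet> rotate_by \<theta> v F = (\<i> * z F) \<bullet> v F" for F
    using inner_cis_mult[of "2 * pi * \<theta> F" "\<i> * z F" "v F"] by (simp add: rotate_by_cis mult_ac)
  then show ?thesis unfolding vert_angle_def by simp
qed

text \<open>Uniqueness for the definite description: two candidates differ by a vertical vector
  orthogonal to itself; it vanishes on the facets, and off them because \<open>z\<close>
  does.\<close>

lemma horizontal_part_eq:
  fixes P :: "(real ^ 'n) set"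
  assumes fin: "finite (facets P)" and z: "z \<in> level_set P" and \<xi>: "normal_map P \<xi> = 0"
    and orth: "\<And>\<eta>. normal_map P \<eta> = 0 \<Longrightarrow> flat_inner P (\<lambda>F. v F - vert z \<xi> F) (vert z \<eta>) = 0"
  shows "horizontal_part P z v = (\<lambda>F. v F - vert z \<xi> F)"
  unfolding horizontal_part_def
proof (rule the_equality)
  show "(\<lambda>F. v F - (v F - vert z \<xi> F)) \<in> vertical_space P z \<and>
    (\<forall>w\<in>vertical_space P z. flat_inner P (\<lambda>F. v F - vert z \<xi> F) w = 0)"
    using \<xi> orth by (auto simp: vertical_space_vert)
  fix h assume h: "(\<lambda>F. v F - h F) \<in> vertical_space P z \<and> (\<forall>w\<in>vertical_space P z. flat_inner P h w = 0)"
  then obtain \<zeta> where \<zeta>: "normal_map P \<zeta> = 0" "(\<lambda>F. v F - h F) = vert z \<zeta>"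
    unfolding vertical_space_vert by blast
  have hF: "h F = v F - vert z \<zeta> F" for F using fun_cong[OF \<zeta>(2), of F] by (simp add: algebra_simps)
  define \<eta> where "\<eta> = (\<lambda>F. \<xi> F - \<zeta> F)"
  have \<eta>: "normal_map P \<eta> = 0" using \<xi> \<zeta>(1) by (simp add: \<eta>_def normal_map_diff)
  have diff: "h F - (v F - vert z \<xi> F) = vert z \<eta> F" for F
    by (simp add: hF \<eta>_def vert_def algebra_simps)
  have "flat_inner P (vert z \<eta>) (vert z \<eta>) = flat_inner P (\<lambda>F. h F - (v F - vert z \<xi> F)) (vert z \<eta>)"
    by (simp only: diff)
  also have "\<dots> = flat_inner P h (vert z \<eta>) - flat_inner P (\<lambda>F. v F - vert z \<xi> F) (vert z \<eta>)"
    by (rule flat_inner_diff_left)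
  also have "\<dots> = 0" using h orth \<eta> by (auto simp: vertical_space_vert)
  finally have "cnorm P (vert z \<eta>) = 0" by (simp add: cnorm_def)
  then have "vert z \<eta> F = 0" if "F \<in> facets P" for F
    using cmod_le_cnorm[OF fin that, of "vert z \<eta>"] by simp
  moreover have "vert z \<eta> F = 0" if "F \<notin> facets P" for F
    using z that by (simp add: vert_def level_set_def)
  ultimately have "vert z \<eta> F = 0" for F by blast
  then show "h = (\<lambda>F. v F - vert z \<xi> F)" using diff by (intro ext) (metis eq_iff_diff_eq_0)
qed

definition speed :: "(real ^ 'n) set \<Rightarrow> 'n cvec \<Rightarrow> 'n cvec \<Rightarrow> real" where
  "speed P z v = sqrt (guillemin_metric P z v v)"

lemma speed_eq:
  assumes "delzant P" "z \<in> level_set P"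
  shows "speed P z v = cnorm P (\<lambda>F. v F - vert z (vert_angle P z v) F)"
proof -
  have "horizontal_part P z v = (\<lambda>F. v F - vert z (vert_angle P z v) F)"
    by (rule horizontal_part_eq) (use assms vert_angle[OF assms] in \<open>auto simp: flat_inner_vert\<close>)
  then show ?thesis by (simp add: speed_def guillemin_metric_def cnorm_def)
qed

lemma speed_nonneg [simp]: "0 \<le> speed P z v"
  by (simp add: speed_def guillemin_metric_def flat_inner_def sum_nonneg)

lemma speed_cong:
  assumes "delzant P" "z \<in> level_set P" "\<And>F. F \<in> facets P \<Longrightarrow> v F = w F"
  shows "speed P z v = speed P z w"
  using vert_angle_cong[of P v w z] assms by (simp add: speed_eq) (auto intro: cnorm_cong)

lemma speed_rotate:
  assumes "delzant P" "z \<in> level_set P"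
  shows "speed P (rotate_by \<theta> z) (rotate_by \<theta> v) = speed P z v"
proof -
  have "rotate_by \<theta> v F - vert (rotate_by \<theta> z) \<xi> F = rotate_by \<theta> (\<lambda>F. v F - vert z \<xi> F) F" for F \<xi>
    by (simp add: vert_def rotate_by_cis algebra_simps)
  then have "cnorm P (\<lambda>F. rotate_by \<theta> v F - vert (rotate_by \<theta> z) \<xi> F) = cnorm P (\<lambda>F. v F - vert z \<xi> F)" for \<xi>
    by (intro cnorm_cong) simp
  then show ?thesis using assms by (simp add: speed_eq rotate_by_level_set vert_angle_rotate)
qed

text \<open>Orthogonal projection does not increase the norm. Arcs can thus be estimated in the flat
  space without knowing their vertical parts.\<close>

lemma speed_le_cnorm:
  assumes "delzant P" "z \<in> level_set P"
  shows "speed P z v \<le> cnorm P v"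
proof -
  define h where "h = (\<lambda>F. v F - vert z (vert_angle P z v) F)"
  have 0: "flat_inner P h (vert z (vert_angle P z v)) = 0"
    unfolding h_def flat_inner_vert using vert_angle[OF assms] by simp
  have "(cnorm P h)\<^sup>2 = flat_inner P h v - flat_inner P h (vert z (vert_angle P z v))"
    unfolding cnorm_sq by (subst (2) h_def) (rule flat_inner_diff_right)
  also have "\<dots> \<le> cnorm P h * cnorm P v" using 0 flat_inner_Cauchy_Schwarz by simp
  finally have "cnorm P h * cnorm P h \<le> cnorm P h * cnorm P v" by (simp add: power2_eq_square)
  then have "cnorm P h \<le> cnorm P v"
    by (cases "cnorm P h = 0") (auto simp: mult_le_cancel_left order_less_le)
  then show ?thesis using assms by (simp add: speed_eq h_def)
qed

lemma cnorm_scale: "cnorm P (\<lambda>F. of_real c * v F) = \<bar>c\<bar> * cnorm P v"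
  unfolding cnorm_L2 using L2_set_right_distrib[of "\<bar>c\<bar>" "\<lambda>F. cmod (v F)" "facets P"] by (simp add: norm_mult)

lemma speed_scale:
  assumes D: "delzant P" and z: "z \<in> level_set P"
  shows "speed P z (\<lambda>F. of_real c * v F) = \<bar>c\<bar> * speed P z v"
proof -
  have eq: "of_real c * v F - vert z (\<lambda>F. c * vert_angle P z v F) F = of_real c * (v F - vert z (vert_angle P z v) F)" for F
    by (simp add: vert_def algebra_simps)
  have "horizontal_part P z (\<lambda>F. of_real c * v F) = (\<lambda>F. of_real c * v F - vert z (\<lambda>F. c * vert_angle P z v F) F)"
  proof (rule horizontal_part_eq)
    fix \<eta> assume \<eta>: "normal_map P \<eta> = 0"
    have "flat_inner P (\<lambda>F. v F - vert z (vert_angle P z v) F) (vert z \<eta>) = 0"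
      using vert_angle(2)[OF D z \<eta>] by (simp add: flat_inner_vert)
    then have "c * flat_inner P (\<lambda>F. v F - vert z (vert_angle P z v) F) (vert z \<eta>) = 0" by simp
    then show "flat_inner P (\<lambda>F. of_real c * v F - vert z (\<lambda>F. c * vert_angle P z v F) F) (vert z \<eta>) = 0"
      unfolding eq by (simp add: flat_inner_def sum_distrib_left mult_ac flip: scaleR_conv_of_real)
  qed (use D z vert_angle(1)[OF D z] in \<open>auto simp: normal_map_scale\<close>)
  then have "speed P z (\<lambda>F. of_real c * v F) = cnorm P (\<lambda>F. of_real c * (v F - vert z (vert_angle P z v) F))"
    by (simp add: speed_def guillemin_metric_def cnorm_def eq)
  then show ?thesis using D z by (simp add: cnorm_scale speed_eq)
qed

text \<open>Solutions of a uniformly coercive linear system depend continuously on its coefficients: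
  the difference of two solutions lies in the kernel and can be tested against itself. Continuity
  makes the speed integrable and the integrated angles differentiable.\<close>

lemma vert_angle_continuous:
  fixes P :: "(real ^ 'n) set" and \<gamma> V :: "'t::t2_space \<Rightarrow> 'n cvec"
  assumes D: "delzant P" and \<gamma>: "\<And>t. t \<in> S \<Longrightarrow> \<gamma> t \<in> level_set P"
    and c\<gamma>: "\<And>F. F \<in> facets P \<Longrightarrow> continuous_on S (\<lambda>t. \<gamma> t F)"
    and cV: "\<And>F. F \<in> facets P \<Longrightarrow> continuous_on S (\<lambda>t. V t F)" and G: "G \<in> facets P"
  shows "continuous_on S (\<lambda>t. vert_angle P (\<gamma> t) (V t) G)"
  unfolding continuous_on_def
proof
  fix t0 assume t0: "t0 \<in> S"
  have fin: "finite (facets P)" using D by simp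
  obtain c where c: "c > 0" and coerc: "\<forall>z\<in>level_set P. \<forall>\<xi>. normal_map P \<xi> = 0 \<longrightarrow>
     c * (\<Sum>F\<in>facets P. (\<xi> F)\<^sup>2) \<le> (\<Sum>F\<in>facets P. (cmod (z F))\<^sup>2 * (\<xi> F)\<^sup>2)"
    using level_set_coercive[OF D] .
  define \<xi> where "\<xi> t = vert_angle P (\<gamma> t) (V t)" for t
  define a where "a t F = (cmod (\<gamma> t F))\<^sup>2" for t F
  define b where "b t F = ((\<i> * \<gamma> t F) \<bullet> V t F) / (2 * pi)" for t F
  \<comment> \<open>Up to a term orthogonal to the kernel, the defect of the solution at
    \<open>t0\<close> in the equations at \<open>t\<close>.\<close>
  define e where "e t F = (b t F - b t0 F) - (a t F - a t0 F) * \<xi> t0 F" for t F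
  have bound: "\<bar>\<xi> t G - \<xi> t0 G\<bar> \<le> (\<Sum>F\<in>facets P. \<bar>e t F\<bar>) / c" if t: "t \<in> S" for t
  proof -
    define \<zeta> where "\<zeta> F = \<xi> t F - \<xi> t0 F" for F
    have n0: "normal_map P (\<xi> t) = 0" "normal_map P (\<xi> t0) = 0"
      using vert_angle(1)[OF D \<gamma>] t t0 by (auto simp: \<xi>_def)
    then have \<zeta>: "normal_map P \<zeta> = 0" unfolding \<zeta>_def by (simp add: normal_map_diff)
    have "(\<Sum>F\<in>facets P. (a t F * \<xi> t F - b t F) * \<zeta> F) = 0" "(\<Sum>F\<in>facets P. (a t0 F * \<xi> t0 F - b t0 F) * \<zeta> F) = 0"
      using vert_angle(2)[OF D \<gamma>[OF t] \<zeta>] vert_angle(2)[OF D \<gamma>[OF t0] \<zeta>] by (auto simp: \<xi>_def a_def b_def)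
    then have "(\<Sum>F\<in>facets P. (a t F * \<xi> t F - b t F) * \<zeta> F - (a t0 F * \<xi> t0 F - b t0 F) * \<zeta> F) = 0"
      by (simp add: sum_subtractf)
    moreover have "(\<Sum>F\<in>facets P. a t F * (\<zeta> F)\<^sup>2) = (\<Sum>F\<in>facets P. ((a t F * \<xi> t F - b t F) * \<zeta> F - (a t0 F * \<xi> t0 F - b t0 F) * \<zeta> F) + e t F * \<zeta> F)"
      by (rule sum.cong) (auto simp: e_def \<zeta>_def power2_eq_square algebra_simps)
    ultimately have "(\<Sum>F\<in>facets P. a t F * (\<zeta> F)\<^sup>2) = (\<Sum>F\<in>facets P. e t F * \<zeta> F)" by (simp add: sum.distrib)
    then have "c * (\<Sum>F\<in>facets P. (\<zeta> F)\<^sup>2) \<le> (\<Sum>F\<in>facets P. e t F * \<zeta> F)"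
      using coerc[rule_format, OF \<gamma>[OF t] \<zeta>] by (simp add: a_def)
    also have "\<dots> \<le> (\<Sum>F\<in>facets P. \<bar>e t F\<bar> * \<bar>\<zeta> F\<bar>)"
      by (rule sum_mono) (metis abs_ge_self abs_mult)
    also have "\<dots> \<le> L2_set (e t) (facets P) * L2_set \<zeta> (facets P)" by (rule L2_set_mult_ineq)
    finally have "c * (L2_set \<zeta> (facets P))\<^sup>2 \<le> L2_set (e t) (facets P) * L2_set \<zeta> (facets P)"
      by (simp add: L2_set_def sum_nonneg)
    then have "c * L2_set \<zeta> (facets P) * L2_set \<zeta> (facets P) \<le> L2_set (e t) (facets P) * L2_set \<zeta> (facets P)"
      by (simp add: power2_eq_square mult.assoc)
    then have "c * L2_set \<zeta> (facets P) \<le> L2_set (e t) (facets P)"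
      by (cases "L2_set \<zeta> (facets P) = 0") (auto simp: mult_le_cancel_right order_less_le)
    then have "L2_set \<zeta> (facets P) \<le> L2_set (e t) (facets P) / c" using c by (simp add: field_simps)
    moreover have "\<bar>\<zeta> G\<bar> \<le> L2_set \<zeta> (facets P)"
      using member_le_L2_set[OF fin G, of "\<lambda>F. \<bar>\<zeta> F\<bar>"] by (simp add: L2_set_def)
    moreover have "L2_set (e t) (facets P) / c \<le> (\<Sum>F\<in>facets P. \<bar>e t F\<bar>) / c"
      using L2_set_le_sum_abs c by (intro divide_right_mono) auto
    ultimately show ?thesis by (simp add: \<zeta>_def)
  qed
  have lim: "((\<lambda>t. \<gamma> t F) \<longlongrightarrow> \<gamma> t0 F) (at t0 within S)" "((\<lambda>t. V t F) \<longlongrightarrow> V t0 F) (at t0 within S)"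
    if "F \<in> facets P" for F using c\<gamma>[OF that] cV[OF that] t0 by (auto simp: continuous_on_def)
  have "((\<lambda>t. e t F) \<longlongrightarrow> 0) (at t0 within S)" if "F \<in> facets P" for F
  proof -
    have "((\<lambda>t. e t F) \<longlongrightarrow> (b t0 F - b t0 F) - (a t0 F - a t0 F) * \<xi> t0 F) (at t0 within S)"
      unfolding e_def b_def a_def by (intro tendsto_intros lim that) auto
    then show ?thesis by simp
  qed
  then have "((\<lambda>t. (\<Sum>F\<in>facets P. \<bar>e t F\<bar>) / c) \<longlongrightarrow> (\<Sum>F\<in>facets P. \<bar>0\<bar>) / c) (at t0 within S)"
    by (intro tendsto_intros) (use c in auto)
  then have "((\<lambda>t. (\<Sum>F\<in>facets P. \<bar>e t F\<bar>) / c) \<longlongrightarrow> 0) (at t0 within S)" by simp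
  moreover have "\<forall>\<^sub>F t in at t0 within S. norm (\<xi> t G - \<xi> t0 G) \<le> (\<Sum>F\<in>facets P. \<bar>e t F\<bar>) / c"
    using bound by (auto simp: eventually_at_filter)
  ultimately have "((\<lambda>t. \<xi> t G - \<xi> t0 G) \<longlongrightarrow> 0) (at t0 within S)" by (rule Lim_null_comparison[rotated])
  then show "((\<lambda>t. vert_angle P (\<gamma> t) (V t) G) \<longlongrightarrow> vert_angle P (\<gamma> t0) (V t0) G) (at t0 within S)"
    unfolding \<xi>_def by (rule LIM_zero_cancel)
qed

section \<open>Arcs and chains\<close>

definition arc_on :: "(real ^ 'n) set \<Rightarrow> real \<Rightarrow> real \<Rightarrow> (real \<Rightarrow> 'n cvec) \<Rightarrow> bool" where
  "arc_on P a b \<gamma> \<longleftrightarrow> (\<forall>F\<in>facets P. (\<lambda>t. \<gamma> t F) C1_differentiable_on {a..b}) \<and> (\<forall>t\<in>{a..b}. \<gamma> t \<in> level_set P)"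

definition arc_len :: "(real ^ 'n) set \<Rightarrow> real \<Rightarrow> real \<Rightarrow> (real \<Rightarrow> 'n cvec) \<Rightarrow> real" where
  "arc_len P a b \<gamma> = integral {a..b} (\<lambda>t. speed P (\<gamma> t) (velocity \<gamma> t))"

lemma arc_on_velocity:
  assumes "arc_on P a b \<gamma>" "F \<in> facets P"
  shows "t \<in> {a..b} \<Longrightarrow> ((\<lambda>t. \<gamma> t F) has_vector_derivative velocity \<gamma> t F) (at t)"
    "continuous_on {a..b} (\<lambda>t. velocity \<gamma> t F)" "continuous_on {a..b} (\<lambda>t. \<gamma> t F)"
proof -
  have C1: "(\<forall>t\<in>{a..b}. (\<lambda>t. \<gamma> t F) differentiable at t)" "continuous_on {a..b} (\<lambda>t. vector_derivative (\<lambda>t. \<gamma> t F) (at t))"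
    using assms by (auto simp: arc_on_def C1_differentiable_on_eq)
  then show *: "t \<in> {a..b} \<Longrightarrow> ((\<lambda>t. \<gamma> t F) has_vector_derivative velocity \<gamma> t F) (at t)" for t
    by (simp add: velocity_def flip: vector_derivative_works)
  show "continuous_on {a..b} (\<lambda>t. velocity \<gamma> t F)" using C1(2) by (simp add: velocity_def)
  show "continuous_on {a..b} (\<lambda>t. \<gamma> t F)"
    by (rule continuous_at_imp_continuous_on) (blast intro: has_vector_derivative_continuous[OF *])
qed

lemma arc_onI:
  assumes "\<And>F t. F \<in> facets P \<Longrightarrow> t \<in> {a..b} \<Longrightarrow> ((\<lambda>t. \<gamma> t F) has_vector_derivative V t F) (at t)"
    and "\<And>F. F \<in> facets P \<Longrightarrow> continuous_on {a..b} (\<lambda>t. V t F)"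
    and "\<And>t. t \<in> {a..b} \<Longrightarrow> \<gamma> t \<in> level_set P"
  shows "arc_on P a b \<gamma>" "\<And>F t. F \<in> facets P \<Longrightarrow> t \<in> {a..b} \<Longrightarrow> velocity \<gamma> t F = V t F"
proof -
  show "arc_on P a b \<gamma>" unfolding arc_on_def C1_differentiable_on_def
  proof (intro conjI ballI)
    fix F assume F: "F \<in> facets P"
    show "\<exists>D. (\<forall>x\<in>{a..b}. ((\<lambda>t. \<gamma> t F) has_vector_derivative D x) (at x)) \<and> continuous_on {a..b} D"
      by (rule exI[of _ "\<lambda>t. V t F"]) (use assms(1,2) F in auto)
  qed (rule assms(3))
  show "velocity \<gamma> t F = V t F" if "F \<in> facets P" "t \<in> {a..b}" for F t
    unfolding velocity_def using assms(1)[OF that] by (rule vector_derivative_at)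
qed

lemma arc_speed_continuous:
  fixes P :: "(real ^ 'n) set"
  assumes D: "delzant P" and \<gamma>: "arc_on P a b \<gamma>"
  shows "continuous_on {a..b} (\<lambda>t. speed P (\<gamma> t) (velocity \<gamma> t))"
proof -
  have L: "\<gamma> t \<in> level_set P" if "t \<in> {a..b}" for t using \<gamma> that by (simp add: arc_on_def)
  note c = arc_on_velocity[OF \<gamma>]
  have "continuous_on {a..b} (\<lambda>t. cnorm P (\<lambda>F. velocity \<gamma> t F - vert (\<gamma> t) (vert_angle P (\<gamma> t) (velocity \<gamma> t)) F))"
    unfolding cnorm_def flat_inner_def vert_def
    by (intro continuous_intros c vert_angle_continuous[OF D L]) auto
  then show ?thesis
    by (rule continuous_on_eq) (simp add: speed_eq[OF D L])
qed

lemma arc_len_nonneg: "0 \<le> arc_len P a b \<gamma>"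
  unfolding arc_len_def
  by (cases "(\<lambda>t. speed P (\<gamma> t) (velocity \<gamma> t)) integrable_on {a..b}")
    (auto intro: Henstock_Kurzweil_Integration.integral_nonneg simp: not_integrable_integral)

lemma arc_restrict: "arc_on P a b \<gamma> \<Longrightarrow> {c..d} \<subseteq> {a..b} \<Longrightarrow> arc_on P c d \<gamma>"
  unfolding arc_on_def by (meson C1_differentiable_on_subset subsetD)

lemma arc_affine:
  fixes P :: "(real ^ 'n) set"
  assumes D: "delzant P" and \<gamma>: "arc_on P a b \<gamma>" and sub: "\<And>t. t \<in> {p..q} \<Longrightarrow> m * t + k \<in> {a..b}"
  shows "arc_on P p q (\<lambda>t. \<gamma> (m * t + k))"
    "\<And>t. t \<in> {p..q} \<Longrightarrow> speed P (\<gamma> (m * t + k)) (velocity (\<lambda>t. \<gamma> (m * t + k)) t) = \<bar>m\<bar> * speed P (\<gamma> (m * t + k)) (velocity \<gamma> (m * t + k))"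
proof -
  have der: "((\<lambda>t. \<gamma> (m * t + k) F) has_vector_derivative of_real m * velocity \<gamma> (m * t + k) F) (at t)"
    if "F \<in> facets P" "t \<in> {p..q}" for F t
  proof -
    have "((\<lambda>t. m * t + k) has_vector_derivative m) (at t)"
      by (auto intro!: derivative_eq_intros simp: has_real_derivative_iff_has_vector_derivative[symmetric])
    from vector_diff_chain_at[OF this arc_on_velocity(1)[OF \<gamma> that(1) sub[OF that(2)]]]
    show ?thesis by (simp add: o_def scaleR_conv_of_real)
  qed
  have cont: "continuous_on {p..q} (\<lambda>t. of_real m * velocity \<gamma> (m * t + k) F)" if "F \<in> facets P" for F
    by (intro continuous_intros continuous_on_compose2[OF arc_on_velocity(2)[OF \<gamma> that]]) (use sub in auto)
  have L: "\<gamma> (m * t + k) \<in> level_set P" if "t \<in> {p..q}" for t using \<gamma> sub[OF that] by (simp add: arc_on_def)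
  note * = arc_onI[of P p q "\<lambda>t. \<gamma> (m * t + k)" "\<lambda>t F. of_real m * velocity \<gamma> (m * t + k) F", OF der cont L]
  show "arc_on P p q (\<lambda>t. \<gamma> (m * t + k))" by (rule *(1))
  show "speed P (\<gamma> (m * t + k)) (velocity (\<lambda>t. \<gamma> (m * t + k)) t) = \<bar>m\<bar> * speed P (\<gamma> (m * t + k)) (velocity \<gamma> (m * t + k))"
    if t: "t \<in> {p..q}" for t
  proof -
    have "speed P (\<gamma> (m * t + k)) (velocity (\<lambda>t. \<gamma> (m * t + k)) t)
        = speed P (\<gamma> (m * t + k)) (\<lambda>F. of_real m * velocity \<gamma> (m * t + k) F)"
      by (rule speed_cong[OF D L[OF t]]) (use *(2) t in blast)
    then show ?thesis using speed_scale[OF D L[OF t]] by simp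
  qed
qed

text \<open>Arcs may live on a degenerate interval \<open>a = b\<close>, while the pieces of a curve
  need \<open>p < q\<close>. The affine substitution, with slope 0 in the degenerate case, passes
  from the former to the latter.\<close>

lemma arc_reparam:
  fixes P :: "(real ^ 'n) set"
  assumes D: "delzant P" and \<gamma>: "arc_on P a b \<gamma>" and ab: "a \<le> b" and pq: "p < q"
  obtains \<delta> where "arc_on P p q \<delta>" "\<delta> p = \<gamma> a" "\<delta> q = \<gamma> b" "arc_len P p q \<delta> = arc_len P a b \<gamma>"
proof -
  define m where "m = (b - a) / (q - p)"
  define k where "k = a - m * p"
  have m: "0 \<le> m" using ab pq by (simp add: m_def)
  have mp: "m * p + k = a" by (simp add: k_def)
  have "m * (q - p) = b - a" using pq by (simp add: m_def)
  then have mq: "m * q + k = b" by (simp add: k_def algebra_simps)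
  have sub: "m * t + k \<in> {a..b}" if "t \<in> {p..q}" for t
  proof -
    have "m * p \<le> m * t" "m * t \<le> m * q" using that m by (auto intro: mult_left_mono)
    then show ?thesis using mp mq by auto
  qed
  note aff = arc_affine[OF D \<gamma> sub]
  have "((\<lambda>t. m *\<^sub>R speed P (\<gamma> (m * t + k)) (velocity \<gamma> (m * t + k))) has_integral
     integral {m * p + k..m * q + k} (\<lambda>t. speed P (\<gamma> t) (velocity \<gamma> t))) {p..q}"
    by (rule has_integral_substitution[where c = a and d = b])
      (use pq m mp mq ab sub arc_speed_continuous[OF D \<gamma>] in \<open>auto intro!: derivative_eq_intros\<close>)
  from integral_unique[OF this] have "integral {p..q} (\<lambda>t. m *\<^sub>R speed P (\<gamma> (m * t + k)) (velocity \<gamma> (m * t + k))) = arc_len P a b \<gamma>"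
    by (simp only: arc_len_def mp mq)
  moreover have "arc_len P p q (\<lambda>t. \<gamma> (m * t + k)) = integral {p..q} (\<lambda>t. m *\<^sub>R speed P (\<gamma> (m * t + k)) (velocity \<gamma> (m * t + k)))"
    unfolding arc_len_def by (rule integral_cong) (use aff(2) m in auto)
  ultimately show thesis using aff(1) mp mq by (intro that[of "\<lambda>t. \<gamma> (m * t + k)"]) auto
qed

lemma arc_reverse:
  fixes P :: "(real ^ 'n) set"
  assumes D: "delzant P" and \<gamma>: "arc_on P a b \<gamma>"
  shows "arc_on P (- b) (- a) (\<lambda>t. \<gamma> (- t))" "arc_len P (- b) (- a) (\<lambda>t. \<gamma> (- t)) = arc_len P a b \<gamma>"
proof -
  have sub: "(-1) * t + 0 \<in> {a..b}" if "t \<in> {- b..- a}" for t using that by auto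
  note aff = arc_affine[OF D \<gamma> sub]
  show "arc_on P (- b) (- a) (\<lambda>t. \<gamma> (- t))" using aff(1) by simp
  have "arc_len P (- b) (- a) (\<lambda>t. \<gamma> (- t)) = integral {- b..- a} (\<lambda>t. speed P (\<gamma> (- t)) (velocity \<gamma> (- t)))"
    unfolding arc_len_def by (rule integral_cong) (use aff(2) in auto)
  also have "\<dots> = arc_len P a b \<gamma>" unfolding arc_len_def
    by (rule Henstock_Kurzweil_Integration.integral_reflect_real)
  finally show "arc_len P (- b) (- a) (\<lambda>t. \<gamma> (- t)) = arc_len P a b \<gamma>" .
qed

lemma arc_rotate:
  fixes P :: "(real ^ 'n) set"
  assumes D: "delzant P" and \<gamma>: "arc_on P a b \<gamma>"
  shows "arc_on P a b (\<lambda>t. rotate_by \<theta> (\<gamma> t))" "arc_len P a b (\<lambda>t. rotate_by \<theta> (\<gamma> t)) = arc_len P a b \<gamma>"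
proof -
  have der: "((\<lambda>t. rotate_by \<theta> (\<gamma> t) F) has_vector_derivative rotate_by \<theta> (velocity \<gamma> t) F) (at t)"
    if "F \<in> facets P" "t \<in> {a..b}" for F t unfolding rotate_by_def
    by (rule has_vector_derivative_mult_right[OF arc_on_velocity(1)[OF \<gamma> that]])
  have cont: "continuous_on {a..b} (\<lambda>t. rotate_by \<theta> (velocity \<gamma> t) F)" if "F \<in> facets P" for F
    unfolding rotate_by_def by (intro continuous_intros arc_on_velocity(2)[OF \<gamma> that])
  have L0: "\<gamma> t \<in> level_set P" if "t \<in> {a..b}" for t using \<gamma> that by (simp add: arc_on_def)
  have L: "rotate_by \<theta> (\<gamma> t) \<in> level_set P" if "t \<in> {a..b}" for t using L0[OF that] by (rule rotate_by_level_set)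
  note * = arc_onI[of P a b "\<lambda>t. rotate_by \<theta> (\<gamma> t)" "\<lambda>t. rotate_by \<theta> (velocity \<gamma> t)", OF der cont L]
  show "arc_on P a b (\<lambda>t. rotate_by \<theta> (\<gamma> t))" by (rule *(1))
  show "arc_len P a b (\<lambda>t. rotate_by \<theta> (\<gamma> t)) = arc_len P a b \<gamma>"
    unfolding arc_len_def
  proof (rule integral_cong)
    fix t assume t: "t \<in> {a..b}"
    have "speed P (rotate_by \<theta> (\<gamma> t)) (velocity (\<lambda>t. rotate_by \<theta> (\<gamma> t)) t) = speed P (rotate_by \<theta> (\<gamma> t)) (rotate_by \<theta> (velocity \<gamma> t))"
      by (rule speed_cong[OF D L[OF t]]) (use *(2) t in blast)
    then show "speed P (rotate_by \<theta> (\<gamma> t)) (velocity (\<lambda>t. rotate_by \<theta> (\<gamma> t)) t) = speed P (\<gamma> t) (velocity \<gamma> t)"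
      using speed_rotate[OF D L0[OF t]] by simp
  qed
qed

lemma arc_split:
  fixes P :: "(real ^ 'n) set"
  assumes D: "delzant P" and \<gamma>: "arc_on P a b \<gamma>" and ab: "a \<le> b" and r: "0 \<le> r" "r \<le> arc_len P a b \<gamma>"
  obtains c where "a \<le> c" "c \<le> b" "arc_len P a c \<gamma> = r" "arc_len P c b \<gamma> = arc_len P a b \<gamma> - r"
proof -
  let ?f = "\<lambda>t. speed P (\<gamma> t) (velocity \<gamma> t)"
  have int: "?f integrable_on {a..b}" using arc_speed_continuous[OF D \<gamma>] by (rule integrable_continuous_real)
  have "continuous_on {a..b} (\<lambda>c. integral {a..c} ?f)" by (rule indefinite_integral_continuous_1[OF int])
  then obtain c where c: "a \<le> c" "c \<le> b" "integral {a..c} ?f = r"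
    using IVT'[of "\<lambda>c. integral {a..c} ?f" a r b] r ab by (auto simp: arc_len_def)
  have "integral {a..c} ?f + integral {c..b} ?f = integral {a..b} ?f"
    by (rule Henstock_Kurzweil_Integration.integral_combine[OF c(1,2) int])
  then show thesis using c by (intro that[of c]) (auto simp: arc_len_def)
qed

text \<open>Rotating by the integral of the angular velocities of the vertical part turns an arc into a
  horizontal one, whose length dominates the distance of its ends.\<close>

lemma arc_lift:
  fixes P :: "(real ^ 'n) set"
  assumes D: "delzant P" and \<gamma>: "arc_on P a b \<gamma>" and ab: "a \<le> b"
  obtains \<theta> where "normal_map P \<theta> = 0" "cnorm P (\<lambda>F. \<gamma> a F - rotate_by \<theta> (\<gamma> b) F) \<le> arc_len P a b \<gamma>"
proof -
  have L: "\<gamma> t \<in> level_set P" if "t \<in> {a..b}" for t using \<gamma> that by (simp add: arc_on_def)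
  note c = arc_on_velocity[OF \<gamma>]
  define \<xi> where "\<xi> t = vert_angle P (\<gamma> t) (velocity \<gamma> t)" for t
  have c\<xi>: "continuous_on {a..b} (\<lambda>t. \<xi> t F)" if "F \<in> facets P" for F
    unfolding \<xi>_def by (intro vert_angle_continuous[OF D L] c that)
  define \<Theta> where "\<Theta> t F = integral {a..t} (\<lambda>s. \<xi> s F)" for t F
  define \<eta> where "\<eta> t = rotate_by (\<lambda>F. - \<Theta> t F) (\<gamma> t)" for t
  define h where "h t F = velocity \<gamma> t F - vert (\<gamma> t) (\<xi> t) F" for t F
  \<comment> \<open>The angles come from integration starting at \<open>a\<close>, so derivatives
    are taken within the interval; \<open>\<eta>\<close> serves for the estimate and is not claimed
    to satisfy \<open>arc_on\<close>.\<close>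
  have d\<eta>: "((\<lambda>t. \<eta> t F) has_vector_derivative rotate_by (\<lambda>F. - \<Theta> t F) (h t) F) (at t within {a..b})"
    if F: "F \<in> facets P" and t: "t \<in> {a..b}" for F t
  proof -
    have "((\<lambda>t. \<Theta> t F) has_vector_derivative \<xi> t F) (at t within {a..b})"
      unfolding \<Theta>_def by (rule integral_has_vector_derivative[OF c\<xi>[OF F] t])
    then have "((\<lambda>t. - \<Theta> t F) has_vector_derivative - \<xi> t F) (at t within {a..b})"
      by (rule has_vector_derivative_minus)
    from bounded_linear.has_vector_derivative[OF bounded_linear_of_real this]
    have "((\<lambda>t. complex_of_real (- \<Theta> t F)) has_vector_derivative complex_of_real (- \<xi> t F)) (at t within {a..b})" .
    then have "((\<lambda>t. 2 * of_real pi * \<i> * complex_of_real (- \<Theta> t F)) has_vector_derivative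
        2 * of_real pi * \<i> * complex_of_real (- \<xi> t F)) (at t within {a..b})"
      by (rule has_vector_derivative_mult_right)
    from field_vector_diff_chain_within[OF this, of exp "exp (2 * of_real pi * \<i> * complex_of_real (- \<Theta> t F))"]
    have "((\<lambda>t. exp (2 * of_real pi * \<i> * complex_of_real (- \<Theta> t F))) has_vector_derivative
        2 * of_real pi * \<i> * complex_of_real (- \<xi> t F) * exp (2 * of_real pi * \<i> * complex_of_real (- \<Theta> t F))) (at t within {a..b})"
      by (simp add: o_def DERIV_exp has_field_derivative_at_within)
    from has_vector_derivative_mult[OF this has_vector_derivative_at_within[OF c(1)[OF F t]]]
    show ?thesis unfolding \<eta>_def rotate_by_def h_def vert_def
      by (rule has_vector_derivative_eq_rhs) (simp add: algebra_simps)
  qed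
  \<comment> \<open>Testing against the fixed vector that joins the ends reduces the estimate to the
    fundamental theorem for a real function and Cauchy-Schwarz.\<close>
  define w where "w F = \<eta> b F - \<eta> a F" for F
  define f where "f t = flat_inner P w (\<eta> t)" for t
  define f' where "f' t = flat_inner P w (rotate_by (\<lambda>F. - \<Theta> t F) (h t))" for t
  have "(f has_vector_derivative f' t) (at t within {a..b})" if t: "t \<in> {a..b}" for t
  proof -
    have "((\<lambda>t. (1 / pi) * (\<Sum>F\<in>facets P. w F \<bullet> \<eta> t F)) has_vector_derivative
      (1 / pi) * (\<Sum>F\<in>facets P. w F \<bullet> rotate_by (\<lambda>F. - \<Theta> t F) (h t) F)) (at t within {a..b})"
      by (intro has_vector_derivative_mult_right has_vector_derivative_sum
            bounded_linear.has_vector_derivative[OF bounded_linear_inner_right] d\<eta> t)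
    then show ?thesis unfolding f_def f'_def flat_inner_def .
  qed
  then have 1: "(f' has_integral f b - f a) {a..b}" by (rule fundamental_theorem_of_calculus[OF ab])
  have "((\<lambda>t. cnorm P w * speed P (\<gamma> t) (velocity \<gamma> t)) has_integral cnorm P w * arc_len P a b \<gamma>) {a..b}"
    unfolding arc_len_def
    by (intro has_integral_mult_right integrable_integral integrable_continuous_real arc_speed_continuous[OF D \<gamma>])
  then have "f b - f a \<le> cnorm P w * arc_len P a b \<gamma>"
  proof (rule has_integral_le[OF 1])
    fix t assume t: "t \<in> {a..b}"
    have "f' t \<le> cnorm P w * cnorm P (rotate_by (\<lambda>F. - \<Theta> t F) (h t))" unfolding f'_def by (rule flat_inner_Cauchy_Schwarz)
    also have "cnorm P (rotate_by (\<lambda>F. - \<Theta> t F) (h t)) = cnorm P (h t)" by (rule cnorm_cong) simp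
    also have "\<dots> = speed P (\<gamma> t) (velocity \<gamma> t)" using speed_eq[OF D L[OF t]] by (simp add: h_def[abs_def] \<xi>_def)
    finally show "f' t \<le> cnorm P w * speed P (\<gamma> t) (velocity \<gamma> t)" .
  qed
  moreover have "f b - f a = (cnorm P w)\<^sup>2"
  proof -
    have "f b - f a = flat_inner P w (\<lambda>F. \<eta> b F - \<eta> a F)" by (simp add: f_def flat_inner_diff_right)
    then show ?thesis by (simp add: cnorm_sq w_def[abs_def])
  qed
  ultimately have "cnorm P w * cnorm P w \<le> cnorm P w * arc_len P a b \<gamma>" by (simp add: power2_eq_square)
  then have "cnorm P w \<le> arc_len P a b \<gamma>"
    using arc_len_nonneg[of P a b \<gamma>] by (cases "cnorm P w = 0") (auto simp: mult_le_cancel_left order_less_le)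
  moreover have "\<eta> a = \<gamma> a" by (simp add: \<eta>_def \<Theta>_def)
  ultimately have "cnorm P (\<lambda>F. \<gamma> a F - rotate_by (\<lambda>F. - \<Theta> b F) (\<gamma> b) F) \<le> arc_len P a b \<gamma>"
    by (simp add: w_def[abs_def] \<eta>_def cnorm_minus_commute[of P "\<gamma> a"])
  \<comment> \<open>The angular velocities lie in the kernel of a linear map, hence so does their
    integral.\<close>
  moreover have "normal_map P (\<lambda>F. - \<Theta> b F) = 0"
  proof -
    have "((\<lambda>t. \<Sum>F\<in>facets P. \<xi> t F *\<^sub>R facet_normal P F) has_integral (\<Sum>F\<in>facets P. \<Theta> b F *\<^sub>R facet_normal P F)) {a..b}"
      unfolding \<Theta>_def using D
      by (intro has_integral_sum has_integral_scaleR_left integrable_integral integrable_continuous_real c\<xi>) auto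
    moreover have "((\<lambda>t. \<Sum>F\<in>facets P. \<xi> t F *\<^sub>R facet_normal P F) has_integral 0) {a..b}"
      by (rule has_integral_is_0) (use vert_angle(1)[OF D L] in \<open>simp add: normal_map_def \<xi>_def\<close>)
    ultimately have "normal_map P (\<Theta> b) = 0" unfolding normal_map_def by (rule has_integral_unique)
    then show ?thesis by (simp add: normal_map_minus)
  qed
  ultimately show thesis using that by blast
qed

text \<open>Curves in the quotient without their parametrization: successive arcs have to agree only
  as orbits. Degenerate intervals are allowed, which supplies chains of length 0.\<close>

inductive chain :: "(real ^ 'n) set \<Rightarrow> 'n cvec set \<Rightarrow> 'n cvec set \<Rightarrow> real \<Rightarrow> bool" for P where
  arc: "a \<le> b \<Longrightarrow> arc_on P a b \<gamma> \<Longrightarrow> chain P (H_orbit P (\<gamma> a)) (H_orbit P (\<gamma> b)) (arc_len P a b \<gamma>)"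
| step: "a \<le> b \<Longrightarrow> arc_on P a b \<gamma> \<Longrightarrow> chain P (H_orbit P (\<gamma> b)) Z L \<Longrightarrow>
    chain P (H_orbit P (\<gamma> a)) Z (arc_len P a b \<gamma> + L)"

lemma chain_nonneg: "chain P X Y L \<Longrightarrow> 0 \<le> L"
  by (induction rule: chain.induct) (auto simp: arc_len_nonneg intro: add_nonneg_nonneg)

lemma chain_trans: "chain P X Y L \<Longrightarrow> chain P Y Z M \<Longrightarrow> chain P X Z (L + M)"
  by (induction rule: chain.induct) (auto simp: add.assoc intro: chain.step)

lemma chain_manifold: "chain P X Y L \<Longrightarrow> X \<in> toric_manifold P \<and> Y \<in> toric_manifold P"
  by (induction rule: chain.induct) (auto simp: arc_on_def toric_manifold_def)

lemma chain_sym: "delzant P \<Longrightarrow> chain P X Y L \<Longrightarrow> chain P Y X L"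
proof (rotate_tac, induction rule: chain.induct)
  case (arc a b \<gamma>)
  show ?case using chain.arc[of "- b" "- a" P "\<lambda>t. \<gamma> (- t)"] arc arc_reverse[OF arc(3,2)] by simp
next
  case (step a b \<gamma> Z L)
  have "chain P (H_orbit P (\<gamma> b)) (H_orbit P (\<gamma> a)) (arc_len P a b \<gamma>)"
    using chain.arc[of "- b" "- a" P "\<lambda>t. \<gamma> (- t)"] step arc_reverse[OF step(5,2)] by simp
  then show ?case using chain_trans[OF step(4)[OF step(5)]] by (metis add.commute)
qed

lemma chain_refl:
  assumes "X \<in> toric_manifold P"
  shows "chain P X X 0"
proof -
  obtain z where z: "z \<in> level_set P" "X = H_orbit P z" using assms by (auto simp: toric_manifold_def)
  have "arc_on P 0 0 (\<lambda>t. z)" using z(1) by (simp add: arc_on_def)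
  from chain.arc[OF order_refl this] show ?thesis using z by (simp add: arc_len_def)
qed

lemma chain_split:
  assumes D: "delzant P"
  shows "chain P X Y L \<Longrightarrow> 0 \<le> r \<Longrightarrow> r \<le> L \<Longrightarrow> \<exists>Z. chain P X Z r \<and> chain P Z Y (L - r)"
proof (induction arbitrary: r rule: chain.induct)
  case (arc a b \<gamma>)
  obtain c where c: "a \<le> c" "c \<le> b" "arc_len P a c \<gamma> = r" "arc_len P c b \<gamma> = arc_len P a b \<gamma> - r"
    using arc_split[OF D arc(2,1,3,4)] .
  have "arc_on P a c \<gamma>" "arc_on P c b \<gamma>" using arc_restrict[OF arc(2)] c by auto
  then show ?case using chain.arc[of a c P \<gamma>] chain.arc[of c b P \<gamma>] c by metis
next
  case (step a b \<gamma> Z L)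
  show ?case
  proof (cases "r \<le> arc_len P a b \<gamma>")
    case True
    obtain c where c: "a \<le> c" "c \<le> b" "arc_len P a c \<gamma> = r" "arc_len P c b \<gamma> = arc_len P a b \<gamma> - r"
      using arc_split[OF D step(2,1,5) True] .
    have "arc_on P a c \<gamma>" "arc_on P c b \<gamma>" using arc_restrict[OF step(2)] c by auto
    then have "chain P (H_orbit P (\<gamma> a)) (H_orbit P (\<gamma> c)) r" "chain P (H_orbit P (\<gamma> c)) Z (arc_len P a b \<gamma> - r + L)"
      using chain.arc[of a c P \<gamma>] chain.step[of c b P \<gamma> Z L] c step(3) by auto
    then show ?thesis by (metis add_diff_eq add.commute diff_add_eq)
  next
    case False
    then obtain W where "chain P (H_orbit P (\<gamma> b)) W (r - arc_len P a b \<gamma>)" "chain P W Z (L - (r - arc_len P a b \<gamma>))"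
      using step.IH[of "r - arc_len P a b \<gamma>"] step.prems by auto
    then show ?thesis using chain.step[OF step(1,2), of W "r - arc_len P a b \<gamma>"] by (auto simp: algebra_simps)
  qed
qed

text \<open>Cutting by length rather than by parameter makes every piece short; \<open>Suc m\<close>
  rules out a division into no pieces.\<close>

lemma chain_divide:
  assumes D: "delzant P" and s: "0 \<le> s"
  shows "chain P X Y (real (Suc m) * s) \<Longrightarrow>
    \<exists>Xs. Xs 0 = X \<and> Xs (Suc m) = Y \<and> (\<forall>j\<le>m. chain P (Xs j) (Xs (Suc j)) s)"
proof (induction m arbitrary: X)
  case 0
  then show ?case by (intro exI[of _ "\<lambda>j. if j = 0 then X else Y"]) simp
next
  case (Suc m)
  have "s \<le> real (Suc (Suc m)) * s" using mult_right_mono[of 1 "real (Suc (Suc m))" s] s by simp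
  then obtain Z where Z: "chain P X Z s" "chain P Z Y (real (Suc (Suc m)) * s - s)"
    using chain_split[OF D Suc.prems s] by blast
  have "real (Suc (Suc m)) * s - s = real (Suc m) * s" by (simp add: algebra_simps)
  then obtain Xs where Xs: "Xs 0 = Z" "Xs (Suc m) = Y" "\<forall>j\<le>m. chain P (Xs j) (Xs (Suc j)) s"
    using Suc.IH Z(2) by metis
  show ?case
  proof (intro exI[of _ "\<lambda>j. case j of 0 \<Rightarrow> X | Suc i \<Rightarrow> Xs i"] conjI allI impI)
    fix j assume "j \<le> Suc m"
    then show "chain P (case j of 0 \<Rightarrow> X | Suc i \<Rightarrow> Xs i) (case Suc j of 0 \<Rightarrow> X | Suc i \<Rightarrow> Xs i) s"
      using Xs Z(1) by (cases j) auto
  qed (use Xs in auto)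
qed

text \<open>At a joint the next lift has to start at a prescribed point of the orbit; an element of
  \<open>H\<close> moves it there without changing the chordal distance of its ends. This is the
  lower bound for lengths, valid at every scale.\<close>

lemma chain_lift:
  assumes D: "delzant P"
  shows "chain P X Y L \<Longrightarrow> z \<in> X \<Longrightarrow> \<exists>w\<in>Y. cnorm P (\<lambda>F. z F - w F) \<le> L"
proof (induction arbitrary: z rule: chain.induct)
  have *: "\<exists>w\<in>H_orbit P (\<gamma> b). cnorm P (\<lambda>F. z F - w F) \<le> arc_len P a b \<gamma>"
    if ab: "a \<le> b" and \<gamma>: "arc_on P a b \<gamma>" and z: "z \<in> H_orbit P (\<gamma> a)" for a b \<gamma> z
  proof -
    obtain \<phi> where \<phi>: "normal_map P \<phi> \<in> int_lattice" "z = rotate_by \<phi> (\<gamma> a)" using z unfolding H_orbit_def by blast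
    obtain \<theta> where \<theta>: "normal_map P \<theta> = 0" "cnorm P (\<lambda>F. \<gamma> a F - rotate_by \<theta> (\<gamma> b) F) \<le> arc_len P a b \<gamma>"
      using arc_lift[OF D \<gamma> ab] .
    have "rotate_by (\<lambda>F. \<phi> F + \<theta> F) (\<gamma> b) \<in> H_orbit P (\<gamma> b)" unfolding H_orbit_def
      using \<phi> \<theta> by (intro CollectI exI[of _ "\<lambda>F. \<phi> F + \<theta> F"]) (simp add: normal_map_add)
    moreover have "cnorm P (\<lambda>F. z F - rotate_by (\<lambda>F. \<phi> F + \<theta> F) (\<gamma> b) F) = cnorm P (\<lambda>F. \<gamma> a F - rotate_by \<theta> (\<gamma> b) F)"
      using cnorm_rotate_diff[of P \<phi> "\<gamma> a" "rotate_by \<theta> (\<gamma> b)"] \<phi>(2) by simp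
    ultimately show ?thesis using \<theta>(2) by (intro bexI) auto
  qed
  {
    case (arc a b \<gamma>)
    then show ?case using * by blast
  next
    case (step a b \<gamma> Z L)
    obtain w where w: "w \<in> H_orbit P (\<gamma> b)" "cnorm P (\<lambda>F. z F - w F) \<le> arc_len P a b \<gamma>"
      using *[OF step(1,2,5)] by blast
    obtain y where y: "y \<in> Z" "cnorm P (\<lambda>F. w F - y F) \<le> L" using step.IH[OF w(1)] by blast
    then show ?case using cnorm_diff_triangle[of P z y w] w(2) by (intro bexI[of _ y]) auto
  }
qed

lemma rotate_H_orbit: "rotate_by \<theta> ` H_orbit P z = H_orbit P (rotate_by \<theta> z)"
proof -
  have *: "rotate_by \<theta> (rotate_by \<phi> z) = rotate_by \<phi> (rotate_by \<theta> z)" for \<phi> by (simp add: add.commute)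
  have "H_orbit P y = (\<lambda>\<phi>. rotate_by \<phi> y) ` {\<phi>. normal_map P \<phi> \<in> int_lattice}" for y
    by (auto simp: H_orbit_def)
  then show ?thesis by (simp only: image_image *)
qed

lemma chain_rotate:
  assumes D: "delzant P"
  shows "chain P X Y L \<Longrightarrow> chain P (rotate_by \<theta> ` X) (rotate_by \<theta> ` Y) L"
proof (induction rule: chain.induct)
  case (arc a b \<gamma>)
  show ?case using chain.arc[OF arc(1) arc_rotate(1)[OF D arc(2), of \<theta>]] arc_rotate(2)[OF D arc(2)]
    by (simp add: rotate_H_orbit)
next
  case (step a b \<gamma> Z L)
  show ?case using chain.step[OF step(1) arc_rotate(1)[OF D step(2), of \<theta>], of "rotate_by \<theta> ` Z" L] step.IH arc_rotate(2)[OF D step(2)]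
    by (simp add: rotate_H_orbit)
qed

section \<open>Local comparison with the chordal distance\<close>

text \<open>The correction \<open>t * (1 - t) * k\<close> vanishes at both ends, so the ends of the
  segment are kept. As the segment stays at modulus at least \<open>sqrt c / 2\<close>, the
  rescaling factor is near 1 and changes the velocity by at most a multiple of
  \<open>\<bar>k\<bar> / c\<close>.\<close>

lemma coordinate_arc:
  fixes z d :: complex and k c \<delta> :: real
  defines "u \<equiv> \<lambda>t::real. z + of_real t * d"
  assumes c: "0 < c" "c \<le> 1" and z: "c \<le> (cmod z)\<^sup>2" and d: "cmod d \<le> \<delta>" "\<delta> \<le> sqrt c / 2"
    and k: "\<bar>k\<bar> \<le> c / 2"
  obtains V where "continuous_on {0..1} V"
    "\<forall>t\<in>{0..1}. ((\<lambda>t. u t * of_real (sqrt (1 + t * (1 - t) * k / (cmod (u t))\<^sup>2))) has_vector_derivative V t) (at t)"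
    "\<forall>t\<in>{0..1}. cmod (V t - d) \<le> 4 * \<bar>k\<bar> / c"
    "\<forall>t\<in>{0..1}. (cmod (u t * of_real (sqrt (1 + t * (1 - t) * k / (cmod (u t))\<^sup>2))))\<^sup>2 = (cmod (u t))\<^sup>2 + t * (1 - t) * k"
proof -
  \<comment> \<open>The squared modulus of \<open>u t\<close> as a polynomial in \<open>t\<close>,
    to be differentiated as such.\<close>
  define s where "s t = z \<bullet> z + 2 * t * (z \<bullet> d) + t\<^sup>2 * (d \<bullet> d)" for t
  define s' where "s' t = 2 * (z \<bullet> d) + 2 * t * (d \<bullet> d)" for t
  have us: "u t = z + t *\<^sub>R d" for t by (simp add: u_def scaleR_conv_of_real)
  have s: "(cmod (u t))\<^sup>2 = s t" for t
    by (simp add: us s_def power2_norm_eq_inner inner_simps inner_commute[of d z]) (simp add: power2_eq_square algebra_simps)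
  have s'u: "s' t = 2 * (u t \<bullet> d)" for t by (simp add: us s'_def inner_simps)
  define sc where "sc = sqrt c"
  have sc: "0 < sc" "sc \<le> 1" "sc\<^sup>2 = c" "c \<le> sc"
  proof -
    show "0 < sc" "sc\<^sup>2 = c" using c by (auto simp: sc_def)
    show "sc \<le> 1" using c by (simp add: sc_def)
    then have "sc * sc \<le> sc * 1" using \<open>0 < sc\<close> by (intro mult_left_mono) auto
    then show "c \<le> sc" using \<open>sc\<^sup>2 = c\<close> by (simp add: power2_eq_square)
  qed
  have cz: "sc \<le> cmod z" using z c by (simp add: sc_def real_le_lsqrt real_sqrt_le_iff)
  have \<delta>0: "0 \<le> \<delta>" using d(1) norm_ge_zero order_trans by blast
  have ub: "sc / 2 \<le> cmod (u t)" if t: "t \<in> {0..1}" for t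
  proof -
    have "cmod (of_real t * d) \<le> 1 * \<delta>" unfolding norm_mult by (rule mult_mono) (use t d in auto)
    moreover have "cmod z \<le> cmod (u t) + cmod (of_real t * d)" using norm_triangle_ineq4[of "u t" "of_real t * d"] by (simp add: u_def)
    ultimately show ?thesis using cz d(2) by (simp add: sc_def)
  qed
  have sb: "c / 4 \<le> s t" if t: "t \<in> {0..1}" for t
  proof -
    have "(sc / 2)\<^sup>2 \<le> (cmod (u t))\<^sup>2" using ub[OF t] sc by (intro power_mono) auto
    then show ?thesis by (simp add: s power_divide sc)
  qed
  have tt: "0 \<le> t * (1 - t)" "t * (1 - t) \<le> 1/4" if t: "t \<in> {0..1}" for t :: real
  proof -
    show "0 \<le> t * (1 - t)" using t by simp
    have "0 \<le> (t - 1/2)\<^sup>2" by simp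
    then show "t * (1 - t) \<le> 1/4" by (simp add: power2_eq_square algebra_simps)
  qed
  define h where "h t = t * (1 - t) * k / s t" for t
  \<comment> \<open>The factor 1/4 bounding \<open>t * (1 - t)\<close> cancels the one in the lower
    bound \<open>c / 4\<close> for \<open>s\<close>.\<close>
  have hb: "\<bar>h t\<bar> \<le> \<bar>k\<bar> / c" if t: "t \<in> {0..1}" for t
  proof -
    have "\<bar>h t\<bar> = \<bar>t * (1 - t)\<bar> * \<bar>k\<bar> / \<bar>s t\<bar>" by (simp only: h_def abs_divide abs_mult[of "t * (1 - t)" k])
    also have "\<dots> = t * (1 - t) * \<bar>k\<bar> / s t" using tt(1)[OF t] sb[OF t] c by (simp only: abs_of_nonneg abs_of_pos)
    also have "\<dots> \<le> (1/4 * \<bar>k\<bar>) / (c / 4)" using tt[OF t] sb[OF t] c by (intro frac_le mult_right_mono) auto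
    finally show ?thesis by simp
  qed
  have h1: "\<bar>h t\<bar> \<le> 1 / 2" if t: "t \<in> {0..1}" for t
  proof -
    have "\<bar>k\<bar> / c \<le> 1 / 2" using k c by (simp add: divide_le_eq)
    then show ?thesis using hb[OF t] by linarith
  qed
  define h' where "h' t = ((1 - 2 * t) * k * s t - t * (1 - t) * k * s' t) / (s t)\<^sup>2" for t
  define g where "g t = sqrt (1 + h t)" for t
  define g' where "g' t = h' t / (2 * sqrt (1 + h t))" for t
  define V where "V t = d * of_real (g t) + u t * of_real (g' t)" for t
  have ds: "(s has_real_derivative s' t) (at t)" for t
    unfolding s_def s'_def by (auto intro!: derivative_eq_intros simp: power2_eq_square algebra_simps)
  have dh: "(h has_real_derivative h' t) (at t)" if t: "t \<in> {0..1}" for t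
    unfolding h_def h'_def using sb[OF t] c
    by (auto intro!: derivative_eq_intros ds simp: power2_eq_square algebra_simps)
  have dg: "(g has_real_derivative g' t) (at t)" if t: "t \<in> {0..1}" for t
  proof -
    have "0 < 1 + h t" using h1[OF t] by linarith
    then show ?thesis unfolding g_def g'_def
      by (auto intro!: derivative_eq_intros dh[OF t] simp: field_simps)
  qed
  have du: "(u has_vector_derivative d) (at t)" for t
    unfolding us by (auto intro!: derivative_eq_intros)
  have dV: "((\<lambda>t. u t * of_real (g t)) has_vector_derivative V t) (at t)" if t: "t \<in> {0..1}" for t
  proof -
    have "((\<lambda>t. of_real (g t)) has_vector_derivative complex_of_real (g' t)) (at t)"
      using bounded_linear.has_vector_derivative[OF bounded_linear_of_real] dg[OF t]
      by (simp add: has_real_derivative_iff_has_vector_derivative)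
    from has_vector_derivative_mult[OF du this] show ?thesis
      by (rule has_vector_derivative_eq_rhs) (simp add: V_def algebra_simps)
  qed
  have cs: "continuous_on {0..1} s" "continuous_on {0..1} s'" "continuous_on {0..1} u"
    unfolding s_def s'_def u_def by (intro continuous_intros)+
  have cV: "continuous_on {0..1} V"
  proof -
    have "s t \<noteq> 0" if "t \<in> {0..1}" for t using sb[OF that] c by linarith
    then have ch: "continuous_on {0..1} h" "continuous_on {0..1} h'"
      unfolding h_def h'_def by (intro continuous_intros cs; simp)+
    have "sqrt (1 + h t) \<noteq> 0" if "t \<in> {0..1}" for t using h1[OF that] by (auto simp: abs_le_iff)
    then show ?thesis unfolding V_def g_def g'_def by (intro continuous_intros cs ch) auto
  qed
  have bound: "cmod (V t - d) \<le> 4 * \<bar>k\<bar> / c" if t: "t \<in> {0..1}" for t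
  proof -
    have pos: "0 < cmod (u t)" using ub[OF t] sc by linarith
    have g1: "\<bar>g t - 1\<bar> \<le> \<bar>k\<bar> / c"
    proof -
      have g0: "0 \<le> g t" using h1[OF t] by (simp add: g_def abs_le_iff)
      have "(g t - 1) * (g t + 1) = h t" using h1[OF t] by (simp add: g_def algebra_simps abs_le_iff)
      then have "\<bar>g t - 1\<bar> * \<bar>g t + 1\<bar> = \<bar>h t\<bar>" by (metis abs_mult)
      moreover have "\<bar>g t - 1\<bar> * 1 \<le> \<bar>g t - 1\<bar> * \<bar>g t + 1\<bar>" using g0 by (intro mult_left_mono) auto
      ultimately show ?thesis using hb[OF t] by linarith
    qed
    have "1/2 \<le> sqrt (1 + h t)"
    proof -
      have "(1/2)\<^sup>2 \<le> 1 + h t" using h1[OF t] by (simp add: power2_eq_square abs_le_iff)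
      then show ?thesis by (rule real_le_rsqrt)
    qed
    then have "\<bar>g' t\<bar> \<le> \<bar>h' t\<bar>"
    proof -
      assume half: "1/2 \<le> sqrt (1 + h t)"
      have "0 < 2 * sqrt (1 + h t)" using half by linarith
      then have "\<bar>g' t\<bar> = \<bar>h' t\<bar> / (2 * sqrt (1 + h t))" by (simp only: g'_def abs_divide abs_of_pos)
      also have "\<dots> \<le> \<bar>h' t\<bar> / 1" using half h1[OF t] by (intro divide_left_mono) (auto simp: abs_le_iff)
      finally show ?thesis by simp
    qed
    then have "cmod (u t) * \<bar>g' t\<bar> \<le> cmod (u t) * \<bar>h' t\<bar>" by (intro mult_left_mono) auto
    also have "\<dots> \<le> 3 * \<bar>k\<bar> / c"
    proof -
      define a where "a = cmod (u t)"
      have a: "sc / 2 \<le> a" "0 < a" using ub[OF t] pos by (auto simp: a_def)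
      have st: "s t = a\<^sup>2" by (simp add: s[symmetric] a_def)
      have s't: "\<bar>s' t\<bar> \<le> 2 * a * \<delta>"
      proof -
        have "\<bar>u t \<bullet> d\<bar> \<le> cmod (u t) * cmod d" by (rule Cauchy_Schwarz_ineq2)
        also have "\<dots> \<le> a * \<delta>" using d(1) by (simp add: a_def mult_left_mono)
        finally show ?thesis by (simp add: s'u)
      qed
      have "\<bar>(1 - 2 * t) * k * s t - t * (1 - t) * k * s' t\<bar> \<le> \<bar>(1 - 2 * t) * k * s t\<bar> + \<bar>t * (1 - t) * k * s' t\<bar>"
        by (rule abs_triangle_ineq4)
      also have "\<dots> \<le> \<bar>k\<bar> * a\<^sup>2 + 1/4 * (\<bar>k\<bar> * (2 * a * \<delta>))"
      proof (rule add_mono)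
        have "\<bar>1 - 2 * t\<bar> \<le> 1" using t by auto
        then have "\<bar>1 - 2 * t\<bar> * (\<bar>k\<bar> * a\<^sup>2) \<le> 1 * (\<bar>k\<bar> * a\<^sup>2)" by (intro mult_right_mono) auto
        then show "\<bar>(1 - 2 * t) * k * s t\<bar> \<le> \<bar>k\<bar> * a\<^sup>2" by (simp add: abs_mult st mult.assoc)
        have "(t * (1 - t)) * (\<bar>k\<bar> * \<bar>s' t\<bar>) \<le> 1/4 * (\<bar>k\<bar> * (2 * a * \<delta>))"
          using tt[OF t] s't by (intro mult_mono) auto
        moreover have "\<bar>t * (1 - t) * k * s' t\<bar> = (t * (1 - t)) * (\<bar>k\<bar> * \<bar>s' t\<bar>)"
          by (simp only: mult.assoc[of "t * (1 - t)"] abs_mult[of "t * (1 - t)" "k * s' t"] abs_mult[of k "s' t"]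
              abs_of_nonneg[OF tt(1)[OF t]])
        ultimately show "\<bar>t * (1 - t) * k * s' t\<bar> \<le> 1/4 * (\<bar>k\<bar> * (2 * a * \<delta>))" by simp
      qed
      finally have "\<bar>h' t\<bar> \<le> (\<bar>k\<bar> * a\<^sup>2 + 1/4 * (\<bar>k\<bar> * (2 * a * \<delta>))) / (a\<^sup>2)\<^sup>2"
        unfolding h'_def abs_divide st using a by (simp add: divide_right_mono)
      then have "a * \<bar>h' t\<bar> \<le> a * ((\<bar>k\<bar> * a\<^sup>2 + 1/4 * (\<bar>k\<bar> * (2 * a * \<delta>))) / (a\<^sup>2)\<^sup>2)" using a by (intro mult_left_mono) auto
      also have "\<dots> = \<bar>k\<bar> * (1 / a + 1/2 * (\<delta> / a) * (1 / a))" using a by (simp add: field_simps power2_eq_square)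
      also have "\<dots> \<le> \<bar>k\<bar> * (2 / sc + 1/2 * 1 * (2 / sc))"
      proof (intro mult_left_mono add_mono mult_mono)
        have "1 / a \<le> 1 / (sc / 2)" using a sc by (intro divide_left_mono) auto
        then show "1 / a \<le> 2 / sc" "1 / a \<le> 2 / sc" by auto
        have "\<delta> \<le> a" using d(2) a(1) by (simp add: sc_def)
        then show "\<delta> / a \<le> 1" using a by simp
      qed (use a \<delta>0 sc in auto)
      also have "\<dots> = \<bar>k\<bar> * (3 / sc)" by simp
      also have "\<dots> \<le> \<bar>k\<bar> * (3 / c)" using sc c by (intro mult_left_mono divide_left_mono) auto
      finally show ?thesis by (simp add: a_def mult.commute)
    qed
    finally have 1: "cmod (u t) * \<bar>g' t\<bar> \<le> 3 * \<bar>k\<bar> / c" .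
    have "\<delta> \<le> 1" using d(2) sc(2) unfolding sc_def by linarith
    then have "cmod d * \<bar>g t - 1\<bar> \<le> 1 * (\<bar>k\<bar> / c)" using d(1) g1 by (intro mult_mono) auto
    moreover have "V t - d = d * of_real (g t - 1) + u t * of_real (g' t)" by (simp add: V_def algebra_simps)
    moreover have "cmod (d * of_real (g t - 1) + u t * of_real (g' t)) \<le> cmod d * \<bar>g t - 1\<bar> + cmod (u t) * \<bar>g' t\<bar>"
      using norm_triangle_ineq[of "d * of_real (g t - 1)" "u t * of_real (g' t)"] by (simp only: norm_mult norm_of_real)
    \<comment> \<open>One \<open>\<bar>k\<bar> / c\<close> stems from rescaling \<open>d\<close>,
      three from the derivative of the factor.\<close>
    ultimately have "cmod (V t - d) \<le> \<bar>k\<bar> / c + 3 * \<bar>k\<bar> / c" using 1 by simp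
    then show ?thesis by (simp add: field_simps)
  qed
  have val: "(cmod (u t * of_real (sqrt (1 + t * (1 - t) * k / (cmod (u t))\<^sup>2))))\<^sup>2 = (cmod (u t))\<^sup>2 + t * (1 - t) * k" if t: "t \<in> {0..1}" for t
  proof -
    have "0 \<le> 1 + h t" using h1[OF t] by (simp add: abs_le_iff)
    moreover have "s t \<noteq> 0" using sb[OF t] c by linarith
    ultimately show ?thesis by (simp add: s norm_mult power_mult_distrib h_def field_simps)
  qed
  show thesis
  proof (rule that[of V])
    show "\<forall>t\<in>{0..1}. ((\<lambda>t. u t * of_real (sqrt (1 + t * (1 - t) * k / (cmod (u t))\<^sup>2))) has_vector_derivative V t) (at t)"
      using dV by (simp add: g_def h_def s)
  qed (use cV bound val in auto)
qed

text \<open>The squared moduli along the segment from \<open>z\<close> to \<open>w\<close> are the facet forms of a curve in \<open>Q\<close> up to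
  the quadratic error \<open>t (1 - t) k\<close> below, which vanishes on the facets of the chart. Rescaling the
  other coordinates, which stay away from \<open>0\<close>, removes it.\<close>

lemma local_arc:
  fixes Q :: "(real ^ 'n) set"
  assumes D: "delzant Q" and ch: "chart Q A u" and c: "0 < c" "c \<le> 1" and M: "1 \<le> M"
    and z: "z \<in> level_set Q" and w: "w \<in> level_set Q"
    and far: "\<forall>F\<in>facets Q - A. c \<le> (cmod (z F))\<^sup>2"
    and uM: "\<forall>F\<in>facets Q. \<forall>G\<in>A. \<bar>facet_normal Q F \<bullet> u G\<bar> \<le> M"
  defines "\<delta> \<equiv> L2_set (\<lambda>F. cmod (w F - z F)) (facets Q)"
  assumes \<delta>: "\<delta> \<le> sqrt c / 2" "(1 + M) * \<delta>\<^sup>2 \<le> c / 2"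
  shows "\<exists>\<gamma>. arc_on Q 0 1 \<gamma> \<and> \<gamma> 0 = z \<and> \<gamma> 1 = w \<and>
    arc_len Q 0 1 \<gamma> \<le> (\<delta> + real (card (facets Q)) * (4 * (1 + M) * \<delta>\<^sup>2 / c)) / sqrt pi"
proof -
  have fin: "finite (facets Q)" using D by simp
  have A: "A \<subseteq> facets Q" "finite A" using ch fin finite_subset by (auto simp: chart_def)
  define d where "d F = w F - z F" for F
  have d\<delta>: "cmod (d F) \<le> \<delta>" if "F \<in> facets Q" for F
    unfolding \<delta>_def d_def using member_le_L2_set[OF fin that, of "\<lambda>F. cmod (w F - z F)"] by simp
  have \<delta>0: "0 \<le> \<delta>" by (simp add: \<delta>_def)
  have \<delta>2: "\<delta>\<^sup>2 = (\<Sum>F\<in>facets Q. (cmod (d F))\<^sup>2)" by (simp add: \<delta>_def d_def L2_set_def sum_nonneg)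
  \<comment> \<open>Along the segment the squared moduli fall short of linear interpolation by
    \<open>t * (1 - t) * (cmod (d F))\<^sup>2\<close>. Moving the base point along the vectors
    \<open>u G\<close> accounts for this on the chart; \<open>k F\<close> is what remains to be
    corrected on the other facets.\<close>
  define k where "k F = (cmod (d F))\<^sup>2 - (\<Sum>G\<in>A. (cmod (d G))\<^sup>2 * (facet_normal Q F \<bullet> u G))" for F
  have kA: "k F = 0" if "F \<in> A" for F
  proof -
    have "(\<Sum>G\<in>A. (cmod (d G))\<^sup>2 * (facet_normal Q F \<bullet> u G)) = (\<Sum>G\<in>A. if G = F then (cmod (d F))\<^sup>2 else 0)"
      using ch that by (intro sum.cong) (auto simp: chart_def)
    then show ?thesis using A that by (simp add: k_def)
  qed
  have kb: "\<bar>k F\<bar> \<le> (1 + M) * \<delta>\<^sup>2" if F: "F \<in> facets Q" for F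
  proof -
    have "\<bar>\<Sum>G\<in>A. (cmod (d G))\<^sup>2 * (facet_normal Q F \<bullet> u G)\<bar> \<le> (\<Sum>G\<in>A. (cmod (d G))\<^sup>2 * M)"
      by (rule order_trans[OF sum_abs], rule sum_mono) (use uM F in \<open>auto simp: abs_mult intro: mult_left_mono\<close>)
    also have "\<dots> = M * (\<Sum>G\<in>A. (cmod (d G))\<^sup>2)" by (simp add: sum_distrib_left mult.commute)
    also have "\<dots> \<le> M * \<delta>\<^sup>2" unfolding \<delta>2 using M A fin by (intro mult_left_mono sum_mono2) auto
    finally have "\<bar>\<Sum>G\<in>A. (cmod (d G))\<^sup>2 * (facet_normal Q F \<bullet> u G)\<bar> \<le> M * \<delta>\<^sup>2" .
    moreover have "(cmod (d F))\<^sup>2 \<le> \<delta>\<^sup>2" using d\<delta>[OF F] by (intro power_mono) auto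
    moreover have "0 \<le> (cmod (d F))\<^sup>2" "(1 + M) * \<delta>\<^sup>2 = \<delta>\<^sup>2 + M * \<delta>\<^sup>2" by (auto simp: distrib_right)
    ultimately show ?thesis unfolding k_def by linarith
  qed
  define U where "U F t = z F + of_real t * d F" for F t
  define \<gamma> where "\<gamma> t F = (if F \<in> A then U F t else U F t * of_real (sqrt (1 + t * (1 - t) * k F / (cmod (U F t))\<^sup>2)))" for t F
  define E where "E = 4 * (1 + M) * \<delta>\<^sup>2 / c"
  have E0: "0 \<le> E" using M c by (simp add: E_def)
  have "\<exists>V. continuous_on {0..1} V \<and> (\<forall>t\<in>{0..1}. ((\<lambda>t. \<gamma> t F) has_vector_derivative V t) (at t) \<and>
     cmod (V t - d F) \<le> E \<and> (cmod (\<gamma> t F))\<^sup>2 = (cmod (U F t))\<^sup>2 + t * (1 - t) * k F)" if F: "F \<in> facets Q" for F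
  proof (cases "F \<in> A")
    case True
    have "((\<lambda>t. z F + t *\<^sub>R d F) has_vector_derivative d F) (at t)" for t by (auto intro!: derivative_eq_intros)
    then show ?thesis using True kA[OF True] E0
      by (intro exI[of _ "\<lambda>t. d F"]) (simp add: \<gamma>_def U_def scaleR_conv_of_real)
  next
    case False
    have k2: "\<bar>k F\<bar> \<le> c / 2" using kb[OF F] \<delta>(2) by linarith
    have "c \<le> (cmod (z F))\<^sup>2" using far F False by blast
    then obtain V where V: "continuous_on {0..1} V"
      "\<forall>t\<in>{0..1}. ((\<lambda>t. U F t * of_real (sqrt (1 + t * (1 - t) * k F / (cmod (U F t))\<^sup>2))) has_vector_derivative V t) (at t)"
      "\<forall>t\<in>{0..1}. cmod (V t - d F) \<le> 4 * \<bar>k F\<bar> / c"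
      "\<forall>t\<in>{0..1}. (cmod (U F t * of_real (sqrt (1 + t * (1 - t) * k F / (cmod (U F t))\<^sup>2))))\<^sup>2 = (cmod (U F t))\<^sup>2 + t * (1 - t) * k F"
      using coordinate_arc[OF c _ d\<delta>[OF F] \<delta>(1) k2] unfolding U_def by blast
    have "4 * \<bar>k F\<bar> \<le> 4 * (1 + M) * \<delta>\<^sup>2" using mult_left_mono[OF kb[OF F] zero_le_numeral, of "num.Bit0 (num.Bit0 num.One)"] by (simp only: mult.assoc)
    then have "4 * \<bar>k F\<bar> / c \<le> E" unfolding E_def by (rule divide_right_mono) (use c in simp)
    then show ?thesis using V False by (intro exI[of _ V]) (auto simp: \<gamma>_def intro: order_trans)
  qed
  then obtain V where V: "\<And>F. F \<in> facets Q \<Longrightarrow> continuous_on {0..1} (V F) \<and> (\<forall>t\<in>{0..1}. ((\<lambda>t. \<gamma> t F) has_vector_derivative V F t) (at t) \<and>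
     cmod (V F t - d F) \<le> E \<and> (cmod (\<gamma> t F))\<^sup>2 = (cmod (U F t))\<^sup>2 + t * (1 - t) * k F)" by metis
  obtain x where x: "\<forall>F\<in>facets Q. (cmod (z F))\<^sup>2 = facet_form Q F x" using level_set_point[OF D z] .
  obtain y where y: "\<forall>F\<in>facets Q. (cmod (w F))\<^sup>2 = facet_form Q F y" using level_set_point[OF D w] .
  have off: "z F = 0" "w F = 0" if "F \<notin> facets Q" for F using z w that by (auto simp: level_set_def)
  have L: "\<gamma> t \<in> level_set Q" if t: "t \<in> {0..1}" for t
  proof -
    \<comment> \<open>The base point of \<open>\<gamma> t\<close>: linear interpolation, displaced
      so as to absorb the shortfall on the chart.\<close>
    define p where "p = ((1 - t) *\<^sub>R x + t *\<^sub>R y) - (t * (1 - t)) *\<^sub>R (\<Sum>G\<in>A. (cmod (d G))\<^sup>2 *\<^sub>R u G)"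
    have "(cmod (\<gamma> t F))\<^sup>2 = facet_form Q F p" if F: "F \<in> facets Q" for F
    proof -
      have e1: "(cmod (U F t))\<^sup>2 = (1 - t) * (cmod (z F))\<^sup>2 + t * (cmod (w F))\<^sup>2 - t * (1 - t) * (cmod (d F))\<^sup>2"
        unfolding U_def d_def cmod_power2 by (simp add: power2_eq_square algebra_simps)
      have e2: "facet_form Q F p = facet_form Q F ((1 - t) *\<^sub>R x + t *\<^sub>R y)
          - t * (1 - t) * (\<Sum>G\<in>A. (cmod (d G))\<^sup>2 * (facet_normal Q F \<bullet> u G))"
        unfolding facet_form_def p_def inner_diff_left
        by (simp add: inner_sum_left inner_commute[of "u _"])
      have e3: "(cmod (\<gamma> t F))\<^sup>2 = (cmod (U F t))\<^sup>2 + t * (1 - t) * k F" using V[OF F] t by blast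
      have e4: "(cmod (z F))\<^sup>2 = facet_form Q F x" "(cmod (w F))\<^sup>2 = facet_form Q F y" using x y F by blast+
      show ?thesis unfolding e3 e1 e2 e4 facet_form_affine k_def by (simp add: algebra_simps)
    qed
    moreover have "\<gamma> t F = 0" if "F \<notin> facets Q" for F using off[OF that] by (simp add: \<gamma>_def U_def d_def)
    ultimately show ?thesis by (auto simp: level_set_def)
  qed
  have arc: "arc_on Q 0 1 \<gamma>" and vel: "\<And>F t. F \<in> facets Q \<Longrightarrow> t \<in> {0..1} \<Longrightarrow> velocity \<gamma> t F = V F t"
    using arc_onI[of Q 0 1 \<gamma> "\<lambda>t F. V F t"] V L by blast+
  have "speed Q (\<gamma> t) (velocity \<gamma> t) \<le> (\<delta> + real (card (facets Q)) * E) / sqrt pi" if t: "t \<in> {0..1}" for t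
  proof -
    have "L2_set (\<lambda>F. cmod (velocity \<gamma> t F)) (facets Q) \<le> L2_set (\<lambda>F. cmod (d F) + E) (facets Q)"
    proof (rule L2_set_mono)
      fix F assume F: "F \<in> facets Q"
      have "cmod (V F t) \<le> cmod (d F) + cmod (V F t - d F)" by (metis add.commute norm_triangle_sub)
      also have "\<dots> \<le> cmod (d F) + E" using V[OF F] t by simp
      finally show "cmod (velocity \<gamma> t F) \<le> cmod (d F) + E" by (simp add: vel[OF F t])
    qed simp
    also have "\<dots> \<le> \<delta> + L2_set (\<lambda>F. E) (facets Q)" unfolding \<delta>_def d_def by (rule L2_set_triangle_ineq)
    also have "L2_set (\<lambda>F. E) (facets Q) \<le> real (card (facets Q)) * E"
      using L2_set_le_sum[of "facets Q" "\<lambda>F. E"] E0 by simp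
    finally have "cnorm Q (velocity \<gamma> t) \<le> (\<delta> + real (card (facets Q)) * E) / sqrt pi"
      by (simp add: cnorm_L2 divide_right_mono)
    then show ?thesis using speed_le_cnorm[OF D L[OF t], of "velocity \<gamma> t"] by linarith
  qed
  then have "integral {0..1} (\<lambda>t. speed Q (\<gamma> t) (velocity \<gamma> t)) \<le> integral {0..1::real} (\<lambda>t. (\<delta> + real (card (facets Q)) * E) / sqrt pi)"
    by (intro integral_le integrable_continuous_real arc_speed_continuous[OF D arc] continuous_intros) auto
  then have "arc_len Q 0 1 \<gamma> \<le> (\<delta> + real (card (facets Q)) * E) / sqrt pi" by (simp add: arc_len_def)
  moreover have "\<gamma> 0 = z" "\<gamma> 1 = w" by (auto simp: \<gamma>_def U_def d_def)
  ultimately show ?thesis using arc unfolding E_def by blast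
qed

text \<open>Only this inequality between distance and chord is restricted to a scale
  \<open>r\<close>; the opposite one is \<open>chain_lift\<close>.\<close>

definition loc_comparable :: "(real ^ 'n) set \<Rightarrow> real \<Rightarrow> real \<Rightarrow> bool" where
  "loc_comparable P \<epsilon> r \<longleftrightarrow> (\<forall>z\<in>level_set P. \<forall>w\<in>level_set P. cnorm P (\<lambda>F. z F - w F) \<le> r \<longrightarrow>
     (\<exists>L \<le> (1 + \<epsilon>) * cnorm P (\<lambda>F. z F - w F). chain P (H_orbit P z) (H_orbit P w) L))"

text \<open>The arc of \<open>local_arc\<close> exceeds the chord by a quadratic term only, so it is
  absorbed into the factor \<open>1 + \<epsilon>\<close> at small scale. The scale is fixed before
  the polytope, so one \<open>r\<close> serves all polytopes with the same constants.\<close>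

lemma loc_comparable_if_chart_cover:
  assumes c: "0 < c" and M: "1 \<le> M" and \<epsilon>: "0 < \<epsilon>"
  shows "\<exists>r>0. \<forall>Q :: (real ^ 'n) set. delzant Q \<longrightarrow> card (facets Q) = N \<longrightarrow> chart_cover Q c M \<longrightarrow> loc_comparable Q \<epsilon> r"
proof -
  define c1 where "c1 = min c 1"
  have c1: "0 < c1" "c1 \<le> 1" "c1 \<le> c" using c by (auto simp: c1_def)
  \<comment> \<open>The first two entries give the smallness conditions of \<open>local_arc\<close>;
    the third makes the quadratic error at most \<open>\<epsilon>\<close> times the
    distance.\<close>
  define \<delta>0 where "\<delta>0 = Min {sqrt c1 / 2, c1 / (2 * (1 + M)), \<epsilon> * c1 / (4 * (real N + 1) * (1 + M))}"
  have "0 < \<delta>0" using c1 M \<epsilon> by (simp add: \<delta>0_def)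
  have \<delta>0: "\<delta>0 \<le> sqrt c1 / 2" "\<delta>0 \<le> c1 / (2 * (1 + M))" "\<delta>0 \<le> \<epsilon> * c1 / (4 * (real N + 1) * (1 + M))"
    unfolding \<delta>0_def by (rule Min_le; simp)+
  have \<delta>01: "\<delta>0 \<le> 1"
  proof -
    have "sqrt c1 \<le> 1" using c1 by simp
    then show ?thesis using \<delta>0(1) by linarith
  qed
  show ?thesis
  proof (intro exI[of _ "\<delta>0 / sqrt pi"] conjI allI impI)
    show "0 < \<delta>0 / sqrt pi" using \<open>0 < \<delta>0\<close> by simp
    fix Q :: "(real ^ 'n) set" assume D: "delzant Q" and N: "card (facets Q) = N" and cov: "chart_cover Q c M"
    show "loc_comparable Q \<epsilon> (\<delta>0 / sqrt pi)" unfolding loc_comparable_def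
    proof (intro ballI impI)
      fix z w assume z: "z \<in> level_set Q" and w: "w \<in> level_set Q" and near: "cnorm Q (\<lambda>F. z F - w F) \<le> \<delta>0 / sqrt pi"
      define \<delta> where "\<delta> = L2_set (\<lambda>F. cmod (w F - z F)) (facets Q)"
      have cn: "cnorm Q (\<lambda>F. z F - w F) = \<delta> / sqrt pi" unfolding cnorm_L2 \<delta>_def by (simp add: norm_minus_commute)
      have \<delta>: "0 \<le> \<delta>" "\<delta> \<le> \<delta>0" using near by (auto simp: \<delta>_def cn[unfolded \<delta>_def] divide_le_cancel)
      have 1: "\<delta> \<le> sqrt c1 / 2" using \<delta> \<delta>0 by linarith
      have 2: "(1 + M) * \<delta>\<^sup>2 \<le> c1 / 2"
      proof -
        have "(1 + M) * \<delta>0 \<le> (1 + M) * (c1 / (2 * (1 + M)))" using \<delta>0(2) M by (intro mult_left_mono) auto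
        moreover have "(1 + M) * (c1 / (2 * (1 + M))) = c1 / 2" using M by (simp add: field_simps)
        ultimately have "(1 + M) * \<delta>0 \<le> c1 / 2" by (simp only:)
        moreover have "\<delta> * \<delta> \<le> \<delta>0 * 1" using \<delta> \<delta>01 by (intro mult_mono) auto
        then have "(1 + M) * \<delta>\<^sup>2 \<le> (1 + M) * \<delta>0" using M by (intro mult_left_mono) (auto simp: power2_eq_square)
        ultimately show ?thesis by linarith
      qed
      obtain x where x: "x \<in> Q" "\<forall>F\<in>facets Q. (cmod (z F))\<^sup>2 = facet_form Q F x" using level_set_point[OF D z] .
      obtain A u where ch: "chart Q A u" and far: "\<forall>F\<in>facets Q - A. c \<le> facet_form Q F x"
        and uM: "\<forall>F\<in>facets Q. \<forall>G\<in>A. \<bar>facet_normal Q F \<bullet> u G\<bar> \<le> M" using cov x(1) unfolding chart_cover_def by blast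
      have far': "\<forall>F\<in>facets Q - A. c1 \<le> (cmod (z F))\<^sup>2"
      proof
        fix F assume F: "F \<in> facets Q - A"
        have "c \<le> facet_form Q F x" using far F by blast
        moreover have "(cmod (z F))\<^sup>2 = facet_form Q F x" using x(2) F by blast
        ultimately show "c1 \<le> (cmod (z F))\<^sup>2" using c1(3) by linarith
      qed
      obtain \<gamma> where \<gamma>: "arc_on Q 0 1 \<gamma>" "\<gamma> 0 = z" "\<gamma> 1 = w"
        "arc_len Q 0 1 \<gamma> \<le> (\<delta> + real N * (4 * (1 + M) * \<delta>\<^sup>2 / c1)) / sqrt pi"
        using local_arc[OF D ch c1(1,2) M z w far' uM] 1 2 unfolding \<delta>_def N by blast
      have "real N * (4 * (1 + M) * \<delta>\<^sup>2 / c1) \<le> \<epsilon> * \<delta>"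
      proof -
        have "\<delta> \<le> \<epsilon> * c1 / (4 * (real N + 1) * (1 + M))" using \<delta> \<delta>0 by linarith
        then have "\<delta> * (4 * (real N + 1) * (1 + M)) \<le> \<epsilon> * c1" using M by (simp add: pos_le_divide_eq)
        moreover have "\<delta> * (4 * real N * (1 + M)) \<le> \<delta> * (4 * (real N + 1) * (1 + M))"
          using \<delta> M by (intro mult_left_mono mult_right_mono) auto
        ultimately have "\<delta> * (\<delta> * (4 * real N * (1 + M))) \<le> \<delta> * (\<epsilon> * c1)" using \<delta> by (intro mult_left_mono) auto
        then show ?thesis using c1 by (simp add: divide_le_eq power2_eq_square mult_ac)
      qed
      then have "arc_len Q 0 1 \<gamma> \<le> (\<delta> + \<epsilon> * \<delta>) / sqrt pi"
        using \<gamma>(4) by (meson add_left_mono divide_right_mono order_trans pi_ge_zero real_sqrt_ge_zero)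
      then have "arc_len Q 0 1 \<gamma> \<le> (1 + \<epsilon>) * cnorm Q (\<lambda>F. z F - w F)" by (simp add: cn algebra_simps)
      then show "\<exists>L \<le> (1 + \<epsilon>) * cnorm Q (\<lambda>F. z F - w F). chain Q (H_orbit Q z) (H_orbit Q w) L"
        using chain.arc[OF _ \<gamma>(1)] \<gamma>(2,3) by (metis zero_le_one)
    qed
  qed
qed

section \<open>The quotient as a compact metric space\<close>

lemma C1_lift_arc: "C1_lift P c a b \<gamma> \<longleftrightarrow> arc_on P a b \<gamma> \<and> (\<forall>t\<in>{a..b}. c t = H_orbit P (\<gamma> t))"
  by (auto simp: C1_lift_def arc_on_def)

lemma curve_has_length_arcs:
  "curve_has_length P c L \<longleftrightarrow>
     (\<exists>(m::nat) (p::nat \<Rightarrow> real) \<gamma>. p 0 = 0 \<and> p m = 1 \<and>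
        (\<forall>k<m. p k < p (Suc k) \<and> C1_lift P c (p k) (p (Suc k)) (\<gamma> k)) \<and>
        L = (\<Sum>k<m. arc_len P (p k) (p (Suc k)) (\<gamma> k)))"
  by (simp add: curve_has_length_def arc_len_def speed_def)

lemma chain_if_curve:
  assumes "curve_has_length P c L"
  shows "chain P (c 0) (c 1) L"
proof -
  obtain m p \<gamma> where p: "p 0 = (0::real)" "p m = 1"
    and pk: "\<forall>k<m. p k < p (Suc k) \<and> C1_lift P c (p k) (p (Suc k)) (\<gamma> k)"
    and L: "L = (\<Sum>k<m. arc_len P (p k) (p (Suc k)) (\<gamma> k))"
    using assms unfolding curve_has_length_arcs by blast
  have arcs: "chain P (c (p k)) (c (p (Suc k))) (arc_len P (p k) (p (Suc k)) (\<gamma> k))" if "k < m" for k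
  proof -
    have "p k \<le> p (Suc k)" "arc_on P (p k) (p (Suc k)) (\<gamma> k)" "c (p k) = H_orbit P (\<gamma> k (p k))"
      "c (p (Suc k)) = H_orbit P (\<gamma> k (p (Suc k)))" using pk that by (auto simp: C1_lift_arc less_imp_le)
    then show ?thesis using chain.arc by metis
  qed
  have chains: "chain P (c (p 0)) (c (p (Suc j))) (\<Sum>k<Suc j. arc_len P (p k) (p (Suc k)) (\<gamma> k))" if "Suc j \<le> m" for j
    using that
  proof (induction j)
    case 0
    then show ?case using arcs[of 0] by simp
  next
    case (Suc j)
    then have "chain P (c (p 0)) (c (p (Suc j))) (\<Sum>k<Suc j. arc_len P (p k) (p (Suc k)) (\<gamma> k))"
      "chain P (c (p (Suc j))) (c (p (Suc (Suc j)))) (arc_len P (p (Suc j)) (p (Suc (Suc j))) (\<gamma> (Suc j)))"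
      using arcs[of "Suc j"] by auto
    from chain_trans[OF this] show ?case by simp
  qed
  obtain j where "m = Suc j" using p by (cases m) auto
  then show ?thesis using chains[of j] p L by simp
qed

text \<open>The interval is arbitrary for the sake of the induction: the first arc is laid on the
  left half and the rest on the right half. The clause \<open>a \<le> p k\<close> keeps the later
  pieces out of the left half, so that gluing does not affect their lifts.\<close>

lemma curve_if_chain:
  fixes P :: "(real ^ 'n) set"
  assumes D: "delzant P"
  shows "chain P X Y L \<Longrightarrow> a < b \<Longrightarrow>
    \<exists>(m::nat) (p::nat \<Rightarrow> real) \<gamma> c. p 0 = a \<and> p m = b \<and> c a = X \<and> c b = Y \<and>
        (\<forall>k<m. p k < p (Suc k) \<and> a \<le> p k \<and> C1_lift P c (p k) (p (Suc k)) (\<gamma> k)) \<and>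
        L = (\<Sum>k<m. arc_len P (p k) (p (Suc k)) (\<gamma> k))"
proof (induction arbitrary: a b rule: chain.induct)
  case (arc a' b' \<gamma>)
  obtain \<delta> where \<delta>: "arc_on P a b \<delta>" "\<delta> a = \<gamma> a'" "\<delta> b = \<gamma> b'" "arc_len P a b \<delta> = arc_len P a' b' \<gamma>"
    using arc_reparam[OF D arc(2,1,3)] .
  show ?case
    by (rule exI[of _ 1], rule exI[of _ "\<lambda>k. if k = 0 then a else b"], rule exI[of _ "\<lambda>k. \<delta>"],
        rule exI[of _ "\<lambda>t. H_orbit P (\<delta> t)"]) (use \<delta> arc(3) in \<open>auto simp: C1_lift_arc\<close>)
next
  case (step a' b' \<gamma> Z L)
  define e where "e = (a + b) / 2"
  have e: "a < e" "e < b" using step.prems by (auto simp: e_def)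
  obtain \<delta> where \<delta>: "arc_on P a e \<delta>" "\<delta> a = \<gamma> a'" "\<delta> e = \<gamma> b'" "arc_len P a e \<delta> = arc_len P a' b' \<gamma>"
    using arc_reparam[OF D step(2,1) e(1)] .
  obtain m p \<eta> c where p: "p 0 = e" "p m = b" and c: "c e = H_orbit P (\<gamma> b')" "c b = Z"
    and pk: "\<forall>k<m. p k < p (Suc k) \<and> e \<le> p k \<and> C1_lift P c (p k) (p (Suc k)) (\<eta> k)"
    and L: "L = (\<Sum>k<m. arc_len P (p k) (p (Suc k)) (\<eta> k))"
    using step.IH[OF e(2)] by blast
  define p' where "p' k = (case k of 0 \<Rightarrow> a | Suc j \<Rightarrow> p j)" for k
  define \<gamma>' where "\<gamma>' k = (case k of 0 \<Rightarrow> \<delta> | Suc j \<Rightarrow> \<eta> j)" for k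
  define c' where "c' t = (if t \<le> e then H_orbit P (\<delta> t) else c t)" for t
  have lift: "p' k < p' (Suc k) \<and> a \<le> p' k \<and> C1_lift P c' (p' k) (p' (Suc k)) (\<gamma>' k)" if k: "k < Suc m" for k
  proof (cases k)
    case 0
    have "C1_lift P c' a e \<delta>" using \<delta>(1) by (auto simp: C1_lift_arc c'_def)
    then show ?thesis using 0 e p by (simp add: p'_def \<gamma>'_def)
  next
    case (Suc j)
    have j: "p j < p (Suc j)" "e \<le> p j" "C1_lift P c (p j) (p (Suc j)) (\<eta> j)" using pk k Suc by auto
    have "c' t = c t" if "e \<le> t" for t using that c(1) \<delta>(3) by (auto simp: c'_def)
    then have "C1_lift P c' (p j) (p (Suc j)) (\<eta> j)" using j by (auto simp: C1_lift_arc)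
    then show ?thesis using Suc j e by (simp add: p'_def \<gamma>'_def)
  qed
  have sum: "arc_len P a' b' \<gamma> + L = (\<Sum>k<Suc m. arc_len P (p' k) (p' (Suc k)) (\<gamma>' k))"
    unfolding sum.lessThan_Suc_shift by (simp add: p'_def \<gamma>'_def p L \<delta>)
  have "c' a = H_orbit P (\<gamma> a')" "c' b = Z" "p' 0 = a" "p' (Suc m) = b"
    using e \<delta> c p by (auto simp: c'_def p'_def)
  then show ?case using lift sum by blast
qed

lemma curve_iff_chain:
  assumes D: "delzant P"
  shows "(\<exists>c. c 0 = X \<and> c 1 = Y \<and> curve_has_length P c L) \<longleftrightarrow> chain P X Y L"
proof
  assume "\<exists>c. c 0 = X \<and> c 1 = Y \<and> curve_has_length P c L"
  then show "chain P X Y L" using chain_if_curve by blast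
next
  assume "chain P X Y L"
  from curve_if_chain[OF D this zero_less_one]
  show "\<exists>c. c 0 = X \<and> c 1 = Y \<and> curve_has_length P c L" unfolding curve_has_length_arcs by blast
qed

section \<open>Topology of the level set and finiteness of the distance\<close>

lemma continuous_on_cnorm_diff:
  "continuous_on S (\<lambda>w. cnorm P (\<lambda>F. z F - w F))"
  unfolding cnorm_def flat_inner_def
  by (intro continuous_intros continuous_on_subset[OF continuous_on_product_coordinates]) auto

text \<open>Polar coordinates exhibit the level set as a continuous image of \<open>P\<close> times
  a box of angles; the box is a product of intervals in the function space, compact by Tychonoff and
  connected.\<close>

lemma level_set_compact_connected:
  fixes P :: "(real ^ 'n) set"
  assumes D: "delzant P"
  shows "compact (level_set P)" "connected (level_set P)"
proof -
  define B :: "((real ^ 'n) set \<Rightarrow> real) set" where "B = {\<theta>. \<forall>F. \<theta> F \<in> {-pi..pi}}"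
  define g :: "(real ^ 'n) \<times> ((real ^ 'n) set \<Rightarrow> real) \<Rightarrow> 'n cvec" where
    "g = (\<lambda>y F. if F \<in> facets P then of_real (sqrt (facet_form P F (fst y))) * cis (snd y F) else 0)"
  have "compact B" unfolding B_def by (rule compact_box_functions) simp
  have "connected B"
  proof -
    have "connectedin (product_topology (\<lambda>i. euclidean) UNIV) (PiE UNIV (\<lambda>i::(real ^ 'n) set. {-pi..pi}))"
      by (simp add: connectedin_PiE)
    moreover have "PiE UNIV (\<lambda>i::(real ^ 'n) set. {-pi..pi}) = B" by (auto simp: PiE_def B_def)
    ultimately show ?thesis by (simp add: euclidean_product_topology)
  qed
  have cg: "continuous_on (P \<times> B) g"
  proof (rule continuous_on_coordinatewise_then_product)
    fix F
    have "continuous_on (P \<times> B) (\<lambda>y. snd y F)"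
      by (rule continuous_on_compose2[OF continuous_on_product_coordinates[of F] continuous_on_snd]) (auto intro: continuous_intros)
    moreover have "continuous_on (P \<times> B) (\<lambda>y. facet_form P F (fst y))"
      unfolding facet_form_def by (intro continuous_intros)
    ultimately show "continuous_on (P \<times> B) (\<lambda>y. g y F)"
      unfolding g_def by (cases "F \<in> facets P") (auto intro!: continuous_intros)
  qed
  have img: "g ` (P \<times> B) = level_set P"
  proof (intro equalityI subsetI)
    fix z assume "z \<in> g ` (P \<times> B)"
    then obtain x \<theta> where x: "x \<in> P" "z = g (x, \<theta>)" by auto
    have "\<forall>F\<in>facets P. (cmod (z F))\<^sup>2 = facet_form P F x"
      using delzant_facet(2)[OF D _ x(1)] by (simp add: x(2) g_def norm_mult)
    then show "z \<in> level_set P" unfolding level_set_def by (auto simp: x(2) g_def)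
  next
    fix z assume z: "z \<in> level_set P"
    obtain x where x: "x \<in> P" "\<forall>F\<in>facets P. (cmod (z F))\<^sup>2 = facet_form P F x" using level_set_point[OF D z] .
    have "z = g (x, \<lambda>F. Arg (z F))"
    proof
      fix F
      show "z F = g (x, \<lambda>F. Arg (z F)) F"
      proof (cases "F \<in> facets P")
        case True
        have "sqrt (facet_form P F x) = cmod (z F)" using x(2) True by (metis norm_ge_zero real_sqrt_unique)
        then show ?thesis using True by (simp add: g_def) (metis rcis_cmod_Arg rcis_def)
      next
        case False
        then show ?thesis using z by (simp add: g_def level_set_def)
      qed
    qed
    moreover have "(x, \<lambda>F. Arg (z F)) \<in> P \<times> B" using x(1) Arg_bounded by (auto simp: B_def less_imp_le)
    ultimately show "z \<in> g ` (P \<times> B)" by blast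
  qed
  have "compact (P \<times> B)" using delzant_compact[OF D] \<open>compact B\<close> by (rule compact_Times)
  then show "compact (level_set P)" using compact_continuous_image[OF cg] img by simp
  have "connected (P \<times> B)" using convex_connected[OF delzant_convex[OF D]] \<open>connected B\<close> by (rule connected_Times)
  then show "connected (level_set P)" using connected_continuous_image[OF cg] img by simp
qed

lemma loc_comparable_exists:
  assumes D: "delzant P" and \<epsilon>: "0 < \<epsilon>"
  obtains r where "r > 0" "loc_comparable P \<epsilon> r"
proof -
  obtain c M where c: "c > 0" and M: "M \<ge> 1" and cov: "chart_cover P c M" using chart_cover_exists[OF D] .
  show thesis using loc_comparable_if_chart_cover[OF c M \<epsilon>, of "card (facets P)"] D cov that by blast
qed

text \<open>Being joined by a chain is an equivalence relation on the connected level set, and local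
  comparability makes its classes open. The infimum defining the distance is thus taken over a
  nonempty set.\<close>

lemma chain_exists:
  assumes D: "delzant P" and X: "X \<in> toric_manifold P" and Y: "Y \<in> toric_manifold P"
  obtains L where "chain P X Y L"
proof -
  obtain r where r: "r > 0" "loc_comparable P 1 r" using loc_comparable_exists[OF D zero_less_one] .
  obtain z where z: "z \<in> level_set P" "X = H_orbit P z" using X by (auto simp: toric_manifold_def)
  obtain w where w: "w \<in> level_set P" "Y = H_orbit P w" using Y by (auto simp: toric_manifold_def)
  have "\<exists>L. chain P (H_orbit P z) (H_orbit P w) L"
  proof (rule connected_equivalence_relation[OF level_set_compact_connected(2)[OF D] z(1) w(1),
        where R = "\<lambda>z w. \<exists>L. chain P (H_orbit P z) (H_orbit P w) L"])
    show "\<exists>L. chain P (H_orbit P y) (H_orbit P x) L" if "\<exists>L. chain P (H_orbit P x) (H_orbit P y) L" for x y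
      using that chain_sym[OF D] by blast
    show "\<exists>L. chain P (H_orbit P x) (H_orbit P v) L"
      if "\<exists>L. chain P (H_orbit P x) (H_orbit P y) L" "\<exists>L. chain P (H_orbit P y) (H_orbit P v) L" for x y v
      using that chain_trans by blast
    fix a assume a: "a \<in> level_set P"
    define U where "U = {w. cnorm P (\<lambda>F. a F - w F) < r}"
    have "open U" unfolding U_def by (intro open_Collect_less continuous_on_cnorm_diff continuous_intros)
    then have "openin (top_of_set (level_set P)) (level_set P \<inter> U)" by (rule openin_open_Int)
    moreover have "a \<in> U" using r(1) by (simp add: U_def cnorm_def flat_inner_def)
    moreover have "\<exists>L. chain P (H_orbit P a) (H_orbit P x) L" if "x \<in> level_set P \<inter> U" for x
      using r(2) a that unfolding loc_comparable_def U_def by force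
    ultimately show "\<exists>T. openin (top_of_set (level_set P)) T \<and> a \<in> T \<and> (\<forall>x\<in>T. \<exists>L. chain P (H_orbit P a) (H_orbit P x) L)"
      using a by blast
  qed
  then show thesis using that z w by blast
qed

section \<open>Metric axioms and compactness of the quotient\<close>

lemma guillemin_dist_Inf:
  assumes "delzant P" "X \<in> toric_manifold P" "Y \<in> toric_manifold P"
  shows "guillemin_dist P X Y = Inf {L. chain P X Y L}"
  using assms by (simp add: guillemin_dist_def curve_iff_chain)

lemma bdd_below_chain: "bdd_below {L. chain P X Y L}"
  using chain_nonneg by (intro bdd_belowI[of _ 0]) auto

lemma guillemin_dist_le:
  assumes "delzant P" "chain P X Y L"
  shows "guillemin_dist P X Y \<le> L"
proof -
  have "X \<in> toric_manifold P" "Y \<in> toric_manifold P" using chain_manifold[OF assms(2)] by auto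
  then show ?thesis using assms by (simp add: guillemin_dist_Inf cInf_lower bdd_below_chain)
qed

lemma guillemin_dist_less:
  assumes D: "delzant P" and X: "X \<in> toric_manifold P" and Y: "Y \<in> toric_manifold P" and L: "guillemin_dist P X Y < L"
  obtains L' where "L' < L" "chain P X Y L'"
proof -
  obtain L0 where "chain P X Y L0" using chain_exists[OF D X Y] .
  then have "{L. chain P X Y L} \<noteq> {}" by blast
  then show thesis using cInf_lessD[of "{L. chain P X Y L}" L] L that by (auto simp: guillemin_dist_Inf[OF D X Y])
qed

lemma guillemin_dist_nonneg:
  assumes D: "delzant P"
  shows "0 \<le> guillemin_dist P X Y"
proof (cases "X \<in> toric_manifold P \<and> Y \<in> toric_manifold P")
  case True
  show ?thesis
  proof (rule ccontr)
    assume "\<not> 0 \<le> guillemin_dist P X Y"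
    then obtain L where "L < 0" "chain P X Y L" using guillemin_dist_less[OF D, of X Y 0] True by auto
    then show False using chain_nonneg by force
  qed
qed (auto simp: guillemin_dist_def)

text \<open>The group \<open>H\<close> is compact: its elements have angles in the unit interval,
  where lying in the preimage of the lattice is a closed condition. The distance from
  \<open>z\<close> to the orbit is therefore attained, and it is 0.\<close>

lemma H_orbit_closed:
  fixes P :: "(real ^ 'n) set"
  assumes D: "delzant P" and z: "z \<in> level_set P" and y: "y \<in> level_set P"
    and near: "\<And>\<epsilon>. \<epsilon> > 0 \<Longrightarrow> \<exists>w\<in>H_orbit P y. cnorm P (\<lambda>F. z F - w F) < \<epsilon>"
  shows "z \<in> H_orbit P y"
proof -
  have fin: "finite (facets P)" using D by simp
  define \<Theta> where "\<Theta> = {\<theta>::(real ^ 'n) set \<Rightarrow> real. \<forall>F. \<theta> F \<in> {0..1}} \<inter> {\<theta>. normal_map P \<theta> \<in> int_lattice}"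
  have cl: "closed (int_lattice :: (real ^ 'n) set)"
  proof -
    have eq: "(int_lattice :: (real ^ 'n) set) = (\<Inter>i. (\<lambda>x. x $ i) -` \<int>)" by (auto simp: int_lattice_def)
    have "closed ((\<lambda>x::real ^ 'n. x $ i) -` \<int>)" for i
      by (rule closed_vimage) (auto intro: continuous_intros)
    then show ?thesis unfolding eq by (rule closed_INT[OF ballI])
  qed
  have "continuous_on UNIV (normal_map P)" unfolding normal_map_def
    by (intro continuous_intros continuous_on_product_coordinates)
  then have "closed (normal_map P -` int_lattice)" using cl by (simp add: closed_vimage)
  then have "closed {\<theta>. normal_map P \<theta> \<in> int_lattice}" by (simp add: vimage_def)
  then have "compact \<Theta>" unfolding \<Theta>_def by (intro compact_Int_closed compact_box_functions) auto
  moreover have "(\<lambda>_. 0) \<in> \<Theta>" by (simp add: \<Theta>_def)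
  moreover have "continuous_on \<Theta> (\<lambda>\<theta>. cnorm P (\<lambda>F. z F - rotate_by \<theta> y F))"
    unfolding cnorm_def flat_inner_def rotate_by_def
    by (intro continuous_intros continuous_on_subset[OF continuous_on_product_coordinates]) auto
  ultimately obtain \<theta>0 where \<theta>0: "\<theta>0 \<in> \<Theta>"
    "\<forall>\<theta>\<in>\<Theta>. cnorm P (\<lambda>F. z F - rotate_by \<theta>0 y F) \<le> cnorm P (\<lambda>F. z F - rotate_by \<theta> y F)"
    using continuous_attains_inf[of \<Theta> "\<lambda>\<theta>. cnorm P (\<lambda>F. z F - rotate_by \<theta> y F)"] by blast
  let ?v = "cnorm P (\<lambda>F. z F - rotate_by \<theta>0 y F)"
  have "?v = 0"
  proof (rule ccontr)
    assume "?v \<noteq> 0"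
    then have "?v > 0" by (simp add: order_less_le)
    then obtain w where w: "w \<in> H_orbit P y" "cnorm P (\<lambda>F. z F - w F) < ?v" using near by blast
    then obtain \<theta> where \<theta>: "normal_map P \<theta> \<in> int_lattice" "w = rotate_by \<theta> y" unfolding H_orbit_def by blast
    \<comment> \<open>The integral parts of the angles are mapped into the lattice, the normals
      being integral, and do not affect the rotation.\<close>
    define \<phi> where "\<phi> F = frac (\<theta> F)" for F
    have fl: "normal_map P (\<lambda>F. of_int \<lfloor>\<theta> F\<rfloor>) \<in> int_lattice"
      using facet_normal_lattice[OF D] by (auto simp: normal_map_def int_lattice_def intro!: Ints_sum Ints_mult)
    have "\<phi> = (\<lambda>F. \<theta> F - of_int \<lfloor>\<theta> F\<rfloor>)" by (simp add: \<phi>_def frac_def fun_eq_iff)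
    then have "normal_map P \<phi> \<in> int_lattice"
      using int_lattice_diff[OF \<theta>(1) fl] by (simp only: normal_map_diff)
    then have "\<phi> \<in> \<Theta>" by (auto simp: \<Theta>_def \<phi>_def frac_ge_0 less_imp_le[OF frac_lt_1])
    moreover have "rotate_by \<phi> y = w"
    proof
      fix F
      have "2 * pi * \<phi> F = 2 * pi * \<theta> F - 2 * pi * of_int \<lfloor>\<theta> F\<rfloor>" by (simp add: \<phi>_def frac_def algebra_simps)
      then have "cis (2 * pi * \<phi> F) = cis (2 * pi * \<theta> F)" by (simp add: cis_divide[symmetric] cis_multiple_2pi)
      then show "rotate_by \<phi> y F = w F" by (simp add: rotate_by_cis \<theta>(2))
    qed
    ultimately show False using \<theta>0(2) w(2) by fastforce
  qed
  then have "z F = rotate_by \<theta>0 y F" if "F \<in> facets P" for F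
    using cmod_le_cnorm[OF fin that, of "\<lambda>F. z F - rotate_by \<theta>0 y F"] by simp
  moreover have "z F = rotate_by \<theta>0 y F" if "F \<notin> facets P" for F
    using z y that by (simp add: level_set_def rotate_by_def)
  ultimately have "z = rotate_by \<theta>0 y" by blast
  then show ?thesis using \<theta>0(1) unfolding H_orbit_def \<Theta>_def by blast
qed

text \<open>Only definiteness is not formal: if the distance is 0, lifting short chains produces
  points of the second orbit arbitrarily close to a point of the first, and orbits are
  closed.\<close>

lemma guillemin_Metric_space:
  assumes D: "delzant P"
  shows "Metric_space (toric_manifold P) (guillemin_dist P)"
proof
  show "0 \<le> guillemin_dist P x y" for x y by (rule guillemin_dist_nonneg[OF D])
  have "{L. chain P x y L} = {L. chain P y x L}" for x y using chain_sym[OF D] by blast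
  then show "guillemin_dist P x y = guillemin_dist P y x" for x y
    using D by (simp add: guillemin_dist_def curve_iff_chain)
  show "(guillemin_dist P x y = 0) = (x = y)" if xy: "x \<in> toric_manifold P" "y \<in> toric_manifold P" for x y
  proof
    assume "x = y"
    then show "guillemin_dist P x y = 0"
      using guillemin_dist_le[OF D chain_refl[OF xy(1)]] guillemin_dist_nonneg[OF D, of x y] by simp
  next
    assume 0: "guillemin_dist P x y = 0"
    obtain z where z: "z \<in> level_set P" "x = H_orbit P z" using xy by (auto simp: toric_manifold_def)
    obtain w where w: "w \<in> level_set P" "y = H_orbit P w" using xy by (auto simp: toric_manifold_def)
    have "z \<in> H_orbit P w"
    proof (rule H_orbit_closed[OF D z(1) w(1)])
      fix \<epsilon> :: real assume "\<epsilon> > 0"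
      then obtain L where L: "L < \<epsilon>" "chain P x y L" using guillemin_dist_less[OF D xy, of \<epsilon>] 0 by auto
      have "z \<in> x" using z H_orbit_self by simp
      from chain_lift[OF D L(2) this] show "\<exists>w\<in>H_orbit P w. cnorm P (\<lambda>F. z F - w F) < \<epsilon>"
        using L(1) w(2) by force
    qed
    then show "x = y" using H_orbit_eq z w by blast
  qed
  show "guillemin_dist P x z \<le> guillemin_dist P x y + guillemin_dist P y z"
    if xyz: "x \<in> toric_manifold P" "y \<in> toric_manifold P" "z \<in> toric_manifold P" for x y z
  proof (rule field_le_epsilon)
    fix e :: real assume "0 < e"
    then have "guillemin_dist P x y < guillemin_dist P x y + e / 2" "guillemin_dist P y z < guillemin_dist P y z + e / 2" by auto
    then obtain L M where L: "L < guillemin_dist P x y + e / 2" "chain P x y L"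
      and M: "M < guillemin_dist P y z + e / 2" "chain P y z M"
      using guillemin_dist_less[OF D] xyz by metis
    then show "guillemin_dist P x z \<le> guillemin_dist P x y + guillemin_dist P y z + e"
      using guillemin_dist_le[OF D chain_trans[OF L(2) M(2)]] by linarith
  qed
qed

text \<open>Local comparability makes the projection from the compact level set continuous for the
  Guillemin distance.\<close>

lemma guillemin_compact:
  assumes D: "delzant P"
  shows "compact_space (Metric_space.mtopology (toric_manifold P) (guillemin_dist P))"
proof -
  interpret M: Metric_space "toric_manifold P" "guillemin_dist P" by (rule guillemin_Metric_space[OF D])
  obtain r where r: "r > 0" "loc_comparable P 1 r" using loc_comparable_exists[OF D zero_less_one] .
  have "continuous_map (top_of_set (level_set P)) M.mtopology (H_orbit P)"
    unfolding M.continuous_map_to_metric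
  proof (intro ballI allI impI)
    fix z and \<epsilon> :: real assume "z \<in> topspace (top_of_set (level_set P))" and \<epsilon>: "0 < \<epsilon>"
    then have z: "z \<in> level_set P" by simp
    define U where "U = {w. cnorm P (\<lambda>F. z F - w F) < min r (\<epsilon> / 2)}"
    have "open U" unfolding U_def by (intro open_Collect_less continuous_on_cnorm_diff continuous_intros)
    then have 1: "openin (top_of_set (level_set P)) (level_set P \<inter> U)" by (rule openin_open_Int)
    have 2: "z \<in> level_set P \<inter> U" using r(1) \<epsilon> z by (simp add: U_def cnorm_def flat_inner_def)
    have 3: "H_orbit P w \<in> M.mball (H_orbit P z) \<epsilon>" if w: "w \<in> level_set P \<inter> U" for w
    proof -
      obtain L where "L \<le> (1 + 1) * cnorm P (\<lambda>F. z F - w F)" "chain P (H_orbit P z) (H_orbit P w) L"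
        using r(2) z w unfolding loc_comparable_def U_def by force
      moreover have "cnorm P (\<lambda>F. z F - w F) < \<epsilon> / 2" using w by (simp add: U_def)
      ultimately have "guillemin_dist P (H_orbit P z) (H_orbit P w) < \<epsilon>"
        using guillemin_dist_le[OF D] by fastforce
      moreover have "H_orbit P z \<in> toric_manifold P" "H_orbit P w \<in> toric_manifold P"
        using z w by (auto simp: toric_manifold_def)
      ultimately show ?thesis by simp
    qed
    show "\<exists>U. openin (top_of_set (level_set P)) U \<and> z \<in> U \<and> (\<forall>y\<in>U. H_orbit P y \<in> M.mball (H_orbit P z) \<epsilon>)"
      using 1 2 3 by blast
  qed
  moreover have "compactin (top_of_set (level_set P)) (level_set P)"
    using level_set_compact_connected(1)[OF D] by (simp add: compactin_subtopology)
  ultimately have "compactin M.mtopology (H_orbit P ` level_set P)" by (rule image_compactin[rotated])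
  then show ?thesis by (simp add: compact_space_def flip: toric_manifold_def)
qed

section \<open>The torus action\<close>

definition lattice_coset :: "real ^ 'n \<Rightarrow> (real ^ 'n) set" where
  "lattice_coset a = {x. x - a \<in> int_lattice}"

lemma lattice_coset_mem: "x \<in> lattice_coset a \<Longrightarrow> lattice_coset x = lattice_coset a"
  unfolding lattice_coset_def
proof (intro Collect_cong)
  fix y assume x: "x \<in> {x. x - a \<in> int_lattice}"
  then have "x - a \<in> int_lattice" by simp
  then show "(y - x \<in> int_lattice) = (y - a \<in> int_lattice)"
    using int_lattice_add[of "y - x" "x - a"] int_lattice_diff[of "y - a" "x - a"] by auto
qed

lemma lattice_coset_self: "a \<in> lattice_coset a"
  by (simp add: lattice_coset_def)

lemma torus_group: "group (torus :: (real ^ 'n) set monoid)"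
proof -
  let ?A = "\<lparr>carrier = UNIV, mult = (+), one = 0 :: real ^ 'n\<rparr>"
  interpret A: comm_group ?A
  proof (rule comm_groupI)
    show "\<exists>y\<in>carrier ?A. y \<otimes>\<^bsub>?A\<^esub> x = \<one>\<^bsub>?A\<^esub>" for x by (auto intro: exI[of _ "- x"])
  qed auto
  have inv: "inv\<^bsub>?A\<^esub> x = - x" for x by (rule A.inv_equality) auto
  have "subgroup int_lattice ?A"
    by (rule subgroup.intro) (auto simp: int_lattice_add inv int_lattice_minus)
  then have "int_lattice \<lhd> ?A" by (rule A.subgroup_imp_normal)
  then show ?thesis unfolding torus_def by (rule normal.factorgroup_is_group)
qed

lemma carrier_torus: "carrier torus = range lattice_coset"
proof -
  have "(\<Union>h\<in>int_lattice. {h + a}) = lattice_coset a" for a :: "real ^ 'n"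
    unfolding lattice_coset_def by (force intro: bexI[of _ "_ - a"])
  then show ?thesis by (auto simp: torus_def FactGroup_def RCOSETS_def r_coset_def)
qed

lemma mult_torus: "lattice_coset a \<otimes>\<^bsub>torus\<^esub> lattice_coset b = lattice_coset (a + b)"
proof -
  have "(\<Union>h\<in>lattice_coset a. \<Union>k\<in>lattice_coset b. {h + k}) = lattice_coset (a + b)"
  proof (intro equalityI subsetI)
    fix x assume "x \<in> (\<Union>h\<in>lattice_coset a. \<Union>k\<in>lattice_coset b. {h + k})"
    then obtain h k where "h - a \<in> int_lattice" "k - b \<in> int_lattice" "x = h + k" by (auto simp: lattice_coset_def)
    then show "x \<in> lattice_coset (a + b)" using int_lattice_add[of "h - a" "k - b"]
      by (simp add: lattice_coset_def algebra_simps)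
  next
    fix x assume x: "x \<in> lattice_coset (a + b)"
    have "x - b \<in> lattice_coset a" using x by (simp add: lattice_coset_def algebra_simps)
    moreover have "b \<in> lattice_coset b" by (rule lattice_coset_self)
    ultimately show "x \<in> (\<Union>h\<in>lattice_coset a. \<Union>k\<in>lattice_coset b. {h + k})"
      by (intro UN_I[of "x - b"] UN_I[of b]) auto
  qed
  then show ?thesis by (simp add: torus_def set_mult_def)
qed

text \<open>The normals of the facets at a single vertex already span.\<close>

lemma normal_map_surj:
  fixes P :: "(real ^ 'n) set"
  assumes D: "delzant P"
  obtains \<theta> where "normal_map P \<theta> = a"
proof -
  obtain x where x: "x \<in> P" using delzant_nonempty[OF D] by blast
  obtain v where v: "v extreme_point_of P" by (rule delzant_active_vertex[OF D x])
  obtain u where ch: "chart P {F \<in> facets P. v \<in> F} u" by (rule delzant_vertex[OF D v])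
  let ?A = "{F \<in> facets P. v \<in> F}"
  have "normal_map P (\<lambda>F. if F \<in> ?A then a \<bullet> u F else 0) = (\<Sum>F\<in>facets P. if F \<in> ?A then (a \<bullet> u F) *\<^sub>R facet_normal P F else 0)"
    unfolding normal_map_def by (rule sum.cong) auto
  also have "\<dots> = (\<Sum>F\<in>?A. (a \<bullet> u F) *\<^sub>R facet_normal P F)"
    by (rule sum.mono_neutral_cong_right) (use D in auto)
  also have "\<dots> = a" using ch unfolding chart_def by metis
  finally show thesis by (rule that)
qed

text \<open>Two angle functions mapped into the same coset differ by an element of \<open>H\<close>,
  which preserves orbits; so a single representative describes the action.\<close>

lemma torus_action_eq:
  assumes X: "X \<in> toric_manifold P" and \<theta>: "normal_map P \<theta> \<in> g" and g: "g \<in> carrier torus"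
  shows "torus_action P g X = rotate_by \<theta> ` X"
proof -
  obtain z where z: "z \<in> level_set P" "X = H_orbit P z" using X by (auto simp: toric_manifold_def)
  obtain a where "g = lattice_coset a" using g by (auto simp: carrier_torus)
  then have g: "g = lattice_coset (normal_map P \<theta>)" using lattice_coset_mem \<theta> by blast
  have "{rotate_by \<theta>' w | \<theta>' w. w \<in> X \<and> normal_map P \<theta>' \<in> g} = H_orbit P (rotate_by \<theta> z)"
  proof (intro equalityI subsetI)
    fix y assume "y \<in> {rotate_by \<theta>' w | \<theta>' w. w \<in> X \<and> normal_map P \<theta>' \<in> g}"
    then obtain \<theta>' w where y: "y = rotate_by \<theta>' w" "w \<in> X" "normal_map P \<theta>' \<in> g" by blast
    obtain \<phi> where \<phi>: "normal_map P \<phi> \<in> int_lattice" "w = rotate_by \<phi> z" using y(2) z unfolding H_orbit_def by blast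
    have "y = rotate_by (\<lambda>F. \<theta>' F - \<theta> F + \<phi> F) (rotate_by \<theta> z)"
      by (simp add: y(1) \<phi>(2) algebra_simps)
    moreover have "normal_map P (\<lambda>F. \<theta>' F - \<theta> F + \<phi> F) \<in> int_lattice"
      using y(3) \<phi>(1) unfolding g lattice_coset_def by (simp add: normal_map_add normal_map_diff int_lattice_add)
    ultimately show "y \<in> H_orbit P (rotate_by \<theta> z)" unfolding H_orbit_def by blast
  next
    fix y assume "y \<in> H_orbit P (rotate_by \<theta> z)"
    then obtain w where "w \<in> X" "y = rotate_by \<theta> w" unfolding rotate_H_orbit[symmetric] z by blast
    then show "y \<in> {rotate_by \<theta>' w | \<theta>' w. w \<in> X \<and> normal_map P \<theta>' \<in> g}" using \<theta> by blast
  qed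
  then show ?thesis using X z by (simp add: torus_action_def rotate_H_orbit)
qed

lemma rotate_manifold: "X \<in> toric_manifold P \<Longrightarrow> rotate_by \<theta> ` X \<in> toric_manifold P"
  by (auto simp: toric_manifold_def rotate_H_orbit intro!: imageI rotate_by_level_set)

lemma carrier_torus_angles:
  assumes D: "delzant P" and g: "g \<in> carrier torus"
  obtains \<theta> where "g = lattice_coset (normal_map P \<theta>)" "normal_map P \<theta> \<in> g"
proof -
  obtain a where a: "g = lattice_coset a" using g by (auto simp: carrier_torus)
  obtain \<theta> where "normal_map P \<theta> = a" using normal_map_surj[OF D] .
  then show thesis using that a lattice_coset_self by blast
qed

lemma torus_action_isometry:
  assumes D: "delzant P" and g: "g \<in> carrier torus" and X: "X \<in> toric_manifold P" and Y: "Y \<in> toric_manifold P"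
  shows "guillemin_dist P (torus_action P g X) (torus_action P g Y) = guillemin_dist P X Y"
proof -
  obtain \<theta> where \<theta>: "normal_map P \<theta> \<in> g" by (rule carrier_torus_angles[OF D g])
  have inv: "rotate_by (\<lambda>F. - \<theta> F) ` rotate_by \<theta> ` X = X" for X by (simp add: image_image)
  have "chain P (rotate_by \<theta> ` X) (rotate_by \<theta> ` Y) L \<longleftrightarrow> chain P X Y L" for L
    using chain_rotate[OF D, of X Y L \<theta>] chain_rotate[OF D, of "rotate_by \<theta> ` X" "rotate_by \<theta> ` Y" L "\<lambda>F. - \<theta> F"]
    unfolding inv by blast
  then show ?thesis
    by (simp add: torus_action_eq[OF _ \<theta> g] X Y guillemin_dist_Inf[OF D] rotate_manifold)
qed

text \<open>Effectiveness can be read off from one orbit, over an interior point of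
  \<open>P\<close>: there no coordinate at a facet vanishes, so the rotated point determines the
  angles modulo 1.\<close>

lemma torus_faithful_action:
  fixes P :: "(real ^ 'n) set"
  assumes D: "delzant P"
  shows "faithful_action torus (toric_manifold P) (torus_action P)"
proof -
  let ?M = "toric_manifold P" and ?\<phi> = "torus_action P"
  have closed: "?\<phi> g X \<in> ?M" if g: "g \<in> carrier torus" and X: "X \<in> ?M" for g X
  proof -
    obtain \<theta> where "normal_map P \<theta> \<in> g" by (rule carrier_torus_angles[OF D g])
    then show ?thesis using torus_action_eq[OF X _ g] rotate_manifold[OF X] by metis
  qed
  have bij: "?\<phi> g \<in> Bij ?M" if g: "g \<in> carrier torus" for g
  proof -
    obtain \<theta> where \<theta>: "normal_map P \<theta> \<in> g" by (rule carrier_torus_angles[OF D g])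
    have "bij_betw (?\<phi> g) ?M ?M"
    proof (rule bij_betwI[where g = "\<lambda>X. rotate_by (\<lambda>F. - \<theta> F) ` X"])
      show "?\<phi> g \<in> ?M \<rightarrow> ?M" using closed[OF g] by blast
      show "(\<lambda>X. rotate_by (\<lambda>F. - \<theta> F) ` X) \<in> ?M \<rightarrow> ?M" using rotate_manifold by blast
      show "rotate_by (\<lambda>F. - \<theta> F) ` ?\<phi> g X = X" if "X \<in> ?M" for X
        by (simp add: torus_action_eq[OF that \<theta> g] image_image)
      show "?\<phi> g (rotate_by (\<lambda>F. - \<theta> F) ` X) = X" if "X \<in> ?M" for X
        by (simp add: torus_action_eq[OF rotate_manifold[OF that] \<theta> g] image_image)
    qed
    moreover have "?\<phi> g \<in> extensional ?M" by (simp add: torus_action_def)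
    ultimately show ?thesis by (simp add: Bij_def)
  qed
  have hom: "?\<phi> \<in> hom torus (BijGroup ?M)"
  proof (rule homI)
    show "?\<phi> g \<in> carrier (BijGroup ?M)" if "g \<in> carrier torus" for g using bij[OF that] by (simp add: BijGroup_def)
    fix g h :: "(real ^ 'n) set" assume g: "g \<in> carrier torus" and h: "h \<in> carrier torus"
    obtain \<theta> where \<theta>: "g = lattice_coset (normal_map P \<theta>)" "normal_map P \<theta> \<in> g" using carrier_torus_angles[OF D g] .
    obtain \<phi> where \<phi>: "h = lattice_coset (normal_map P \<phi>)" "normal_map P \<phi> \<in> h" using carrier_torus_angles[OF D h] .
    have gh: "g \<otimes>\<^bsub>torus\<^esub> h = lattice_coset (normal_map P (\<lambda>F. \<theta> F + \<phi> F))"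
      by (simp add: \<theta>(1) \<phi>(1) mult_torus normal_map_add)
    have ghc: "g \<otimes>\<^bsub>torus\<^esub> h \<in> carrier torus" by (simp add: gh carrier_torus)
    have "?\<phi> (g \<otimes>\<^bsub>torus\<^esub> h) X = ?\<phi> g (?\<phi> h X)" if X: "X \<in> ?M" for X
    proof -
      have "?\<phi> (g \<otimes>\<^bsub>torus\<^esub> h) X = rotate_by (\<lambda>F. \<theta> F + \<phi> F) ` X"
        by (rule torus_action_eq[OF X _ ghc]) (simp add: gh lattice_coset_self)
      moreover have "?\<phi> g (?\<phi> h X) = rotate_by \<theta> ` rotate_by \<phi> ` X"
        using torus_action_eq[OF X \<phi>(2) h] torus_action_eq[OF rotate_manifold[OF X] \<theta>(2) g] by simp
      ultimately show ?thesis by (simp add: image_image)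
    qed
    then have "?\<phi> (g \<otimes>\<^bsub>torus\<^esub> h) = compose ?M (?\<phi> g) (?\<phi> h)"
      by (intro extensionalityI[of _ ?M]) (auto simp: compose_def torus_action_def)
    then show "?\<phi> (g \<otimes>\<^bsub>torus\<^esub> h) = ?\<phi> g \<otimes>\<^bsub>BijGroup ?M\<^esub> ?\<phi> h"
      using bij[OF g] bij[OF h] by (simp add: BijGroup_def)
  qed
  have "inj_on ?\<phi> (carrier torus)"
  proof (rule inj_onI)
    fix g h :: "(real ^ 'n) set" assume g: "g \<in> carrier torus" and h: "h \<in> carrier torus" and eq: "?\<phi> g = ?\<phi> h"
    obtain \<theta> where \<theta>: "g = lattice_coset (normal_map P \<theta>)" "normal_map P \<theta> \<in> g" using carrier_torus_angles[OF D g] .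
    obtain \<phi> where \<phi>: "h = lattice_coset (normal_map P \<phi>)" "normal_map P \<phi> \<in> h" using carrier_torus_angles[OF D h] .
    obtain x where x: "x \<in> interior P" "\<forall>F\<in>facets P. 0 < facet_form P F x" using delzant_interior_point[OF D] .
    define z :: "'n cvec" where "z F = (if F \<in> facets P then of_real (sqrt (facet_form P F x)) else 0)" for F
    have z: "z \<in> level_set P" using x(2) by (auto simp: level_set_def z_def less_imp_le intro!: exI[of _ x])
    then have X: "H_orbit P z \<in> ?M" by (simp add: toric_manifold_def)
    have "rotate_by \<theta> ` H_orbit P z = rotate_by \<phi> ` H_orbit P z"
      using torus_action_eq[OF X \<theta>(2) g] torus_action_eq[OF X \<phi>(2) h] eq by simp
    then have "rotate_by \<theta> z \<in> H_orbit P (rotate_by \<phi> z)" using H_orbit_self unfolding rotate_H_orbit by metis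
    then obtain \<psi> where \<psi>: "normal_map P \<psi> \<in> int_lattice" "rotate_by \<theta> z = rotate_by (\<lambda>F. \<psi> F + \<phi> F) z"
      unfolding H_orbit_def by auto
    \<comment> \<open>The angles differ by integers once the element of \<open>H\<close> is taken
      into account, and integral angles are mapped into the lattice.\<close>
    define \<zeta> where "\<zeta> F = \<theta> F - (\<psi> F + \<phi> F)" for F
    have "\<zeta> F \<in> \<int>" if F: "F \<in> facets P" for F
    proof -
      have "z F \<noteq> 0" using x(2) F by (auto simp: z_def)
      moreover have "rotate_by \<theta> z F = rotate_by (\<lambda>F. \<psi> F + \<phi> F) z F" by (simp only: \<psi>(2))
      ultimately have "cis (2 * pi * \<theta> F) = cis (2 * pi * (\<psi> F + \<phi> F))" by (simp add: rotate_by_cis)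
      then have "cis (2 * pi * \<theta> F) / cis (2 * pi * (\<psi> F + \<phi> F)) = 1" by simp
      then have "cis (2 * pi * \<theta> F - 2 * pi * (\<psi> F + \<phi> F)) = 1" by (simp only: cis_divide)
      then have "cis (2 * pi * \<zeta> F) = 1" by (simp add: \<zeta>_def algebra_simps)
      then have "cos (2 * pi * \<zeta> F) = 1" by (metis cis.sel(1) one_complex.sel(1))
      then obtain n :: int where "2 * pi * \<zeta> F = of_int n * 2 * pi" using cos_one_2pi_int by auto
      then have "\<zeta> F = of_int n" by simp
      then show ?thesis by simp
    qed
    then have "normal_map P \<zeta> \<in> int_lattice"
      using facet_normal_lattice[OF D] by (auto simp: normal_map_def int_lattice_def intro!: Ints_sum Ints_mult)
    then have "normal_map P \<theta> - (normal_map P \<psi> + normal_map P \<phi>) \<in> int_lattice"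
      by (simp add: \<zeta>_def[abs_def] normal_map_diff normal_map_add)
    from int_lattice_add[OF this \<psi>(1)] have "normal_map P \<theta> \<in> lattice_coset (normal_map P \<phi>)"
      by (simp add: lattice_coset_def)
    then show "g = h" using lattice_coset_mem \<theta>(1) \<phi>(1) by blast
  qed
  then show ?thesis using hom torus_group group_BijGroup
    by (intro faithful_action.intro faithful_action_axioms.intro group_action.intro group_hom.intro group_hom_axioms.intro)
qed

lemma guillemin_G_space:
  assumes "delzant P"
  shows "compact_isometric_G_space torus (toric_manifold P) (guillemin_dist P) (torus_action P)"
  unfolding compact_isometric_G_space_def
  using guillemin_Metric_space[OF assms] guillemin_compact[OF assms] torus_faithful_action[OF assms]
    torus_action_isometry[OF assms] by blast

section \<open>Comparison of two polytopes with the same normals\<close>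

text \<open>With equal primitive normals, the tori and the kernel \<open>H\<close> of the two
  constructions agree after relabelling the coordinates; the polytopes differ only in the offsets of
  their facets.\<close>

definition matching :: "(real ^ 'n) set \<Rightarrow> (real ^ 'n) set \<Rightarrow> ((real ^ 'n) set \<Rightarrow> (real ^ 'n) set) \<Rightarrow> bool" where
  "matching P Q \<sigma> \<longleftrightarrow> bij_betw \<sigma> (facets P) (facets Q) \<and> (\<forall>F\<in>facets P. facet_normal Q (\<sigma> F) = facet_normal P F)"

lemma matching_inverse:
  assumes "matching P Q \<sigma>"
  shows "matching Q P (inv_into (facets P) \<sigma>)"
  unfolding matching_def
proof (intro conjI ballI)
  show "bij_betw (inv_into (facets P) \<sigma>) (facets Q) (facets P)"
    using assms by (simp add: matching_def bij_betw_inv_into)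
  fix G assume G: "G \<in> facets Q"
  then have "inv_into (facets P) \<sigma> G \<in> facets P" "\<sigma> (inv_into (facets P) \<sigma> G) = G"
    using assms by (auto simp: matching_def bij_betw_def inv_into_into f_inv_into_f)
  then show "facet_normal P (inv_into (facets P) \<sigma> G) = facet_normal Q G"
    using assms unfolding matching_def by metis
qed

lemma matching_inv:
  assumes "matching P Q \<sigma>"
  shows "F \<in> facets P \<Longrightarrow> \<sigma> F \<in> facets Q" "F \<in> facets P \<Longrightarrow> inv_into (facets P) \<sigma> (\<sigma> F) = F"
    "G \<in> facets Q \<Longrightarrow> inv_into (facets P) \<sigma> G \<in> facets P" "G \<in> facets Q \<Longrightarrow> \<sigma> (inv_into (facets P) \<sigma> G) = G"
  using assms by (auto simp: matching_def bij_betw_def inv_into_into f_inv_into_f)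

lemma matching_cnorm: "matching P Q \<sigma> \<Longrightarrow> cnorm P (\<lambda>F. v (\<sigma> F)) = cnorm Q v"
  unfolding cnorm_def flat_inner_def matching_def
  using sum.reindex_bij_betw[of \<sigma> "facets P" "facets Q" "\<lambda>F. v F \<bullet> v F"] by simp

text \<open>Identifies the maps onto the torus, so that relabelled angles represent the same torus
  element on both sides.\<close>

lemma matching_normal_map:
  assumes m: "matching P Q \<sigma>"
  shows "normal_map Q (\<lambda>G. \<theta> (inv_into (facets P) \<sigma> G)) = normal_map P \<theta>"
proof -
  have "normal_map Q (\<lambda>G. \<theta> (inv_into (facets P) \<sigma> G)) =
      (\<Sum>F\<in>facets P. \<theta> (inv_into (facets P) \<sigma> (\<sigma> F)) *\<^sub>R facet_normal Q (\<sigma> F))"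
    unfolding normal_map_def using m
    by (intro sum.reindex_bij_betw[of \<sigma> "facets P" "facets Q" "\<lambda>G. \<theta> (inv_into (facets P) \<sigma> G) *\<^sub>R facet_normal Q G", symmetric])
      (simp add: matching_def)
  also have "\<dots> = normal_map P \<theta>" unfolding normal_map_def
    using m matching_inv(2)[OF m] by (intro sum.cong) (auto simp: matching_def)
  finally show ?thesis .
qed

text \<open>The two orbits belong to different quotients and are compared in the flat space after
  relabelling coordinates. One pair of representatives suffices, since \<open>H\<close> acts on both
  sides by the same isometries.\<close>

definition orbits_close :: "(real ^ 'n) set \<Rightarrow> ((real ^ 'n) set \<Rightarrow> (real ^ 'n) set) \<Rightarrow> real \<Rightarrow> 'n cvec set \<Rightarrow> 'n cvec set \<Rightarrow> bool" where
  "orbits_close P \<sigma> \<kappa> X Y \<longleftrightarrow> (\<exists>z\<in>X. \<exists>w\<in>Y. cnorm P (\<lambda>F. z F - w (\<sigma> F)) \<le> \<kappa>)"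

lemma matching_rotate:
  assumes m: "matching P Q \<sigma>"
  shows "cnorm P (\<lambda>F. rotate_by \<theta> z F - rotate_by (\<lambda>G. \<theta> (inv_into (facets P) \<sigma> G)) w (\<sigma> F)) = cnorm P (\<lambda>F. z F - w (\<sigma> F))"
proof (rule cnorm_cong)
  fix F assume F: "F \<in> facets P"
  have "rotate_by \<theta> z F - rotate_by (\<lambda>G. \<theta> (inv_into (facets P) \<sigma> G)) w (\<sigma> F) = cis (2 * pi * \<theta> F) * (z F - w (\<sigma> F))"
    using matching_inv(2)[OF m F] by (simp add: rotate_by_cis algebra_simps)
  then show "cmod (rotate_by \<theta> z F - rotate_by (\<lambda>G. \<theta> (inv_into (facets P) \<sigma> G)) w (\<sigma> F)) = cmod (z F - w (\<sigma> F))"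
    by (simp add: norm_mult)
qed

text \<open>Rotating both representatives by the same element of \<open>H\<close> keeps their
  distance, so the first one can be prescribed.\<close>

lemma orbits_close_all:
  assumes m: "matching P Q \<sigma>" and X: "X \<in> toric_manifold P" and Y: "Y \<in> toric_manifold Q"
    and c: "orbits_close P \<sigma> \<kappa> X Y" and z: "z \<in> X"
  shows "\<exists>w\<in>Y. cnorm P (\<lambda>F. z F - w (\<sigma> F)) \<le> \<kappa>"
proof -
  obtain z0 w0 where z0: "z0 \<in> X" and w0: "w0 \<in> Y" and cn: "cnorm P (\<lambda>F. z0 F - w0 (\<sigma> F)) \<le> \<kappa>"
    using c unfolding orbits_close_def by blast
  have "X = H_orbit P z0" using toric_manifold_eq_orbit[OF X z0] by blast
  then obtain \<theta> where \<theta>: "normal_map P \<theta> \<in> int_lattice" "z = rotate_by \<theta> z0" using z unfolding H_orbit_def by blast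
  let ?\<phi> = "\<lambda>G. \<theta> (inv_into (facets P) \<sigma> G)"
  have "normal_map Q ?\<phi> \<in> int_lattice" using \<theta>(1) matching_normal_map[OF m] by metis
  then have "rotate_by ?\<phi> w0 \<in> H_orbit Q w0" unfolding H_orbit_def by blast
  then have "rotate_by ?\<phi> w0 \<in> Y" using toric_manifold_eq_orbit[OF Y w0] by blast
  moreover have "cnorm P (\<lambda>F. z F - rotate_by ?\<phi> w0 (\<sigma> F)) \<le> \<kappa>"
    unfolding \<theta>(2) matching_rotate[OF m] by (rule cn)
  ultimately show ?thesis by blast
qed

lemma orbits_close_inverse:
  assumes m: "matching P Q \<sigma>"
  shows "orbits_close Q (inv_into (facets P) \<sigma>) \<kappa> Y X \<longleftrightarrow> orbits_close P \<sigma> \<kappa> X Y"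
proof -
  have "cnorm Q (\<lambda>G. w G - z (inv_into (facets P) \<sigma> G)) = cnorm P (\<lambda>F. z F - w (\<sigma> F))" for z w
  proof -
    have "cnorm Q (\<lambda>G. w G - z (inv_into (facets P) \<sigma> G)) = cnorm P (\<lambda>F. w (\<sigma> F) - z (inv_into (facets P) \<sigma> (\<sigma> F)))"
      by (rule matching_cnorm[OF m, symmetric])
    also have "\<dots> = cnorm P (\<lambda>F. z F - w (\<sigma> F))"
      by (rule cnorm_cong) (simp add: matching_inv(2)[OF m] norm_minus_commute)
    finally show ?thesis .
  qed
  then show ?thesis unfolding orbits_close_def by (simp only:) blast
qed

text \<open>The same angles represent \<open>g\<close> on both sides, so closeness is preserved with
  the same \<open>\<kappa>\<close>. This is why the identity can serve as the group
  automorphism.\<close>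

lemma orbits_close_torus_action:
  assumes m: "matching P Q \<sigma>" and D: "delzant P" and g: "g \<in> carrier torus"
    and X: "X \<in> toric_manifold P" and Y: "Y \<in> toric_manifold Q" and c: "orbits_close P \<sigma> \<kappa> X Y"
  shows "orbits_close P \<sigma> \<kappa> (torus_action P g X) (torus_action Q g Y)"
proof -
  obtain z w where zw: "z \<in> X" "w \<in> Y" and cn: "cnorm P (\<lambda>F. z F - w (\<sigma> F)) \<le> \<kappa>"
    using c unfolding orbits_close_def by blast
  obtain \<theta> where \<theta>: "normal_map P \<theta> \<in> g" by (rule carrier_torus_angles[OF D g])
  let ?\<phi> = "\<lambda>G. \<theta> (inv_into (facets P) \<sigma> G)"
  have \<phi>: "normal_map Q ?\<phi> \<in> g" using \<theta> matching_normal_map[OF m] by metis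
  show ?thesis unfolding orbits_close_def torus_action_eq[OF X \<theta> g] torus_action_eq[OF Y \<phi> g]
    using zw cn matching_rotate[OF m] by (intro bexI[of _ "rotate_by \<theta> z"] bexI[of _ "rotate_by ?\<phi> w"]) auto
qed

text \<open>Two orbits close to a common one are close to each other. Hence an approximation map may
  be chosen arbitrarily among close orbits, and density of its image and equivariance
  follow.\<close>

lemma orbits_close_close_dist:
  assumes m: "matching P Q \<sigma>" and D: "delzant P" and loc: "loc_comparable P \<epsilon> r" and \<epsilon>: "0 \<le> \<epsilon>"
    and X: "X \<in> toric_manifold P" "X' \<in> toric_manifold P" and Y: "Y \<in> toric_manifold Q"
    and c: "orbits_close P \<sigma> \<kappa> X Y" "orbits_close P \<sigma> \<kappa> X' Y" and \<kappa>: "2 * \<kappa> \<le> r"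
  shows "guillemin_dist P X X' \<le> (1 + \<epsilon>) * (2 * \<kappa>)"
proof -
  obtain z w where z: "z \<in> X" "w \<in> Y" and cn: "cnorm P (\<lambda>F. z F - w (\<sigma> F)) \<le> \<kappa>"
    using c(1) unfolding orbits_close_def by blast
  have c': "orbits_close Q (inv_into (facets P) \<sigma>) \<kappa> Y X'" using c(2) by (simp only: orbits_close_inverse[OF m])
  obtain z' where z': "z' \<in> X'" "cnorm Q (\<lambda>G. w G - z' (inv_into (facets P) \<sigma> G)) \<le> \<kappa>"
    using orbits_close_all[OF matching_inverse[OF m] Y X(2) c' z(2)] by blast
  have "cnorm P (\<lambda>F. w (\<sigma> F) - z' (inv_into (facets P) \<sigma> (\<sigma> F))) \<le> \<kappa>"
    using z'(2) matching_cnorm[OF m, of "\<lambda>G. w G - z' (inv_into (facets P) \<sigma> G)"] by simp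
  then have "cnorm P (\<lambda>F. w (\<sigma> F) - z' F) \<le> \<kappa>"
    using cnorm_cong[of P "\<lambda>F. w (\<sigma> F) - z' (inv_into (facets P) \<sigma> (\<sigma> F))" "\<lambda>F. w (\<sigma> F) - z' F"]
    by (simp add: matching_inv(2)[OF m])
  then have zz: "cnorm P (\<lambda>F. z F - z' F) \<le> 2 * \<kappa>"
    using cnorm_diff_triangle[of P z z' "\<lambda>F. w (\<sigma> F)"] cn by linarith
  have L: "z \<in> level_set P" "z' \<in> level_set P" "X = H_orbit P z" "X' = H_orbit P z'"
    using toric_manifold_eq_orbit X z z' by blast+
  obtain L where "L \<le> (1 + \<epsilon>) * cnorm P (\<lambda>F. z F - z' F)" "chain P (H_orbit P z) (H_orbit P z') L"
    using loc L(1,2) zz \<kappa> unfolding loc_comparable_def by (meson order_trans)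
  moreover have "(1 + \<epsilon>) * cnorm P (\<lambda>F. z F - z' F) \<le> (1 + \<epsilon>) * (2 * \<kappa>)" using zz \<epsilon> by (intro mult_left_mono) auto
  ultimately show ?thesis using guillemin_dist_le[OF D] L(3,4) by fastforce
qed

text \<open>A curve of length \<open>L\<close> is cut into short pieces whose ends are moved to the other quotient, where
  they are joined again by the local comparison.\<close>

lemma guillemin_dist_compare:
  fixes P Q :: "(real ^ 'n) set"
  assumes m: "matching P Q \<sigma>" and D: "delzant P" "delzant Q" and loc: "loc_comparable Q \<epsilon> r" and \<epsilon>: "0 \<le> \<epsilon>" and \<kappa>: "0 \<le> \<kappa>"
    and total: "\<And>Z. Z \<in> toric_manifold P \<Longrightarrow> \<exists>Z'\<in>toric_manifold Q. orbits_close P \<sigma> \<kappa> Z Z'"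
    and ch: "chain P X Y L" and X': "X' \<in> toric_manifold Q" "orbits_close P \<sigma> \<kappa> X X'"
    and Y': "Y' \<in> toric_manifold Q" "orbits_close P \<sigma> \<kappa> Y Y'" and small: "L / real (Suc k) + 2 * \<kappa> \<le> r"
  shows "guillemin_dist Q X' Y' \<le> (1 + \<epsilon>) * (L + 2 * real (Suc k) * \<kappa>)"
proof -
  interpret Q: Metric_space "toric_manifold Q" "guillemin_dist Q" by (rule guillemin_Metric_space[OF D(2)])
  define s where "s = L / real (Suc k)"
  have s: "0 \<le> s" using chain_nonneg[OF ch] by (simp add: s_def)
  have "L = real (Suc k) * s" by (simp add: s_def del: of_nat_Suc)
  with ch chain_divide[OF D(1) s, of X Y k] obtain Xs where Xs: "Xs 0 = X" "Xs (Suc k) = Y"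
    "\<forall>j\<le>k. chain P (Xs j) (Xs (Suc j)) s" by metis
  have XsM: "Xs j \<in> toric_manifold P" if "j \<le> Suc k" for j
    using Xs chain_manifold[OF ch] chain_manifold[of P "Xs j" "Xs (Suc j)" s] that by (cases "j = Suc k") auto
  \<comment> \<open>The division points are moved to \<open>Q\<close> arbitrarily, but the two ends
    have to be the given \<open>X'\<close> and \<open>Y'\<close>.\<close>
  have "\<exists>Z. Z \<in> toric_manifold Q \<and> orbits_close P \<sigma> \<kappa> (Xs j) Z \<and> (j = 0 \<longrightarrow> Z = X') \<and> (j = Suc k \<longrightarrow> Z = Y')"
    if "j \<le> Suc k" for j
    using total[OF XsM[OF that]] X' Y' Xs(1,2) by (cases "j = 0"; cases "j = Suc k") auto
  then obtain Zs where Zs: "\<And>j. j \<le> Suc k \<Longrightarrow> Zs j \<in> toric_manifold Q \<and> orbits_close P \<sigma> \<kappa> (Xs j) (Zs j) \<and>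
      (j = 0 \<longrightarrow> Zs j = X') \<and> (j = Suc k \<longrightarrow> Zs j = Y')" by metis
  \<comment> \<open>Along \<open>w\<close>, \<open>z\<close>, \<open>z'\<close>, \<open>w'\<close>:
    a move of at most \<open>\<kappa>\<close>, a lift of the piece, and another move of at most
    \<open>\<kappa>\<close>.\<close>
  have step: "guillemin_dist Q (Zs j) (Zs (Suc j)) \<le> (1 + \<epsilon>) * (s + 2 * \<kappa>)" if j: "j \<le> k" for j
  proof -
    have Zj: "Zs j \<in> toric_manifold Q" "orbits_close P \<sigma> \<kappa> (Xs j) (Zs j)"
      "Zs (Suc j) \<in> toric_manifold Q" "orbits_close P \<sigma> \<kappa> (Xs (Suc j)) (Zs (Suc j))" using Zs[of j] Zs[of "Suc j"] j by auto
    obtain z w where z: "z \<in> Xs j" "w \<in> Zs j" "cnorm P (\<lambda>F. z F - w (\<sigma> F)) \<le> \<kappa>"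
      using Zj(2) unfolding orbits_close_def by blast
    obtain z' where z': "z' \<in> Xs (Suc j)" "cnorm P (\<lambda>F. z F - z' F) \<le> s"
      using chain_lift[OF D(1) Xs(3)[rule_format, OF j] z(1)] by blast
    obtain w' where w': "w' \<in> Zs (Suc j)" "cnorm P (\<lambda>F. z' F - w' (\<sigma> F)) \<le> \<kappa>"
      using orbits_close_all[OF m XsM Zj(3,4) z'(1)] j by auto
    have "cnorm P (\<lambda>F. w (\<sigma> F) - w' (\<sigma> F)) \<le> cnorm P (\<lambda>F. w (\<sigma> F) - z F) + cnorm P (\<lambda>F. z F - w' (\<sigma> F))"
      by (rule cnorm_diff_triangle)
    also have "\<dots> \<le> cnorm P (\<lambda>F. z F - w (\<sigma> F)) + (cnorm P (\<lambda>F. z F - z' F) + cnorm P (\<lambda>F. z' F - w' (\<sigma> F)))"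
      using cnorm_diff_triangle[of P z "\<lambda>F. w' (\<sigma> F)" z'] cnorm_minus_commute[of P z "\<lambda>F. w (\<sigma> F)"] by simp
    also have "\<dots> \<le> s + 2 * \<kappa>" using z(3) z'(2) w'(2) by simp
    finally have ww: "cnorm Q (\<lambda>G. w G - w' G) \<le> s + 2 * \<kappa>"
      using matching_cnorm[OF m, of "\<lambda>G. w G - w' G"] by simp
    have L: "w \<in> level_set Q" "w' \<in> level_set Q" "Zs j = H_orbit Q w" "Zs (Suc j) = H_orbit Q w'"
      using toric_manifold_eq_orbit Zj z(2) w'(1) by blast+
    have "cnorm Q (\<lambda>G. w G - w' G) \<le> r" using ww small by (simp add: s_def)
    then obtain L' where "L' \<le> (1 + \<epsilon>) * cnorm Q (\<lambda>G. w G - w' G)" "chain Q (H_orbit Q w) (H_orbit Q w') L'"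
      using loc L(1,2) unfolding loc_comparable_def by blast
    moreover have "(1 + \<epsilon>) * cnorm Q (\<lambda>G. w G - w' G) \<le> (1 + \<epsilon>) * (s + 2 * \<kappa>)"
      using ww \<epsilon> by (intro mult_left_mono) auto
    ultimately show ?thesis using guillemin_dist_le[OF D(2)] L(3,4) by fastforce
  qed
  have "guillemin_dist Q (Zs 0) (Zs j) \<le> real j * ((1 + \<epsilon>) * (s + 2 * \<kappa>))" if "j \<le> Suc k" for j
    using that
  proof (induction j)
    case 0
    then show ?case using Zs[of 0] Q.zero[of X' X'] X'(1) by simp
  next
    case (Suc j)
    have "guillemin_dist Q (Zs 0) (Zs (Suc j)) \<le> guillemin_dist Q (Zs 0) (Zs j) + guillemin_dist Q (Zs j) (Zs (Suc j))"
      by (rule Q.triangle) (use Zs Suc.prems in auto)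
    then show ?case using Suc.IH step[of j] Suc.prems by (simp add: algebra_simps)
  qed
  from this[of "Suc k"] have "guillemin_dist Q X' Y' \<le> real (Suc k) * ((1 + \<epsilon>) * (s + 2 * \<kappa>))"
    using Zs[of 0] Zs[of "Suc k"] by simp
  also have "\<dots> = (1 + \<epsilon>) * (real (Suc k) * s + 2 * real (Suc k) * \<kappa>)" by (simp only: algebra_simps)
  also have "real (Suc k) * s = L" by (simp add: s_def del: of_nat_Suc)
  finally show ?thesis .
qed

section \<open>From Hausdorff closeness of polytopes to closeness of orbits and charts\<close>

lemma hausdorff_dist_commute: "hausdorff_dist A B = hausdorff_dist B A"
  by (simp add: hausdorff_dist_def max.commute)

text \<open>One half of the bound is for moving the point, the other for the difference of offsets.
  A point of \<open>F\<close> has a neighbour in \<open>Q\<close>, which bounds the offset of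
  \<open>Q\<close> from above; the inverse matching gives the other direction.\<close>

lemma facet_form_matching:
  fixes P Q :: "(real ^ 'n) set"
  assumes m: "matching P Q \<sigma>" and D: "delzant P" "delzant Q" and h: "hausdorff_dist Q P < \<eta>"
    and F: "F \<in> facets P" and xy: "dist x y < \<eta>"
  shows "\<bar>facet_form P F x - facet_form Q (\<sigma> F) y\<bar> \<le> 2 * (norm (facet_normal P F) * \<eta>)"
proof -
  have off: "facet_offset Q (\<sigma> F) - facet_offset P F \<le> norm (facet_normal P F) * \<eta>"
    if m: "matching P Q \<sigma>" and D: "delzant P" "delzant Q" and h: "hausdorff_dist Q P < \<eta>" and F: "F \<in> facets P"
    for P Q :: "(real ^ 'n) set" and \<sigma> F
  proof -
    obtain p where "p \<in> F" using F by (auto simp: facets_def facet_of_def)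
    then have p: "p \<in> P" "facet_form P F p = 0" using delzant_facet(3)[OF D(1) F] by blast+
    obtain q where q: "q \<in> Q" "dist p q < \<eta>" using delzant_near(2)[OF D(2,1) h p(1)] by blast
    have "0 \<le> facet_form Q (\<sigma> F) q" using delzant_facet(2)[OF D(2) matching_inv(1)[OF m F] q(1)] .
    then have "facet_offset Q (\<sigma> F) \<le> q \<bullet> facet_normal P F" using m F by (simp add: facet_form_def matching_def)
    moreover have "facet_offset P F = p \<bullet> facet_normal P F" using p(2) by (simp add: facet_form_def)
    moreover have "(q - p) \<bullet> facet_normal P F \<le> norm (q - p) * norm (facet_normal P F)" by (rule norm_cauchy_schwarz)
    moreover have "norm (q - p) * norm (facet_normal P F) \<le> \<eta> * norm (facet_normal P F)"
      using q(2) by (intro mult_right_mono) (auto simp: dist_norm norm_minus_commute)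
    ultimately show ?thesis by (simp add: inner_diff_left mult.commute)
  qed
  have 1: "facet_offset Q (\<sigma> F) - facet_offset P F \<le> norm (facet_normal P F) * \<eta>" by (rule off[OF m D h F])
  have "facet_offset P (inv_into (facets P) \<sigma> (\<sigma> F)) - facet_offset Q (\<sigma> F) \<le> norm (facet_normal Q (\<sigma> F)) * \<eta>"
    by (rule off[OF matching_inverse[OF m] D(2,1)]) (use h matching_inv(1)[OF m F] hausdorff_dist_commute[of P Q] in auto)
  then have 2: "facet_offset P F - facet_offset Q (\<sigma> F) \<le> norm (facet_normal P F) * \<eta>"
    using m F matching_inv(2)[OF m F] by (simp add: matching_def)
  have "\<bar>(x - y) \<bullet> facet_normal P F\<bar> \<le> norm (x - y) * norm (facet_normal P F)" by (rule Cauchy_Schwarz_ineq2)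
  also have "\<dots> \<le> \<eta> * norm (facet_normal P F)" using xy by (intro mult_right_mono) (auto simp: dist_norm)
  finally have "\<bar>(x - y) \<bullet> facet_normal P F\<bar> \<le> norm (facet_normal P F) * \<eta>" by (simp add: mult.commute)
  moreover have "facet_form P F x - facet_form Q (\<sigma> F) y
      = (x - y) \<bullet> facet_normal P F + (facet_offset Q (\<sigma> F) - facet_offset P F)"
    using m F by (simp add: facet_form_def matching_def inner_diff_left)
  ultimately show ?thesis using 1 2 by linarith
qed

text \<open>Moduli are square roots of facet forms, which vanish on the boundary; so closeness of
  level sets is only of the order of the square root of the Hausdorff distance.\<close>

lemma abs_sqrt_diff_le:
  assumes "0 \<le> a" "0 \<le> b"
  shows "\<bar>sqrt a - sqrt b\<bar> \<le> sqrt \<bar>a - b\<bar>"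
proof -
  have *: "sqrt a - sqrt b \<le> sqrt (a - b)" if "b \<le> a" "0 \<le> b" for a b :: real
    using sqrt_add_le_add_sqrt[of b "a - b"] that by simp
  show ?thesis using *[of a b] *[of b a] assms by (cases "b \<le> a") (auto simp: abs_if)
qed

text \<open>The partner of \<open>z\<close> keeps its arguments and takes the moduli belonging to a
  nearby base point in \<open>Q\<close>.\<close>

lemma orbits_close_total:
  fixes P Q :: "(real ^ 'n) set"
  assumes m: "matching P Q \<sigma>" and D: "delzant P" "delzant Q" and h: "hausdorff_dist Q P < \<eta>"
    and B: "\<And>F. F \<in> facets P \<Longrightarrow> norm (facet_normal P F) \<le> B" and \<eta>: "0 \<le> \<eta>"
    and Z: "Z \<in> toric_manifold P"
  shows "\<exists>Z'\<in>toric_manifold Q. orbits_close P \<sigma> (real (card (facets P)) * sqrt (2 * (B * \<eta>))) Z Z'"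
proof -
  obtain z where z: "z \<in> level_set P" "Z = H_orbit P z" using Z by (auto simp: toric_manifold_def)
  obtain x where x: "x \<in> P" "\<forall>F\<in>facets P. (cmod (z F))\<^sup>2 = facet_form P F x" using level_set_point[OF D(1) z(1)] .
  obtain y where y: "y \<in> Q" "dist x y < \<eta>" using delzant_near(2)[OF D(2,1) h x(1)] by blast
  define w :: "'n cvec" where "w G = (if G \<in> facets Q then of_real (sqrt (facet_form Q G y)) * cis (Arg (z (inv_into (facets P) \<sigma> G))) else 0)" for G
  have pos: "0 \<le> facet_form Q G y" if "G \<in> facets Q" for G using delzant_facet(2)[OF D(2) that y(1)] .
  have w: "w \<in> level_set Q" unfolding level_set_def
    by (auto simp: w_def norm_mult pos intro!: exI[of _ y])
  have bound: "cmod (z F - w (\<sigma> F)) \<le> sqrt (2 * (B * \<eta>))" if F: "F \<in> facets P" for F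
  proof -
    have \<sigma>F: "\<sigma> F \<in> facets Q" by (rule matching_inv(1)[OF m F])
    have zF: "z F = of_real (cmod (z F)) * cis (Arg (z F))" by (metis rcis_cmod_Arg rcis_def)
    have cz: "cmod (z F) = sqrt (facet_form P F x)" using x(2) F by (metis norm_ge_zero real_sqrt_unique)
    have "z F - w (\<sigma> F) = of_real (sqrt (facet_form P F x) - sqrt (facet_form Q (\<sigma> F) y)) * cis (Arg (z F))"
      by (subst zF) (simp add: w_def \<sigma>F matching_inv(2)[OF m F] cz algebra_simps)
    then have "cmod (z F - w (\<sigma> F)) = \<bar>sqrt (facet_form P F x) - sqrt (facet_form Q (\<sigma> F) y)\<bar>"
      by (simp only: norm_mult norm_of_real norm_cis mult_1_right)
    also have "\<dots> \<le> sqrt \<bar>facet_form P F x - facet_form Q (\<sigma> F) y\<bar>"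
      by (rule abs_sqrt_diff_le) (use delzant_facet(2)[OF D(1) F x(1)] pos[OF \<sigma>F] in auto)
    also have "\<dots> \<le> sqrt (2 * (norm (facet_normal P F) * \<eta>))"
      using facet_form_matching[OF m D h F y(2)] by simp
    also have "\<dots> \<le> sqrt (2 * (B * \<eta>))" using B[OF F] \<eta> by (simp add: mult_right_mono)
    finally show ?thesis .
  qed
  have "L2_set (\<lambda>F. cmod (z F - w (\<sigma> F))) (facets P) \<le> (\<Sum>F\<in>facets P. cmod (z F - w (\<sigma> F)))"
    by (rule L2_set_le_sum) simp
  also have "\<dots> \<le> real (card (facets P)) * sqrt (2 * (B * \<eta>))" by (rule sum_bounded_above) (rule bound)
  finally have 1: "L2_set (\<lambda>F. cmod (z F - w (\<sigma> F))) (facets P) \<le> real (card (facets P)) * sqrt (2 * (B * \<eta>))" .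
  \<comment> \<open>Lets the normalisation of the metric be dropped from the bound.\<close>
  have "1 \<le> sqrt pi" using pi_ge_two by simp
  then have "L2_set (\<lambda>F. cmod (z F - w (\<sigma> F))) (facets P) / sqrt pi \<le> L2_set (\<lambda>F. cmod (z F - w (\<sigma> F))) (facets P) / 1"
    by (intro divide_left_mono) auto
  then have "cnorm P (\<lambda>F. z F - w (\<sigma> F)) \<le> real (card (facets P)) * sqrt (2 * (B * \<eta>))"
    using 1 by (simp add: cnorm_L2)
  then have "orbits_close P \<sigma> (real (card (facets P)) * sqrt (2 * (B * \<eta>))) Z (H_orbit Q w)"
    unfolding orbits_close_def z(2) using H_orbit_self by blast
  moreover have "H_orbit Q w \<in> toric_manifold Q" using w by (simp add: toric_manifold_def)
  ultimately show ?thesis by blast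
qed

text \<open>A chart involves only the normals and carries over by relabelling. The facet forms
  change by at most \<open>2 * (B * \<eta>)\<close>, which costs half of the constant
  \<open>c\<close>.\<close>

lemma chart_cover_matching:
  fixes P Q :: "(real ^ 'n) set"
  assumes m: "matching P Q \<sigma>" and D: "delzant P" "delzant Q" and h: "hausdorff_dist Q P < \<eta>"
    and B: "\<And>F. F \<in> facets P \<Longrightarrow> norm (facet_normal P F) \<le> B" and \<eta>: "0 \<le> \<eta>" "2 * (B * \<eta>) \<le> c / 2"
    and cov: "chart_cover P c M"
  shows "chart_cover Q (c / 2) M"
  unfolding chart_cover_def
proof
  fix y assume "y \<in> Q"
  then obtain x where x: "x \<in> P" "dist y x < \<eta>" using delzant_near(1)[OF D(2,1) h] by blast
  obtain A u where ch: "chart P A u" and far: "\<forall>F\<in>facets P - A. c \<le> facet_form P F x"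
    and uM: "\<forall>G\<in>A. norm (u G) \<le> M" and uM2: "\<forall>F\<in>facets P. \<forall>G\<in>A. \<bar>facet_normal P F \<bullet> u G\<bar> \<le> M"
    using cov x(1) unfolding chart_cover_def by blast
  let ?i = "inv_into (facets P) \<sigma>"
  have A: "A \<subseteq> facets P" using ch by (simp add: chart_def)
  have inj: "inj_on \<sigma> A" using m A by (auto simp: matching_def bij_betw_def intro: inj_on_subset)
  have i: "?i (\<sigma> F) = F" "facet_normal Q (\<sigma> F) = facet_normal P F" "\<sigma> F \<in> facets Q" if "F \<in> A" for F
    using that A m matching_inv[OF m] by (auto simp: matching_def)
  have normal: "facet_normal Q G = facet_normal P (?i G)" if "G \<in> facets Q" for G
    using matching_inverse[OF m] that by (simp add: matching_def)
  show "\<exists>A u. chart Q A u \<and> (\<forall>F\<in>facets Q - A. c / 2 \<le> facet_form Q F y) \<and>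
     (\<forall>G\<in>A. norm (u G) \<le> M) \<and> (\<forall>F\<in>facets Q. \<forall>G\<in>A. \<bar>facet_normal Q F \<bullet> u G\<bar> \<le> M)"
  proof (intro exI[of _ "\<sigma> ` A"] exI[of _ "\<lambda>G. u (?i G)"] conjI)
    show "chart Q (\<sigma> ` A) (\<lambda>G. u (?i G))" unfolding chart_def
    proof (intro conjI allI)
      show "\<sigma> ` A \<subseteq> facets Q" using i by auto
      show "card (\<sigma> ` A) = CARD('n)" using ch by (simp add: card_image[OF inj] chart_def)
      show "\<forall>F\<in>\<sigma> ` A. u (?i F) \<in> int_lattice" using ch i by (auto simp: chart_def)
      show "\<forall>F\<in>\<sigma> ` A. \<forall>G\<in>\<sigma> ` A. facet_normal Q F \<bullet> u (?i G) = (if F = G then 1 else 0)"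
      proof (intro ballI)
        fix F' G' assume "F' \<in> \<sigma> ` A" "G' \<in> \<sigma> ` A"
        then obtain F G where FG: "F \<in> A" "G \<in> A" "F' = \<sigma> F" "G' = \<sigma> G" by blast
        have "facet_normal P F \<bullet> u G = (if F = G then 1 else 0)" using ch FG unfolding chart_def by blast
        then show "facet_normal Q F' \<bullet> u (?i G') = (if F' = G' then 1 else 0)"
          using FG by (simp add: i inj_on_eq_iff[OF inj])
      qed
      show "a = (\<Sum>F\<in>\<sigma> ` A. (a \<bullet> u (?i F)) *\<^sub>R facet_normal Q F)" for a
      proof -
        have "(\<Sum>F\<in>\<sigma> ` A. (a \<bullet> u (?i F)) *\<^sub>R facet_normal Q F) = (\<Sum>F\<in>A. (a \<bullet> u F) *\<^sub>R facet_normal P F)"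
          unfolding sum.reindex[OF inj] by (rule sum.cong) (auto simp: i)
        then show ?thesis using ch unfolding chart_def by metis
      qed
      show "a = (\<Sum>F\<in>\<sigma> ` A. (a \<bullet> facet_normal Q F) *\<^sub>R u (?i F))" for a
      proof -
        have "(\<Sum>F\<in>\<sigma> ` A. (a \<bullet> facet_normal Q F) *\<^sub>R u (?i F)) = (\<Sum>F\<in>A. (a \<bullet> facet_normal P F) *\<^sub>R u F)"
          unfolding sum.reindex[OF inj] by (rule sum.cong) (auto simp: i)
        then show ?thesis using ch unfolding chart_def by metis
      qed
    qed
    show "\<forall>F\<in>facets Q - \<sigma> ` A. c / 2 \<le> facet_form Q F y"
    proof
      fix G assume G: "G \<in> facets Q - \<sigma> ` A"
      define F where "F = ?i G"
      have F: "F \<in> facets P" "\<sigma> F = G" using matching_inv[OF m] G by (auto simp: F_def)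
      then have "F \<notin> A" using G by blast
      have "\<bar>facet_form P F x - facet_form Q (\<sigma> F) y\<bar> \<le> 2 * (norm (facet_normal P F) * \<eta>)"
        by (rule facet_form_matching[OF m D h F(1)]) (use x(2) in \<open>simp add: dist_commute\<close>)
      moreover have "norm (facet_normal P F) * \<eta> \<le> B * \<eta>" using B[OF F(1)] \<eta>(1) by (rule mult_right_mono)
      moreover have "c \<le> facet_form P F x" using far F \<open>F \<notin> A\<close> by blast
      ultimately show "c / 2 \<le> facet_form Q G y" using \<eta>(2) F(2) by auto
    qed
    show "\<forall>G\<in>\<sigma> ` A. norm (u (?i G)) \<le> M" using uM i by auto
    show "\<forall>F\<in>facets Q. \<forall>G\<in>\<sigma> ` A. \<bar>facet_normal Q F \<bullet> u (?i G)\<bar> \<le> M"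
      using uM2 i normal matching_inv(3)[OF m] by auto
  qed
qed

lemma chart_cover_mono: "chart_cover P c M \<Longrightarrow> c' \<le> c \<Longrightarrow> chart_cover P c' M"
  unfolding chart_cover_def by (meson order_trans)

section \<open>Convergence\<close>

lemma orbits_close_mono: "orbits_close P \<sigma> \<kappa> X Y \<Longrightarrow> \<kappa> \<le> \<kappa>' \<Longrightarrow> orbits_close P \<sigma> \<kappa>' X Y"
  unfolding orbits_close_def by (meson order_trans)

lemma guillemin_dist_bounded:
  assumes D: "delzant P"
  obtains K where "0 \<le> K" "\<forall>X\<in>toric_manifold P. \<forall>Y\<in>toric_manifold P. guillemin_dist P X Y \<le> K"
proof -
  interpret M: Metric_space "toric_manifold P" "guillemin_dist P" by (rule guillemin_Metric_space[OF D])
  have "compactin M.mtopology (toric_manifold P)" using guillemin_compact[OF D] by (simp add: compact_space_def)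
  then have "M.mbounded (toric_manifold P)" by (rule M.compactin_imp_mbounded)
  then obtain K where K: "\<forall>X\<in>toric_manifold P. \<forall>Y\<in>toric_manifold P. guillemin_dist P X Y \<le> K"
    unfolding M.mbounded_alt by blast
  show thesis by (rule that[of "max K 0"]) (use K in \<open>auto simp: le_max_iff_disj\<close>)
qed

lemma toric_manifold_nonempty: "delzant P \<Longrightarrow> toric_manifold P \<noteq> {}"
proof -
  assume D: "delzant P"
  obtain x where x: "x \<in> interior P" "\<forall>F\<in>facets P. 0 < facet_form P F x" using delzant_interior_point[OF D] .
  have "(\<lambda>F. if F \<in> facets P then of_real (sqrt (facet_form P F x)) else 0) \<in> level_set P"
    using x(2) by (auto simp: level_set_def less_imp_le intro!: exI[of _ x])
  then show ?thesis by (auto simp: toric_manifold_def)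
qed

text \<open>The conditions on one approximation map for a fixed error, with the identity as
  automorphism of the torus.\<close>

definition GH_approximation ::
    "(real ^ 'n) set \<Rightarrow> (real ^ 'n) set \<Rightarrow> real \<Rightarrow> ('n cvec set \<Rightarrow> 'n cvec set) \<Rightarrow> bool" where
  "GH_approximation P Q \<epsilon> f \<longleftrightarrow> f \<in> toric_manifold Q \<rightarrow> toric_manifold P \<and>
     (\<forall>X\<in>toric_manifold Q. \<forall>Y\<in>toric_manifold Q. \<bar>guillemin_dist Q X Y - guillemin_dist P (f X) (f Y)\<bar> < \<epsilon>) \<and>
     (\<forall>p\<in>toric_manifold P. \<exists>X\<in>toric_manifold Q. guillemin_dist P p (f X) < \<epsilon>) \<and>
     (\<forall>X\<in>toric_manifold Q. \<forall>g\<in>carrier torus.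
        guillemin_dist P (f (torus_action Q g X)) (torus_action P g (f X)) < \<epsilon>)"

text \<open>Three errors of at most \<open>e / 16\<close> each: the slack in choosing a chain, the
  relative error \<open>\<omega>\<close> on a length up to \<open>K\<close>, and the moved ends of
  \<open>Suc k\<close> pieces. The bound \<open>K - 1\<close> on the distance leaves room for the
  slack. The roles of the two polytopes can be exchanged.\<close>

lemma guillemin_dist_estimate:
  fixes P Q :: "(real ^ 'n) set"
  assumes m: "matching P Q \<sigma>" and D: "delzant P" "delzant Q" and loc: "loc_comparable Q \<omega> r" and \<omega>: "0 \<le> \<omega>" "\<omega> \<le> 1"
    and \<kappa>: "0 \<le> \<kappa>" "2 * \<kappa> \<le> r / 2" "4 * real (Suc k) * \<kappa> \<le> e / 16"
    and K: "0 \<le> K" "\<omega> * K \<le> e / 16" "K / real (Suc k) \<le> r / 2" and e: "0 < e" "e \<le> 1"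
    and total: "\<And>Z. Z \<in> toric_manifold P \<Longrightarrow> \<exists>Z'\<in>toric_manifold Q. orbits_close P \<sigma> \<kappa> Z Z'"
    and X: "X \<in> toric_manifold P" and Y: "Y \<in> toric_manifold P" and XY: "guillemin_dist P X Y \<le> K - 1"
    and X': "X' \<in> toric_manifold Q" "orbits_close P \<sigma> \<kappa> X X'" and Y': "Y' \<in> toric_manifold Q" "orbits_close P \<sigma> \<kappa> Y Y'"
  shows "guillemin_dist Q X' Y' \<le> guillemin_dist P X Y + e / 4"
proof -
  obtain L where L: "L < guillemin_dist P X Y + e / 16" "chain P X Y L"
    using guillemin_dist_less[OF D(1) X Y, of "guillemin_dist P X Y + e / 16"] e by auto
  have LK: "L \<le> K" using L(1) XY e by linarith
  have "L / real (Suc k) \<le> K / real (Suc k)" using LK by (rule divide_right_mono) simp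
  then have "L / real (Suc k) + 2 * \<kappa> \<le> r" using \<kappa>(2) K(3) by linarith
  from guillemin_dist_compare[OF m D loc \<omega>(1) \<kappa>(1) total L(2) X' Y' this]
  have "guillemin_dist Q X' Y' \<le> (1 + \<omega>) * (L + 2 * real (Suc k) * \<kappa>)" .
  also have "\<dots> = L + \<omega> * L + (1 + \<omega>) * (2 * real (Suc k) * \<kappa>)" by (simp only: algebra_simps)
  also have "\<dots> \<le> L + \<omega> * K + 2 * (2 * real (Suc k) * \<kappa>)"
    using LK \<omega> \<kappa>(1) by (intro add_mono mult_left_mono mult_right_mono) auto
  also have "\<dots> \<le> guillemin_dist P X Y + e / 4" using L(1) K(2) \<kappa>(3) e by linarith
  finally show ?thesis .
qed

text \<open>The constants depend on each other in the order \<open>K\<close>,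
  \<open>\<omega>\<close>, \<open>r\<close>, \<open>k\<close>, \<open>\<kappa>\<close>,
  \<open>\<eta>\<close>. In particular the number of pieces is known before the orbits are required
  to be close, so the total cost of moving the ends can be made small.\<close>

lemma GH_approximation_exists:
  fixes P :: "(real ^ 'n) set"
  assumes D: "delzant P" and e0: "0 < \<epsilon>"
  shows "\<exists>\<eta>>0. \<forall>Q. delzant Q \<longrightarrow> hausdorff_dist Q P < \<eta> \<longrightarrow> card (facets Q) = card (facets P) \<longrightarrow>
    (\<exists>f. GH_approximation P Q \<epsilon> f)"
proof -
  have fin: "finite (facets P)" using D by simp
  define e where "e = min \<epsilon> 1"
  have e: "0 < e" "e \<le> 1" "e \<le> \<epsilon>" using e0 by (auto simp: e_def)
  obtain K0 where K0: "0 \<le> K0" "\<forall>X\<in>toric_manifold P. \<forall>Y\<in>toric_manifold P. guillemin_dist P X Y \<le> K0"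
    using guillemin_dist_bounded[OF D] .
  \<comment> \<open>One unit is the room required by \<open>guillemin_dist_estimate\<close>; the
    other covers the excess of distances on \<open>Q\<close> over those on \<open>P\<close>.\<close>
  define K where "K = K0 + 2"
  have K: "0 < K" using K0 by (simp add: K_def)
  obtain c M where c: "c > 0" and M: "M \<ge> 1" and cov: "chart_cover P c M" using chart_cover_exists[OF D] .
  define B where "B = 1 + (\<Sum>F\<in>facets P. norm (facet_normal P F))"
  have B0: "0 < B" by (simp add: B_def sum_nonneg add_pos_nonneg)
  have B: "norm (facet_normal P F) \<le> B" if "F \<in> facets P" for F
  proof -
    have "norm (facet_normal P F) \<le> (\<Sum>F\<in>facets P. norm (facet_normal P F))"
      by (rule member_le_sum) (use that fin in auto)
    then show ?thesis by (simp add: B_def)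
  qed
  define N where "N = card (facets P)"
  define \<omega> where "\<omega> = min 1 (e / (16 * K))"
  have \<omega>: "0 < \<omega>" "\<omega> \<le> 1" "\<omega> * K \<le> e / 16"
  proof -
    show "0 < \<omega>" "\<omega> \<le> 1" using e K by (auto simp: \<omega>_def)
    have "\<omega> * K \<le> e / (16 * K) * K" using K by (intro mult_right_mono) (auto simp: \<omega>_def)
    then show "\<omega> * K \<le> e / 16" using K by simp
  qed
  obtain r where r: "r > 0" and loc: "\<forall>Q :: (real ^ 'n) set. delzant Q \<longrightarrow> card (facets Q) = N \<longrightarrow> chart_cover Q (c / 2) M \<longrightarrow> loc_comparable Q \<omega> r"
    using loc_comparable_if_chart_cover[of "c / 2" M \<omega> N] c M \<omega>(1) by auto
  obtain k where k0: "2 * K / r < real k" using reals_Archimedean2 by blast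
  have k: "K / real (Suc k) \<le> r / 2"
  proof -
    have "2 * K \<le> real (Suc k) * r" using k0 r by (simp add: divide_less_eq algebra_simps)
    then show ?thesis by (simp add: divide_le_eq del: of_nat_Suc) (simp add: mult.commute)
  qed
  define \<kappa> where "\<kappa> = min (r / 4) (e / (64 * real (Suc k)))"
  have \<kappa>: "0 < \<kappa>" "2 * \<kappa> \<le> r / 2" "4 * real (Suc k) * \<kappa> \<le> e / 16"
  proof -
    show "0 < \<kappa>" "2 * \<kappa> \<le> r / 2" using r e by (auto simp: \<kappa>_def)
    have "4 * real (Suc k) * \<kappa> \<le> 4 * real (Suc k) * (e / (64 * real (Suc k)))"
      by (intro mult_left_mono) (auto simp: \<kappa>_def)
    also have "\<dots> = e / 16" by (simp del: of_nat_Suc)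
    finally show "4 * real (Suc k) * \<kappa> \<le> e / 16" .
  qed
  have \<kappa>4: "4 * \<kappa> \<le> e / 16"
  proof -
    have "4 * \<kappa> * 1 \<le> 4 * \<kappa> * real (Suc k)" using \<kappa>(1) by (intro mult_left_mono) auto
    also have "\<dots> = 4 * real (Suc k) * \<kappa>" by (simp only: mult_ac)
    finally show ?thesis using \<kappa>(3) by simp
  qed
  obtain \<eta>0 where \<eta>0: "\<eta>0 > 0" "\<forall>Q. delzant Q \<longrightarrow> hausdorff_dist Q P < \<eta>0 \<longrightarrow> card (facets Q) = card (facets P) \<longrightarrow>
    (\<exists>\<sigma>. bij_betw \<sigma> (facets P) (facets Q) \<and> (\<forall>F\<in>facets P. facet_normal Q (\<sigma> F) = facet_normal P F))"
    using facet_normals_stable[OF D] by blast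
  \<comment> \<open>The entries ensure equal normals, a chart cover of \<open>Q\<close> with
    constant \<open>c / 2\<close>, and partner orbits within \<open>\<kappa>\<close>.\<close>
  define \<eta> where "\<eta> = Min {\<eta>0, c / (4 * B), (\<kappa> / (real N + 1))\<^sup>2 / (2 * B)}"
  have \<eta>: "0 < \<eta>" using \<eta>0(1) c B0 \<kappa>(1) by (simp add: \<eta>_def)
  have \<eta>': "\<eta> \<le> \<eta>0" "\<eta> \<le> c / (4 * B)" "\<eta> \<le> (\<kappa> / (real N + 1))\<^sup>2 / (2 * B)"
    unfolding \<eta>_def by (rule Min_le; simp)+
  have \<eta>c: "2 * (B * \<eta>) \<le> c / 2"
  proof -
    have "2 * B * \<eta> \<le> 2 * B * (c / (4 * B))" using \<eta>'(2) B0 by (intro mult_left_mono) auto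
    then show ?thesis using B0 by simp
  qed
  have \<eta>\<kappa>: "real N * sqrt (2 * (B * \<eta>)) \<le> \<kappa>"
  proof -
    have "2 * B * \<eta> \<le> 2 * B * ((\<kappa> / (real N + 1))\<^sup>2 / (2 * B))" using \<eta>'(3) B0 by (intro mult_left_mono) auto
    then have "2 * (B * \<eta>) \<le> (\<kappa> / (real N + 1))\<^sup>2" using B0 by simp
    then have "sqrt (2 * (B * \<eta>)) \<le> \<kappa> / (real N + 1)" using \<kappa>(1) by (intro real_le_lsqrt) auto
    then have "(real N + 1) * sqrt (2 * (B * \<eta>)) \<le> (real N + 1) * (\<kappa> / (real N + 1))" by (intro mult_left_mono) auto
    moreover have "(real N + 1) * (\<kappa> / (real N + 1)) = \<kappa>" by (simp add: add_pos_nonneg)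
    moreover have "real N * sqrt (2 * (B * \<eta>)) \<le> (real N + 1) * sqrt (2 * (B * \<eta>))"
      using B0 \<eta> by (intro mult_right_mono) auto
    ultimately show ?thesis by linarith
  qed
  show ?thesis
  proof (intro exI[of _ \<eta>] conjI allI impI)
    show "0 < \<eta>" by (fact \<eta>)
    fix Q :: "(real ^ 'n) set" assume Q: "delzant Q" and h: "hausdorff_dist Q P < \<eta>" and card: "card (facets Q) = card (facets P)"
    have h': "hausdorff_dist P Q < \<eta>" using h by (simp add: hausdorff_dist_commute)
    obtain \<sigma> where m: "matching P Q \<sigma>" using \<eta>0(2) Q h \<eta>'(1) card unfolding matching_def by force
    let ?i = "inv_into (facets P) \<sigma>"
    note mi = matching_inverse[OF m]
    have BQ: "norm (facet_normal Q G) \<le> B" if "G \<in> facets Q" for G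
    proof -
      have "facet_normal Q G = facet_normal P (?i G)" "?i G \<in> facets P"
        using mi matching_inv(3)[OF m] that by (auto simp: matching_def)
      then show ?thesis using B by simp
    qed
    have locP: "loc_comparable P \<omega> r" using loc D chart_cover_mono[OF cov, of "c / 2"] c by (simp add: N_def)
    have "chart_cover Q (c / 2) M" by (rule chart_cover_matching[OF m D Q h B _ \<eta>c cov]) (use \<eta> in auto)
    then have locQ: "loc_comparable Q \<omega> r" using loc Q card by (simp add: N_def)
    have total: "\<exists>Z'\<in>toric_manifold Q. orbits_close P \<sigma> \<kappa> Z Z'" if Z: "Z \<in> toric_manifold P" for Z
      using orbits_close_total[OF m D Q h B less_imp_le[OF \<eta>] Z] orbits_close_mono \<eta>\<kappa> unfolding N_def by blast
    have total': "\<exists>Z'\<in>toric_manifold P. orbits_close Q ?i \<kappa> Z Z'" if Z: "Z \<in> toric_manifold Q" for Z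
      using orbits_close_total[OF mi Q D h' BQ less_imp_le[OF \<eta>] Z] orbits_close_mono \<eta>\<kappa> card unfolding N_def by fastforce
    \<comment> \<open>Any choice of a close orbit serves; neither continuity nor equivariance is
      asked of \<open>f\<close>.\<close>
    define f where "f X' = (SOME X. X \<in> toric_manifold P \<and> orbits_close P \<sigma> \<kappa> X X')" for X'
    have f: "f X' \<in> toric_manifold P" "orbits_close P \<sigma> \<kappa> (f X') X'" if X': "X' \<in> toric_manifold Q" for X'
    proof -
      have "\<exists>X. X \<in> toric_manifold P \<and> orbits_close P \<sigma> \<kappa> X X'" using total'[OF X'] unfolding orbits_close_inverse[OF m] by blast
      from someI_ex[OF this] show "f X' \<in> toric_manifold P" "orbits_close P \<sigma> \<kappa> (f X') X'" by (auto simp: f_def)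
    qed
    have near: "guillemin_dist P X X' < \<epsilon>"
      if X: "X \<in> toric_manifold P" "X' \<in> toric_manifold P" and Y: "Y \<in> toric_manifold Q"
        and cl: "orbits_close P \<sigma> \<kappa> X Y" "orbits_close P \<sigma> \<kappa> X' Y" for X X' Y
    proof -
      have "guillemin_dist P X X' \<le> (1 + \<omega>) * (2 * \<kappa>)"
        by (rule orbits_close_close_dist[OF m D locP _ X Y cl]) (use \<omega> \<kappa> r in auto)
      also have "\<dots> \<le> 2 * (2 * \<kappa>)" using \<omega> \<kappa>(1) by (intro mult_right_mono) auto
      also have "\<dots> < \<epsilon>" using \<kappa>4 e by linarith
      finally show ?thesis .
    qed
    have dist: "\<bar>guillemin_dist Q X' Y' - guillemin_dist P (f X') (f Y')\<bar> < \<epsilon>"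
      if X': "X' \<in> toric_manifold Q" and Y': "Y' \<in> toric_manifold Q" for X' Y'
    proof -
      have bd: "guillemin_dist P (f X') (f Y') \<le> K0" using K0(2) f X' Y' by blast
      have 1: "guillemin_dist Q X' Y' \<le> guillemin_dist P (f X') (f Y') + e / 4"
        by (rule guillemin_dist_estimate[where K = K and k = k, OF m D Q locQ])
          (use \<omega> \<kappa> K k e total f X' Y' bd in \<open>auto simp: K_def\<close>)
      \<comment> \<open>The estimate with exchanged roles needs a bound for distances on
        \<open>Q\<close>, which the first estimate has just provided.\<close>
      have 2: "guillemin_dist P (f X') (f Y') \<le> guillemin_dist Q X' Y' + e / 4"
      proof (rule guillemin_dist_estimate[where K = K and k = k, OF mi Q D locP])
        show "guillemin_dist Q X' Y' \<le> K - 1" using 1 bd e by (simp add: K_def)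
        show "orbits_close Q ?i \<kappa> X' (f X')" "orbits_close Q ?i \<kappa> Y' (f Y')"
          using f X' Y' by (simp_all only: orbits_close_inverse[OF m])
      qed (use \<omega> \<kappa> K k e total' f X' Y' in auto)
      show ?thesis using 1 2 e by linarith
    qed
    show "\<exists>f. GH_approximation P Q \<epsilon> f" unfolding GH_approximation_def
    proof (intro exI[of _ f] conjI ballI)
      show "f \<in> toric_manifold Q \<rightarrow> toric_manifold P" using f by blast
      show "\<bar>guillemin_dist Q X Y - guillemin_dist P (f X) (f Y)\<bar> < \<epsilon>"
        if "X \<in> toric_manifold Q" "Y \<in> toric_manifold Q" for X Y using dist that by blast
      show "\<exists>X\<in>toric_manifold Q. guillemin_dist P p (f X) < \<epsilon>" if p: "p \<in> toric_manifold P" for p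
        using total[OF p] near[OF p] f by blast
      fix X and g :: "(real ^ 'n) set" assume X: "X \<in> toric_manifold Q" and g: "g \<in> carrier torus"
      have act: "torus_action R g Z \<in> toric_manifold R" if R: "delzant R" and Z: "Z \<in> toric_manifold R"
        for R :: "(real ^ 'n) set" and Z
      proof -
        obtain \<theta> where \<theta>: "normal_map R \<theta> \<in> g" by (rule carrier_torus_angles[OF R g])
        show ?thesis unfolding torus_action_eq[OF Z \<theta> g] by (rule rotate_manifold[OF Z])
      qed
      note gX = act[OF Q X]
      show "guillemin_dist P (f (torus_action Q g X)) (torus_action P g (f X)) < \<epsilon>"
        by (rule near[OF f(1)[OF gX] act[OF D f(1)[OF X]] gX f(2)[OF gX]
              orbits_close_torus_action[OF m D g f(1)[OF X] X f(2)[OF X]]])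
    qed
  qed
qed

theorem theorem2:
  fixes Ps :: "nat \<Rightarrow> (real ^ 'n) set" and P :: "(real ^ 'n) set"
  assumes "\<And>i. delzant (Ps i)" and "delzant P"
    and "(\<lambda>i. hausdorff_dist (Ps i) P) \<longlonglongrightarrow> 0"
    and "(\<lambda>i. card (facets (Ps i))) \<longlonglongrightarrow> card (facets P)"
  shows "equivariant_GH_converges torus
           (\<lambda>i. toric_manifold (Ps i)) (\<lambda>i. guillemin_dist (Ps i)) (\<lambda>i. torus_action (Ps i))
           (toric_manifold P) (guillemin_dist P) (torus_action P)"
proof -
  \<comment> \<open>For each error there is an approximation at almost all indices, whereas one null
    sequence of errors is wanted. Taking \<open>\<epsilon> i\<close> within \<open>1 / Suc i\<close>
    of the infimum of the admissible errors gives it: eventually \<open>a / 2\<close> is admissible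
    and the margin is below \<open>a / 2\<close>.\<close>
  define S where "S i = {\<epsilon>. 0 < \<epsilon> \<and> (\<exists>f. GH_approximation P (Ps i) \<epsilon> f)}" for i
  have ev: "\<forall>\<^sub>F i in sequentially. \<epsilon> \<in> S i" if \<epsilon>: "0 < \<epsilon>" for \<epsilon>
  proof -
    obtain \<eta> where \<eta>: "\<eta> > 0" "\<forall>Q. delzant Q \<longrightarrow> hausdorff_dist Q P < \<eta> \<longrightarrow> card (facets Q) = card (facets P) \<longrightarrow>
      (\<exists>f. GH_approximation P Q \<epsilon> f)" using GH_approximation_exists[OF assms(2) \<epsilon>] by blast
    have "\<forall>\<^sub>F i in sequentially. hausdorff_dist (Ps i) P < \<eta>" using order_tendstoD(2)[OF assms(3) \<eta>(1)] .
    \<comment> \<open>Convergence of natural numbers is eventual equality.\<close>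
    moreover have "\<forall>\<^sub>F i in sequentially. card (facets (Ps i)) = card (facets P)"
      using assms(4) by (simp add: tendsto_discrete)
    ultimately show ?thesis by eventually_elim (use \<eta>(2) assms(1) \<epsilon> in \<open>auto simp: S_def\<close>)
  qed
  obtain X0 where X0: "X0 \<in> toric_manifold P" using toric_manifold_nonempty[OF assms(2)] by blast
  have bdd: "bdd_below (S i)" for i by (rule bdd_belowI[of _ 0]) (simp add: S_def)
  have "\<exists>\<epsilon> f. 0 < \<epsilon> \<and> f \<in> toric_manifold (Ps i) \<rightarrow> toric_manifold P \<and>
      (S i \<noteq> {} \<longrightarrow> \<epsilon> < Inf (S i) + 1 / real (Suc i) \<and> GH_approximation P (Ps i) \<epsilon> f)" for i
  proof (cases "S i = {}")
    \<comment> \<open>Arbitrary values; eventually 1 is an admissible error, so this happens for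
      finitely many \<open>i\<close> only.\<close>
    case True
    then show ?thesis using X0 by (intro exI[of _ 1] exI[of _ "\<lambda>_. X0"]) auto
  next
    case False
    have "Inf (S i) < Inf (S i) + 1 / real (Suc i)" by simp
    then obtain \<epsilon> where "\<epsilon> \<in> S i" "\<epsilon> < Inf (S i) + 1 / real (Suc i)" using cInf_lessD[OF False] by blast
    moreover from this obtain f where "0 < \<epsilon>" "GH_approximation P (Ps i) \<epsilon> f" unfolding S_def by blast
    ultimately show ?thesis by (intro exI[of _ \<epsilon>] exI[of _ f]) (simp add: GH_approximation_def)
  qed
  then obtain \<epsilon> f where \<epsilon>f: "\<And>i. 0 < \<epsilon> i \<and> f i \<in> toric_manifold (Ps i) \<rightarrow> toric_manifold P \<and>
      (S i \<noteq> {} \<longrightarrow> \<epsilon> i < Inf (S i) + 1 / real (Suc i) \<and> GH_approximation P (Ps i) (\<epsilon> i) (f i))" by metis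
  have lim: "\<epsilon> \<longlonglongrightarrow> 0"
  proof (rule order_tendstoI)
    show "\<forall>\<^sub>F i in sequentially. a < \<epsilon> i" if "a < 0" for a
    proof (rule always_eventually, rule allI)
      show "a < \<epsilon> i" for i using \<epsilon>f[of i] that by linarith
    qed
    show "\<forall>\<^sub>F i in sequentially. \<epsilon> i < a" if a: "0 < a" for a
    proof -
      have "\<forall>\<^sub>F i in sequentially. a / 2 \<in> S i" using ev a by simp
      moreover have "\<forall>\<^sub>F i in sequentially. 1 / real (Suc i) < a / 2"
        by (rule order_tendstoD(2)[OF lim_1_over_n[THEN LIMSEQ_Suc]]) (use a in simp)
      ultimately show ?thesis
      proof eventually_elim
        case (elim i)
        have "Inf (S i) \<le> a / 2" by (rule cInf_lower[OF elim(1) bdd])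
        then show ?case using \<epsilon>f[of i] elim by force
      qed
    qed
  qed
  \<comment> \<open>The torus and its lattice are the same for all polytopes, so no automorphism has
    to be chosen.\<close>
  have id: "(\<lambda>x. x) \<in> iso torus torus"
    by (auto simp: iso_def hom_def bij_betw_def group.is_monoid[OF torus_group] intro: monoid.m_closed[OF group.is_monoid[OF torus_group]])
  have appr: "\<forall>\<^sub>F i in sequentially. GH_approximation P (Ps i) (\<epsilon> i) (f i)"
    using ev[OF zero_less_one] by (rule eventually_mono) (use \<epsilon>f in blast)
  show ?thesis unfolding equivariant_GH_converges_def
  proof (intro conjI allI exI[of _ f] exI[of _ "\<lambda>i x. x"] exI[of _ \<epsilon>])
    show "compact_isometric_G_space torus (toric_manifold (Ps i)) (guillemin_dist (Ps i)) (torus_action (Ps i))" for i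
      by (rule guillemin_G_space[OF assms(1)])
    show "compact_isometric_G_space torus (toric_manifold P) (guillemin_dist P) (torus_action P)"
      by (rule guillemin_G_space[OF assms(2)])
    show "\<forall>\<^sub>F i in sequentially.
       (\<forall>x\<in>toric_manifold (Ps i). \<forall>y\<in>toric_manifold (Ps i). \<bar>guillemin_dist (Ps i) x y - guillemin_dist P (f i x) (f i y)\<bar> < \<epsilon> i) \<and>
       (\<forall>p\<in>toric_manifold P. \<exists>x\<in>toric_manifold (Ps i). guillemin_dist P p (f i x) < \<epsilon> i) \<and>
       (\<forall>x\<in>toric_manifold (Ps i). \<forall>g\<in>carrier torus. guillemin_dist P (f i (torus_action (Ps i) g x)) (torus_action P g (f i x)) < \<epsilon> i)"
      using appr by (rule eventually_mono) (simp add: GH_approximation_def)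
  qed (use \<epsilon>f lim id in auto)
qed

end
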